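(* Let $\mathcal C$ be a class of structures. (1) If $\mathcal C$ does not have bounded MSO width, then there exists a language $L \subseteq \mathcal C$ which is recognizable but not definable in MSO. (2) If there exists an MSO encoding of $\mathcal C$ into the class of trees, then every recognizable language $L \subseteq \mathcal C$ is definable in MSO (i.e. there is an MSO sentence over the vocabulary of $\mathcal C$ whose models in $\mathcal C$ are exactly $L$).
   Context: A vocabulary is a set of relation names, each with a type in $\{\text{element},\text{set}\}^*$ (each argument ranges over elements or over sets of elements). A structure consists of a finite nonempty universe and an interpretation of each relation name as a relation of the corresponding type. A class of structures is a class of structures over a common vocabulary that is closed under isomorphism. MSO always means monadic second-order logic extended with modulo-counting predicates "$|X|$ is divisible by $p$" for every $p\ge 2$. An MSO transduction is a binary relation between structures (closed under isomorphism) obtained by composing finitely many of: (i) MSO interpretations (a partial function given by a universe formula $\varphi(x)$ selecting the output universe among input elements, and for each output relation name an MSO formula of the same type defining it); (ii) filtering by an MSO sentence (identity on models of the sentence, undefined otherwise); (iii) $k$-copying (take $k$ disjoint copies of the input and add a $k$-ary relation containing exactly the tuples $(a_1,\dots,a_k)$ of the $k$ ordered copies of some input element); (iv) $k$-colouring (nondeterministically add $k$ unary relations partitioning the universe). For classes $\mathcal C,\mathcal D$, a $\mathcal C$-to-$\mathcal D$ MSO transduction is an MSO transduction from the vocabulary of $\mathcal C$ to that of $\mathcal D$ all of whose outputs on inputs from $\mathcal C$ lie in $\mathcal D$. An MSO encoding of $\mathcal C$ into $\mathcal D$ is a $\mathcal C$-to-$\mathcal D$ MSO transduction $f$ for which there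 is a $\mathcal D$-to-$\mathcal C$ MSO transduction $g$ such that $f$ followed by $g$ (relational composition) is the identity on $\mathcal C$ (up to isomorphism). "Trees" means finite rooted unranked unordered unlabelled trees, represented as structures whose universe is the set of nodes with a binary parent relation. A class $\mathcal C$ has bounded MSO width if there is an MSO transduction with inputs trees whose set of outputs contains $\mathcal C$. A language $L\subseteq\mathcal C$ (not necessarily MSO definable) is recognizable if for every trees-to-$\mathcal C$ MSO transduction $f$, the set of trees $t$ having some output of $f$ in $L$ is definable by an MSO sentence over trees.
   Formalization: Vocabularies are assumed finite; with infinitely many nullary relation names and one-element structures, part (1) fails, since MSO width is unbounded yet every recognizable language is MSO definable. *)

theory Defs
  imports "HOL-Library.Finite_Map"
begin

text \<open>
  Relation names are strings and universes are finite nonempty sets of natural numbers: these are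
  fixed infinite supplies of names and elements, so that every finite vocabulary and every finite
  structure occurs up to renaming, respectively up to isomorphism.  Vocabularies are finite.
\<close>

datatype arg_kind = KElem | KSet

type_synonym rel_name = string

type_synonym vocabulary = "(rel_name, arg_kind list) fmap"

datatype arg = Elem nat | SetArg "nat set"

record struct =
  universe :: "nat set"
  rel :: "rel_name \<Rightarrow> arg list set"

fun has_kind :: "nat set \<Rightarrow> arg \<Rightarrow> arg_kind \<Rightarrow> bool" where
  "has_kind U (Elem a) KElem \<longleftrightarrow> a \<in> U"
| "has_kind U (SetArg S) KSet \<longleftrightarrow> S \<subseteq> U"
| "has_kind U _ _ \<longleftrightarrow> False"

definition tuples :: "nat set \<Rightarrow> arg_kind list \<Rightarrow> arg list set" where
  "tuples U \<tau> = {args. list_all2 (has_kind U) args \<tau>}"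

text \<open>Names outside the vocabulary are interpreted by the empty relation, so that a structure
  carries no information beyond its universe and the relations of its vocabulary.\<close>

definition structures :: "vocabulary \<Rightarrow> struct set" where
  "structures V = {A. finite (universe A) \<and> universe A \<noteq> {} \<and>
     (\<forall>R. case fmlookup V R of
            None \<Rightarrow> rel A R = {}
          | Some \<tau> \<Rightarrow> rel A R \<subseteq> tuples (universe A) \<tau>)}"

fun map_arg :: "(nat \<Rightarrow> nat) \<Rightarrow> arg \<Rightarrow> arg" where
  "map_arg h (Elem a) = Elem (h a)"
| "map_arg h (SetArg S) = SetArg (h ` S)"

definition isomorphic :: "struct \<Rightarrow> struct \<Rightarrow> bool"  (infix "\<simeq>" 50) where
  "A \<simeq> B \<longleftrightarrow> (\<exists>h. bij_betw h (universe A) (universe B) \<and>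
     (\<forall>R. rel B R = map (map_arg h) ` rel A R))"

definition struct_class :: "vocabulary \<Rightarrow> struct set \<Rightarrow> bool" where
  "struct_class V C \<longleftrightarrow> C \<subseteq> structures V \<and> (\<forall>A\<in>C. \<forall>B\<in>structures V. A \<simeq> B \<longrightarrow> B \<in> C)"


subsection \<open>MSO with modulo counting\<close>

text \<open>Element and set variables share one supply of names; the kind of a variable is
  determined by its quantifier or, for free variables, by a context.  \<open>Divides p X\<close> is the
  predicate ``the size of \<open>X\<close> is divisible by \<open>p\<close>''.\<close>

datatype formula =
    Eq nat nat
  | Mem nat nat
  | Atom rel_name "nat list"
  | Divides nat nat
  | Neg formula
  | Conj formula formula
  | ExElem nat formula
  | ExSet nat formula

fun wf_formula :: "vocabulary \<Rightarrow> (nat \<rightharpoonup> arg_kind) \<Rightarrow> formula \<Rightarrow> bool" where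
  "wf_formula V \<Gamma> (Eq x y) \<longleftrightarrow> \<Gamma> x = Some KElem \<and> \<Gamma> y = Some KElem"
| "wf_formula V \<Gamma> (Mem x X) \<longleftrightarrow> \<Gamma> x = Some KElem \<and> \<Gamma> X = Some KSet"
| "wf_formula V \<Gamma> (Atom R xs) \<longleftrightarrow> (\<exists>\<tau>. fmlookup V R = Some \<tau> \<and> map \<Gamma> xs = map Some \<tau>)"
| "wf_formula V \<Gamma> (Divides p X) \<longleftrightarrow> 2 \<le> p \<and> \<Gamma> X = Some KSet"
| "wf_formula V \<Gamma> (Neg \<phi>) \<longleftrightarrow> wf_formula V \<Gamma> \<phi>"
| "wf_formula V \<Gamma> (Conj \<phi> \<psi>) \<longleftrightarrow> wf_formula V \<Gamma> \<phi> \<and> wf_formula V \<Gamma> \<psi>"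
| "wf_formula V \<Gamma> (ExElem x \<phi>) \<longleftrightarrow> wf_formula V (\<Gamma>(x \<mapsto> KElem)) \<phi>"
| "wf_formula V \<Gamma> (ExSet X \<phi>) \<longleftrightarrow> wf_formula V (\<Gamma>(X \<mapsto> KSet)) \<phi>"

fun sat :: "struct \<Rightarrow> (nat \<Rightarrow> arg) \<Rightarrow> formula \<Rightarrow> bool" where
  "sat A \<nu> (Eq x y) \<longleftrightarrow> \<nu> x = \<nu> y"
| "sat A \<nu> (Mem x X) \<longleftrightarrow> (\<exists>a S. \<nu> x = Elem a \<and> \<nu> X = SetArg S \<and> a \<in> S)"
| "sat A \<nu> (Atom R xs) \<longleftrightarrow> map \<nu> xs \<in> rel A R"
| "sat A \<nu> (Divides p X) \<longleftrightarrow> (\<exists>S. \<nu> X = SetArg S \<and> p dvd card S)"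
| "sat A \<nu> (Neg \<phi>) \<longleftrightarrow> \<not> sat A \<nu> \<phi>"
| "sat A \<nu> (Conj \<phi> \<psi>) \<longleftrightarrow> sat A \<nu> \<phi> \<and> sat A \<nu> \<psi>"
| "sat A \<nu> (ExElem x \<phi>) \<longleftrightarrow> (\<exists>a\<in>universe A. sat A (\<nu>(x := Elem a)) \<phi>)"
| "sat A \<nu> (ExSet X \<phi>) \<longleftrightarrow> (\<exists>S. S \<subseteq> universe A \<and> sat A (\<nu>(X := SetArg S)) \<phi>)"

text \<open>A formula of type \<open>\<tau>\<close> has free variables among \<open>0, \<dots>, length \<tau> - 1\<close>, of the kinds
  listed in \<open>\<tau>\<close>; values of other variables are irrelevant.\<close>

definition formula_of_type :: "vocabulary \<Rightarrow> arg_kind list \<Rightarrow> formula \<Rightarrow> bool" where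
  "formula_of_type V \<tau> \<phi> \<longleftrightarrow>
     wf_formula V (\<lambda>i. if i < length \<tau> then Some (\<tau> ! i) else None) \<phi>"

definition holds :: "struct \<Rightarrow> formula \<Rightarrow> arg list \<Rightarrow> bool" where
  "holds A \<phi> args \<longleftrightarrow> sat A (\<lambda>i. args ! i) \<phi>"

abbreviation sentence :: "vocabulary \<Rightarrow> formula \<Rightarrow> bool" where
  "sentence V \<phi> \<equiv> formula_of_type V [] \<phi>"

abbreviation models :: "struct \<Rightarrow> formula \<Rightarrow> bool"  (infix "\<Turnstile>" 50) where
  "A \<Turnstile> \<phi> \<equiv> holds A \<phi> []"


subsection \<open>MSO transductions\<close>

definition interpret_struct ::
    "vocabulary \<Rightarrow> formula \<Rightarrow> (rel_name \<Rightarrow> formula) \<Rightarrow> struct \<Rightarrow> struct" where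
  "interpret_struct W \<phi> \<psi> A =
     (let U = {a \<in> universe A. holds A \<phi> [Elem a]} in
      \<lparr>universe = U,
       rel = (\<lambda>R. case fmlookup W R of
                    None \<Rightarrow> {}
                  | Some \<tau> \<Rightarrow> {args \<in> tuples U \<tau>. holds A (\<psi> R) args})\<rparr>)"

text \<open>An interpretation is undefined on inputs for which the output universe would be empty.\<close>

definition interpretation_rel ::
    "vocabulary \<Rightarrow> vocabulary \<Rightarrow> formula \<Rightarrow> (rel_name \<Rightarrow> formula) \<Rightarrow> (struct \<times> struct) set" where
  "interpretation_rel V W \<phi> \<psi> =
     {(A, B). A \<in> structures V \<and> B \<in> structures W \<and> interpret_struct W \<phi> \<psi> A \<simeq> B}"

definition filter_rel :: "vocabulary \<Rightarrow> formula \<Rightarrow> (struct \<times> struct) set" where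
  "filter_rel V \<phi> = {(A, B). A \<in> structures V \<and> B \<in> structures V \<and> A \<Turnstile> \<phi> \<and> A \<simeq> B}"

text \<open>The map \<open>h i\<close> embeds the input as the \<open>i\<close>-th copy.  Relations of the input are inherited by
  each copy separately: all arguments of a tuple, including the set arguments, live in one copy.\<close>

definition copy_rel :: "vocabulary \<Rightarrow> nat \<Rightarrow> rel_name \<Rightarrow> (struct \<times> struct) set" where
  "copy_rel V k c = {(A, B). A \<in> structures V \<and>
     (\<exists>h. inj_on (\<lambda>(i, a). h i a) ({..<k} \<times> universe A) \<and>
        universe B = (\<Union>i<k. h i ` universe A) \<and>
        (\<forall>R. rel B R =
           (if R = c then (\<lambda>a. map (\<lambda>i. Elem (h i a)) [0..<k]) ` universe A
            else (\<Union>i<k. map (map_arg (h i)) ` rel A R))))}"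

text \<open>Colours may be unused, that is, parts of the partition may be empty.\<close>

definition colour_struct :: "rel_name list \<Rightarrow> (nat \<Rightarrow> rel_name) \<Rightarrow> struct \<Rightarrow> struct" where
  "colour_struct qs c A =
     A\<lparr>rel := (\<lambda>R. if R \<in> set qs then {[Elem a] | a. a \<in> universe A \<and> c a = R} else rel A R)\<rparr>"

definition colour_rel :: "vocabulary \<Rightarrow> rel_name list \<Rightarrow> (struct \<times> struct) set" where
  "colour_rel V qs = {(A, B). A \<in> structures V \<and>
     (\<exists>c. c ` universe A \<subseteq> set qs \<and> colour_struct qs c A \<simeq> B)}"

inductive mso_transduction ::
    "vocabulary \<Rightarrow> vocabulary \<Rightarrow> (struct \<times> struct) set \<Rightarrow> bool" where
  mso_interpretation:
    "formula_of_type V [KElem] \<phi> \<Longrightarrow>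
     (\<And>R \<tau>. fmlookup W R = Some \<tau> \<Longrightarrow> formula_of_type V \<tau> (\<psi> R)) \<Longrightarrow>
     mso_transduction V W (interpretation_rel V W \<phi> \<psi>)"
| mso_filtering:
    "sentence V \<phi> \<Longrightarrow> mso_transduction V V (filter_rel V \<phi>)"
| mso_copying:
    "1 \<le> k \<Longrightarrow> c \<notin> fmdom' V \<Longrightarrow>
     mso_transduction V (fmupd c (replicate k KElem) V) (copy_rel V k c)"
| mso_colouring:
    "1 \<le> length qs \<Longrightarrow> distinct qs \<Longrightarrow> set qs \<inter> fmdom' V = {} \<Longrightarrow>
     mso_transduction V (V ++\<^sub>f fmap_of_list (map (\<lambda>q. (q, [KElem])) qs)) (colour_rel V qs)"
| mso_composition:
    "mso_transduction V W f \<Longrightarrow> mso_transduction W X g \<Longrightarrow> mso_transduction V X (f O g)"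

definition class_transduction ::
    "vocabulary \<Rightarrow> struct set \<Rightarrow> vocabulary \<Rightarrow> struct set \<Rightarrow> (struct \<times> struct) set \<Rightarrow> bool" where
  "class_transduction V C W D f \<longleftrightarrow> mso_transduction V W f \<and> f `` C \<subseteq> D"

definition mso_encoding ::
    "vocabulary \<Rightarrow> struct set \<Rightarrow> vocabulary \<Rightarrow> struct set \<Rightarrow> (struct \<times> struct) set \<Rightarrow> bool" where
  "mso_encoding V C W D f \<longleftrightarrow> class_transduction V C W D f \<and>
     (\<exists>g. class_transduction W D V C g \<and> (\<forall>A\<in>C. \<forall>B. (A, B) \<in> f O g \<longleftrightarrow> A \<simeq> B))"


subsection \<open>Trees, width, recognizability, definability\<close>

definition tree_vocab :: vocabulary where
  "tree_vocab = fmap_of_list [(''parent'', [KElem, KElem])]"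

text \<open>A pair \<open>(x, y)\<close> in the parent relation means that \<open>y\<close> is the parent of \<open>x\<close>.\<close>

definition parent_pairs :: "struct \<Rightarrow> (nat \<times> nat) set" where
  "parent_pairs t = {(x, y). [Elem x, Elem y] \<in> rel t ''parent''}"

definition trees :: "struct set" where
  "trees = {t \<in> structures tree_vocab. \<exists>r\<in>universe t.
     (\<forall>y. (r, y) \<notin> parent_pairs t) \<and>
     (\<forall>x\<in>universe t - {r}. \<exists>!y. (x, y) \<in> parent_pairs t) \<and>
     (\<forall>x\<in>universe t. (x, r) \<in> (parent_pairs t)\<^sup>*)}"

definition bounded_mso_width :: "vocabulary \<Rightarrow> struct set \<Rightarrow> bool" where
  "bounded_mso_width V C \<longleftrightarrow> (\<exists>f. mso_transduction tree_vocab V f \<and> C \<subseteq> f `` trees)"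

text \<open>Languages are isomorphism-closed, like all classes of structures.\<close>

definition language :: "vocabulary \<Rightarrow> struct set \<Rightarrow> struct set \<Rightarrow> bool" where
  "language V C L \<longleftrightarrow> struct_class V L \<and> L \<subseteq> C"

definition mso_definable :: "vocabulary \<Rightarrow> struct set \<Rightarrow> struct set \<Rightarrow> bool" where
  "mso_definable V C L \<longleftrightarrow> (\<exists>\<phi>. sentence V \<phi> \<and> L = {A \<in> C. A \<Turnstile> \<phi>})"

definition recognizable :: "vocabulary \<Rightarrow> struct set \<Rightarrow> struct set \<Rightarrow> bool" where
  "recognizable V C L \<longleftrightarrow> (\<forall>f. class_transduction tree_vocab trees V C f \<longrightarrow>
     mso_definable tree_vocab trees {t \<in> trees. \<exists>A\<in>L. (t, A) \<in> f})"

end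

theory Submission
  imports Defs
begin

text \<open>
  Everything rests on the backwards translation: for a transduction \<open>f\<close> and a sentence \<open>\<chi>\<close>, the structures
  that have some output satisfying \<open>\<chi>\<close> are definable.  For the second implication, apply it to the encoding
  and to a sentence defining the set of trees that decode into \<open>L\<close>.

  For the first implication, the classes of bounded width form an ideal that contains the isomorphism
  class of every single structure, and there are countably many transductions \<open>f\<^sub>0, f\<^sub>1, \<dots>\<close> from
  trees.  If \<open>C\<close> is not in this ideal, one can choose pairwise non-isomorphic structures \<open>A\<^sub>i\<close> in \<open>C\<close>
  such that \<open>A\<^sub>i\<close> is not an output of \<open>f\<^sub>0, \<dots>, f\<^sub>i\<close>.  For every set \<open>S\<close> of numbers, the language of all
  \<open>A\<^sub>i\<close> with \<open>i \<in> S\<close> is recognizable, because each \<open>f\<^sub>m\<close> sees only finitely many of its structures; but there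
  are uncountably many such languages and only countably many sentences.
\<close>

subsection \<open>Isomorphisms and satisfaction\<close>

text \<open>A transduction is a chain of steps through changing vocabularies, with no means of
  branching, so closure under unions is the laborious part of the ideal property. Branching is
  simulated in a disjoint sum of vocabularies: a two-colouring of the tree guesses which chain is to
  run, a flag records the guess, and each chain is modified so that it computes on one side of the
  sum and returns the structures of the other side unchanged. A single structure comes from a tree
  with equally many nodes: one colour per node makes every element definable, so the interpreting
  formulas can list the tuples. The backwards translation treats all nontrivial steps alike: the
  output consists of \<open>k\<close> copies of input elements coded as numbers, a set in it is
  given by \<open>k\<close> sets of the input, and divisibility survives because the residue of a
  sum depends only on the residues of the summands. Isomorphism types of finite structures are
  definable, which turns the finitely many structures met by a transduction into a definable set of
  trees.\<close>

lemma map_arg_comp: "map_arg g (map_arg h a) = map_arg (g \<circ> h) a"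
  by (cases a) (auto simp: image_comp)

lemma map_map_arg_comp: "map (map_arg g) (map (map_arg h) as) = map (map_arg (g \<circ> h)) as"
  by (simp add: map_arg_comp)

lemma map_arg_cong:
  assumes "has_kind U a \<kappa>" "\<And>x. x \<in> U \<Longrightarrow> g x = h x"
  shows "map_arg g a = map_arg h a"
  using assms by (cases a; cases \<kappa>) (auto simp: subset_iff cong: image_cong_simp intro!: image_cong)

lemma tuples_map_arg_cong:
  assumes "as \<in> tuples U \<tau>" "\<And>x. x \<in> U \<Longrightarrow> g x = h x"
  shows "map (map_arg g) as = map (map_arg h) as"
proof (rule map_cong[OF refl])
  fix a assume "a \<in> set as"
  then obtain \<kappa> where "has_kind U a \<kappa>"
    using assms(1) unfolding tuples_def by (auto simp: list_all2_conv_all_nth in_set_conv_nth)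
  then show "map_arg g a = map_arg h a" using assms(2) by (rule map_arg_cong)
qed

lemma tuples_map_arg_id:
  assumes "as \<in> tuples U \<tau>" "\<And>x. x \<in> U \<Longrightarrow> g x = x"
  shows "map (map_arg g) as = as"
proof -
  have "map_arg id = id" by (rule ext, rename_tac a, case_tac a) auto
  then show ?thesis using tuples_map_arg_cong[OF assms(1), of g id] assms(2) by simp
qed

lemma has_kind_map_arg:
  "has_kind U a \<kappa> \<Longrightarrow> h ` U \<subseteq> U' \<Longrightarrow> has_kind U' (map_arg h a) \<kappa>"
  by (cases a; cases \<kappa>) auto

lemma tuples_map_arg:
  "as \<in> tuples U \<tau> \<Longrightarrow> h ` U \<subseteq> U' \<Longrightarrow> map (map_arg h) as \<in> tuples U' \<tau>"
  unfolding tuples_def by (auto simp: list_all2_conv_all_nth intro: has_kind_map_arg)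

lemma structuresI:
  assumes "finite (universe A)" "universe A \<noteq> {}"
    "\<And>R. fmlookup V R = None \<Longrightarrow> rel A R = {}"
    "\<And>R \<tau>. fmlookup V R = Some \<tau> \<Longrightarrow> rel A R \<subseteq> tuples (universe A) \<tau>"
  shows "A \<in> structures V"
  using assms unfolding structures_def by (auto split: option.splits)

lemma structuresD:
  assumes "A \<in> structures V"
  shows "finite (universe A)" "universe A \<noteq> {}"
    "\<And>R. fmlookup V R = None \<Longrightarrow> rel A R = {}"
    "\<And>R \<tau>. fmlookup V R = Some \<tau> \<Longrightarrow> rel A R \<subseteq> tuples (universe A) \<tau>"
proof -
  have "case fmlookup V R of None \<Rightarrow> rel A R = {} | Some \<tau> \<Rightarrow> rel A R \<subseteq> tuples (universe A) \<tau>" for R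
    using assms unfolding structures_def by blast
  then show "\<And>R. fmlookup V R = None \<Longrightarrow> rel A R = {}"
    "\<And>R \<tau>. fmlookup V R = Some \<tau> \<Longrightarrow> rel A R \<subseteq> tuples (universe A) \<tau>"
    by (metis option.simps(4), metis option.simps(5))
qed (use assms in \<open>simp_all add: structures_def\<close>)

lemma rel_tuples:
  assumes "A \<in> structures V" "as \<in> rel A R"
  obtains \<tau> where "fmlookup V R = Some \<tau>" "as \<in> tuples (universe A) \<tau>"
  using structuresD(3,4)[OF assms(1), of R] assms(2) by (cases "fmlookup V R") auto

lemma rel_image_comp:
  "map (map_arg g) ` (map (map_arg h) ` X) = map (map_arg (g \<circ> h)) ` X"
  by (simp add: image_image map_arg_comp comp_def)

lemma iso_refl: "A \<simeq> A"
proof -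
  have "map_arg id = id" by (rule ext, rename_tac a, case_tac a) auto
  then show ?thesis unfolding isomorphic_def by (intro exI[of _ id]) auto
qed

lemma iso_sym:
  assumes A: "A \<in> structures V" and iso: "A \<simeq> B"
  shows "B \<simeq> A"
proof -
  obtain h where h: "bij_betw h (universe A) (universe B)"
    "\<And>R. rel B R = map (map_arg h) ` rel A R" using iso unfolding isomorphic_def by auto
  let ?g = "inv_into (universe A) h"
  have "rel A R = map (map_arg ?g) ` rel B R" for R
  proof -
    have "map (map_arg ?g) (map (map_arg h) as) = as" if as: "as \<in> rel A R" for as
    proof -
      obtain \<tau> where "as \<in> tuples (universe A) \<tau>" using rel_tuples[OF A as] by blast
      then show ?thesis unfolding map_map_arg_comp
        by (rule tuples_map_arg_id) (use h(1) in \<open>auto simp: bij_betw_def\<close>)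
    qed
    then show ?thesis unfolding h(2) image_image by simp
  qed
  moreover have "bij_betw ?g (universe B) (universe A)" by (rule bij_betw_inv_into[OF h(1)])
  ultimately show ?thesis unfolding isomorphic_def by blast
qed

lemma iso_trans:
  assumes "A \<simeq> B" "B \<simeq> D"
  shows "A \<simeq> D"
proof -
  obtain g h where "bij_betw h (universe A) (universe B)"
    "\<And>R. rel B R = map (map_arg h) ` rel A R"
    "bij_betw g (universe B) (universe D)"
    "\<And>R. rel D R = map (map_arg g) ` rel B R" using assms unfolding isomorphic_def by blast
  then show ?thesis unfolding isomorphic_def
    by (intro exI[of _ "g \<circ> h"]) (auto simp: bij_betw_trans rel_image_comp)
qed

lemma iso_structures:
  assumes A: "A \<in> structures V" and iso: "A \<simeq> B"
  shows "B \<in> structures V"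
proof -
  obtain h where h: "bij_betw h (universe A) (universe B)"
    "\<And>R. rel B R = map (map_arg h) ` rel A R" using iso unfolding isomorphic_def by auto
  have im: "h ` universe A = universe B" using h(1) by (simp add: bij_betw_def)
  show ?thesis
  proof (rule structuresI)
    show "finite (universe B)" using structuresD(1)[OF A] im by (metis finite_imageI)
    show "universe B \<noteq> {}" using structuresD(2)[OF A] im by auto
    show "rel B R = {}" if "fmlookup V R = None" for R using structuresD(3)[OF A that] h(2) by auto
    show "rel B R \<subseteq> tuples (universe B) \<tau>" if "fmlookup V R = Some \<tau>" for R \<tau>
      using structuresD(4)[OF A that] tuples_map_arg[of _ "universe A" \<tau> h "universe B"] im h(2) by auto
  qed
qed

lemma interpret_struct_structures:
  assumes "A \<in> structures V" "universe (interpret_struct W \<phi> \<psi> A) \<noteq> {}"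
  shows "interpret_struct W \<phi> \<psi> A \<in> structures W"
  using assms structuresD(1)[OF assms(1)]
  by (intro structuresI) (auto simp: interpret_struct_def Let_def)

definition fits :: "struct \<Rightarrow> (nat \<rightharpoonup> arg_kind) \<Rightarrow> (nat \<Rightarrow> arg) \<Rightarrow> bool" where
  "fits A \<Gamma> \<nu> \<longleftrightarrow> (\<forall>x \<kappa>. \<Gamma> x = Some \<kappa> \<longrightarrow> has_kind (universe A) (\<nu> x) \<kappa>)"

lemma fits_upd:
  "fits A \<Gamma> \<nu> \<Longrightarrow> has_kind (universe A) v \<kappa> \<Longrightarrow> fits A (\<Gamma>(x \<mapsto> \<kappa>)) (\<nu>(x := v))"
  by (auto simp: fits_def)

lemma fitsD: "fits A \<Gamma> \<nu> \<Longrightarrow> \<Gamma> x = Some \<kappa> \<Longrightarrow> has_kind (universe A) (\<nu> x) \<kappa>"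
  by (auto simp: fits_def)

lemma fits_tuple:
  assumes "fits A \<Gamma> \<nu>" "map \<Gamma> xs = map Some \<tau>"
  shows "map \<nu> xs \<in> tuples (universe A) \<tau>"
proof -
  have "length xs = length \<tau>" using assms(2) by (metis length_map)
  moreover have "\<Gamma> (xs ! i) = Some (\<tau> ! i)" if "i < length \<tau>" for i
    using assms(2) that \<open>length xs = length \<tau>\<close> by (metis nth_map)
  ultimately show ?thesis using assms(1) unfolding tuples_def
    by (auto simp: list_all2_conv_all_nth fits_def)
qed

lemma has_kind_KElem: "has_kind U v KElem \<longleftrightarrow> (\<exists>a\<in>U. v = Elem a)"
  by (cases v) auto

lemma has_kind_KSet: "has_kind U v KSet \<longleftrightarrow> (\<exists>S. S \<subseteq> U \<and> v = SetArg S)"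
  by (cases v) auto

lemma wf_formula_mono: "wf_formula V \<Gamma> \<phi> \<Longrightarrow> \<Gamma> \<subseteq>\<^sub>m \<Gamma>' \<Longrightarrow> wf_formula V \<Gamma>' \<phi>"
proof (induction \<phi> arbitrary: \<Gamma> \<Gamma>')
  case (Atom R xs)
  then obtain \<tau> where \<tau>: "fmlookup V R = Some \<tau>" "map \<Gamma> xs = map Some \<tau>" by auto
  have "map \<Gamma>' xs = map \<Gamma> xs"
  proof (rule map_cong[OF refl])
    fix x assume "x \<in> set xs"
    then have "\<Gamma> x \<in> Some ` set \<tau>" using \<tau>(2) by (metis image_eqI list.set_map)
    then show "\<Gamma>' x = \<Gamma> x" using Atom(2) by (auto simp: map_le_def dom_def)
  qed
  then show ?case using \<tau> by auto
qed (force simp: map_le_def dom_def)+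

lemma sat_cong:
  "wf_formula V \<Gamma> \<phi> \<Longrightarrow> (\<And>x. x \<in> dom \<Gamma> \<Longrightarrow> \<nu> x = \<nu>' x) \<Longrightarrow> sat A \<nu> \<phi> \<longleftrightarrow> sat A \<nu>' \<phi>"
proof (induction \<phi> arbitrary: \<Gamma> \<nu> \<nu>')
  case (Atom R xs)
  then obtain \<tau> where \<tau>: "map \<Gamma> xs = map Some \<tau>" by auto
  have "map \<nu> xs = map \<nu>' xs"
  proof (rule map_cong[OF refl])
    fix x assume "x \<in> set xs"
    then have "\<Gamma> x \<in> Some ` set \<tau>" using \<tau> by (metis image_eqI list.set_map)
    then show "\<nu> x = \<nu>' x" using Atom(2) by auto
  qed
  then show ?case by (simp only: sat.simps)
next
  case (Eq x y) then show ?case by (simp add: domI)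
next
  case (Mem x y) then show ?case by (simp add: domI)
next
  case (Divides x y) then show ?case by (simp add: domI)
next
  case (Neg \<phi>)
  have "sat A \<nu> \<phi> \<longleftrightarrow> sat A \<nu>' \<phi>" using Neg.prems by (intro Neg.IH) auto
  then show ?case by simp
next
  case (Conj \<phi> \<psi>)
  have "sat A \<nu> \<phi> \<longleftrightarrow> sat A \<nu>' \<phi>" "sat A \<nu> \<psi> \<longleftrightarrow> sat A \<nu>' \<psi>"
    using Conj.prems by (auto intro!: Conj.IH simp del: sat.simps)
  then show ?case by simp
next
  case (ExElem x \<phi>)
  have "sat A (\<nu>(x := Elem a)) \<phi> \<longleftrightarrow> sat A (\<nu>'(x := Elem a)) \<phi>" for a
  proof (rule ExElem.IH)
    show "wf_formula V (\<Gamma>(x \<mapsto> KElem)) \<phi>" using ExElem.prems(1) by simp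
    show "(\<nu>(x := Elem a)) z = (\<nu>'(x := Elem a)) z" if "z \<in> dom (\<Gamma>(x \<mapsto> KElem))" for z
      using that ExElem.prems(2)[of z] by (cases "z = x") auto
  qed
  then show ?case by simp
next
  case (ExSet x \<phi>)
  have "sat A (\<nu>(x := SetArg a)) \<phi> \<longleftrightarrow> sat A (\<nu>'(x := SetArg a)) \<phi>" for a
  proof (rule ExSet.IH)
    show "wf_formula V (\<Gamma>(x \<mapsto> KSet)) \<phi>" using ExSet.prems(1) by simp
    show "(\<nu>(x := SetArg a)) z = (\<nu>'(x := SetArg a)) z" if "z \<in> dom (\<Gamma>(x \<mapsto> KSet))" for z
      using that ExSet.prems(2)[of z] by (cases "z = x") auto
  qed
  then show ?case by simp
qed

lemma map_arg_inj:
  assumes "inj_on h U" "has_kind U a \<kappa>" "has_kind U b \<kappa>" "map_arg h a = map_arg h b"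
  shows "a = b"
  using assms by (cases a; cases b; cases \<kappa>) (auto simp: inj_on_def inj_on_image_eq_iff)

lemma tuples_map_arg_inj:
  assumes "inj_on h U" "as \<in> tuples U \<tau>" "bs \<in> tuples U \<tau>" "map (map_arg h) as = map (map_arg h) bs"
  shows "as = bs"
proof (rule nth_equalityI)
  show l: "length as = length bs" using assms(4) by (metis length_map)
  fix i assume i: "i < length as"
  have "has_kind U (as ! i) (\<tau> ! i)" "has_kind U (bs ! i) (\<tau> ! i)"
    using assms(2,3) i l by (auto simp: tuples_def list_all2_conv_all_nth)
  moreover have "map_arg h (as ! i) = map_arg h (bs ! i)" using assms(4) i l by (metis nth_map)
  ultimately show "as ! i = bs ! i" using map_arg_inj[OF assms(1)] by blast
qed

text \<open>Free variables are allowed because the induction passes under quantifiers. Pulling an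
  atom back from \<open>B\<close> needs injectivity of \<open>map (map_arg h)\<close>, which holds
  only on tuples over the universe of \<open>A\<close>; \<open>fits\<close> and well-formedness
  supply this. For set quantifiers, every subset of the universe of \<open>B\<close> is the image of
  a subset of that of \<open>A\<close>.\<close>

lemma sat_iso:
  assumes A: "A \<in> structures V" and bij: "bij_betw h (universe A) (universe B)"
    and rel: "\<And>R. rel B R = map (map_arg h) ` rel A R"
  shows "wf_formula V \<Gamma> \<phi> \<Longrightarrow> fits A \<Gamma> \<nu> \<Longrightarrow> sat A \<nu> \<phi> \<longleftrightarrow> sat B (map_arg h \<circ> \<nu>) \<phi>"
proof (induction \<phi> arbitrary: \<Gamma> \<nu>)
  have inj: "inj_on h (universe A)" and im: "h ` universe A = universe B"
    using bij by (auto simp: bij_betw_def)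
  {
    case (Eq x y)
    then have "has_kind (universe A) (\<nu> x) KElem" "has_kind (universe A) (\<nu> y) KElem"
      by (auto simp: fits_def)
    then show ?case by (auto simp: has_kind_KElem dest: inj_onD[OF inj])
  next
    case (Mem x X)
    then have "has_kind (universe A) (\<nu> x) KElem" "has_kind (universe A) (\<nu> X) KSet"
      by (auto simp: fits_def)
    then obtain a S where "a \<in> universe A" "S \<subseteq> universe A" "\<nu> x = Elem a" "\<nu> X = SetArg S"
      by (auto simp: has_kind_KElem has_kind_KSet)
    then show ?case by (simp add: inj_on_image_mem_iff[OF inj])
  next
    case (Atom R xs)
    then obtain \<tau> where \<tau>: "fmlookup V R = Some \<tau>" "map \<Gamma> xs = map Some \<tau>" by auto
    have t: "map \<nu> xs \<in> tuples (universe A) \<tau>" using fits_tuple[OF Atom(2) \<tau>(2)] .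
    have "map \<nu> xs \<in> rel A R" if "map (map_arg h) (map \<nu> xs) \<in> rel B R"
    proof -
      obtain as where as: "as \<in> rel A R" "map (map_arg h) (map \<nu> xs) = map (map_arg h) as"
        using \<open>map (map_arg h) (map \<nu> xs) \<in> rel B R\<close> unfolding assms(3) by blast
      have "as \<in> tuples (universe A) \<tau>" using structuresD(4)[OF A \<tau>(1)] as(1) by auto
      then show ?thesis using tuples_map_arg_inj[OF inj t _ as(2)] as(1) by simp
    qed
    moreover have "map (map_arg h) (map \<nu> xs) \<in> rel B R" if "map \<nu> xs \<in> rel A R"
      unfolding assms(3) using that by (rule imageI)
    moreover have "map (map_arg h \<circ> \<nu>) xs = map (map_arg h) (map \<nu> xs)" by simp
    ultimately show ?case unfolding sat.simps by metis
  next
    case (Divides p X)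
    then have "has_kind (universe A) (\<nu> X) KSet" by (auto simp: fits_def)
    then obtain S where "S \<subseteq> universe A" "\<nu> X = SetArg S" by (auto simp: has_kind_KSet)
    then show ?case using card_image[OF inj_on_subset[OF inj]] by auto
  next
    case (Neg \<phi>) then show ?case by auto
  next
    case (Conj \<phi> \<psi>) then show ?case by auto
  next
    case (ExElem x \<phi>)
    have "sat A (\<nu>(x := Elem a)) \<phi> \<longleftrightarrow> sat B ((map_arg h \<circ> \<nu>)(x := Elem (h a))) \<phi>"
      if "a \<in> universe A" for a
      using ExElem.IH[of "\<Gamma>(x \<mapsto> KElem)" "\<nu>(x := Elem a)"] ExElem.prems fits_upd[of A \<Gamma> \<nu> "Elem a" KElem x] that
      by (simp add: fun_upd_comp del: fun_upd_apply)
    then show ?case by (simp add: im[symmetric] comp_def)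
  next
    case (ExSet x \<phi>)
    have *: "sat A (\<nu>(x := SetArg S)) \<phi> \<longleftrightarrow> sat B ((map_arg h \<circ> \<nu>)(x := SetArg (h ` S))) \<phi>"
      if "S \<subseteq> universe A" for S
      using ExSet.IH[of "\<Gamma>(x \<mapsto> KSet)" "\<nu>(x := SetArg S)"] ExSet.prems fits_upd[of A \<Gamma> \<nu> "SetArg S" KSet x] that
      by (simp add: fun_upd_comp del: fun_upd_apply)
    show ?case
    proof
      assume "sat A \<nu> (ExSet x \<phi>)"
      then obtain S where "S \<subseteq> universe A" "sat A (\<nu>(x := SetArg S)) \<phi>" by auto
      then show "sat B (map_arg h \<circ> \<nu>) (ExSet x \<phi>)" using * im
        by (auto intro!: exI[of _ "h ` S"])
    next
      assume "sat B (map_arg h \<circ> \<nu>) (ExSet x \<phi>)"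
      then obtain S where "S \<subseteq> universe A" "sat B ((map_arg h \<circ> \<nu>)(x := SetArg (h ` S))) \<phi>"
        unfolding im[symmetric] sat.simps subset_image_iff by auto
      then show "sat A \<nu> (ExSet x \<phi>)" using * by auto
    qed
  }
qed

definition typed :: "arg_kind list \<Rightarrow> nat \<rightharpoonup> arg_kind" where
  "typed \<tau> = (\<lambda>i. if i < length \<tau> then Some (\<tau> ! i) else None)"

lemma formula_of_type_typed: "formula_of_type V \<tau> \<phi> \<longleftrightarrow> wf_formula V (typed \<tau>) \<phi>"
  by (simp add: formula_of_type_def typed_def)

lemma typed_Nil [simp]: "typed [] = Map.empty"
  by (simp add: typed_def)

lemma models_sat: "sentence V \<phi> \<Longrightarrow> A \<Turnstile> \<phi> \<longleftrightarrow> sat A \<nu> \<phi>"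
  unfolding holds_def formula_of_type_typed by (rule sat_cong) auto

lemma models_iso:
  assumes "A \<in> structures V" "A \<simeq> B" "sentence V \<phi>"
  shows "A \<Turnstile> \<phi> \<longleftrightarrow> B \<Turnstile> \<phi>"
proof -
  obtain h where h: "bij_betw h (universe A) (universe B)"
    "\<And>R. rel B R = map (map_arg h) ` rel A R" using assms(2) unfolding isomorphic_def by auto
  have "sat A \<nu> \<phi> \<longleftrightarrow> sat B (map_arg h \<circ> \<nu>) \<phi>" for \<nu>
    using assms(3) by (intro sat_iso[OF assms(1) h, of "typed []"])
      (auto simp: formula_of_type_typed fits_def)
  then show ?thesis using models_sat[OF assms(3)] by metis
qed

subsection \<open>Definable predicates\<close>

text \<open>A semantic substitute for formulas: closure properties are applied as rules, so large
  formulas are never written down and well-formedness comes along. Agreement is asked only on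
  structures over \<open>V\<close> and on valuations of the declared kinds.\<close>

definition definable ::
    "vocabulary \<Rightarrow> (nat \<rightharpoonup> arg_kind) \<Rightarrow> (struct \<Rightarrow> (nat \<Rightarrow> arg) \<Rightarrow> bool) \<Rightarrow> bool" where
  "definable V \<Gamma> P \<longleftrightarrow> (\<exists>\<phi>. wf_formula V \<Gamma> \<phi> \<and>
     (\<forall>A\<in>structures V. \<forall>\<nu>. fits A \<Gamma> \<nu> \<longrightarrow> (sat A \<nu> \<phi> \<longleftrightarrow> P A \<nu>)))"

lemma definableI:
  assumes "wf_formula V \<Gamma> \<phi>"
    "\<And>A \<nu>. A \<in> structures V \<Longrightarrow> fits A \<Gamma> \<nu> \<Longrightarrow> sat A \<nu> \<phi> \<longleftrightarrow> P A \<nu>"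
  shows "definable V \<Gamma> P"
  using assms unfolding definable_def by blast

lemma definableE:
  assumes "definable V \<Gamma> P"
  obtains \<phi> where "wf_formula V \<Gamma> \<phi>"
    "\<And>A \<nu>. A \<in> structures V \<Longrightarrow> fits A \<Gamma> \<nu> \<Longrightarrow> sat A \<nu> \<phi> \<longleftrightarrow> P A \<nu>"
  using assms unfolding definable_def by auto

lemma definable_cong:
  assumes "definable V \<Gamma> P"
    "\<And>A \<nu>. A \<in> structures V \<Longrightarrow> fits A \<Gamma> \<nu> \<Longrightarrow> P A \<nu> \<longleftrightarrow> Q A \<nu>"
  shows "definable V \<Gamma> Q"
  using assms unfolding definable_def by metis

lemma definable_mono:
  assumes "definable V \<Gamma> P" "\<Gamma> \<subseteq>\<^sub>m \<Gamma>'"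
  shows "definable V \<Gamma>' P"
proof -
  obtain \<phi> where \<phi>: "wf_formula V \<Gamma> \<phi>"
    "\<And>A \<nu>. A \<in> structures V \<Longrightarrow> fits A \<Gamma> \<nu> \<Longrightarrow> sat A \<nu> \<phi> \<longleftrightarrow> P A \<nu>"
    by (rule definableE[OF assms(1)], rule that)
  have "fits A \<Gamma> \<nu>" if "fits A \<Gamma>' \<nu>" for A \<nu>
    using that assms(2) unfolding fits_def map_le_def dom_def by (metis (mono_tags, lifting) mem_Collect_eq option.distinct(1))
  then show ?thesis using \<phi> wf_formula_mono[OF _ assms(2)] by (intro definableI[of _ _ \<phi>]) auto
qed

lemma definable_neg: "definable V \<Gamma> P \<Longrightarrow> definable V \<Gamma> (\<lambda>A \<nu>. \<not> P A \<nu>)"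
  unfolding definable_def
  by (elim exE, rule_tac x = "Neg \<phi>" in exI) auto

lemma definable_conj:
  "definable V \<Gamma> P \<Longrightarrow> definable V \<Gamma> Q \<Longrightarrow> definable V \<Gamma> (\<lambda>A \<nu>. P A \<nu> \<and> Q A \<nu>)"
  unfolding definable_def
  by (elim exE, rule_tac x = "Conj \<phi> \<phi>'" in exI) auto

lemma definable_disj:
  assumes "definable V \<Gamma> P" "definable V \<Gamma> Q"
  shows "definable V \<Gamma> (\<lambda>A \<nu>. P A \<nu> \<or> Q A \<nu>)"
  by (rule definable_cong[OF definable_neg[OF definable_conj[OF assms[THEN definable_neg]]]]) auto

lemma definable_imp:
  assumes "definable V \<Gamma> P" "definable V \<Gamma> Q"
  shows "definable V \<Gamma> (\<lambda>A \<nu>. P A \<nu> \<longrightarrow> Q A \<nu>)"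
  by (rule definable_cong[OF definable_disj[OF definable_neg[OF assms(1)] assms(2)]]) auto

lemma definable_iff:
  assumes "definable V \<Gamma> P" "definable V \<Gamma> Q"
  shows "definable V \<Gamma> (\<lambda>A \<nu>. P A \<nu> \<longleftrightarrow> Q A \<nu>)"
  by (rule definable_cong[OF definable_conj[OF definable_imp[OF assms] definable_imp[OF assms(2,1)]]]) auto

lemma definable_ex:
  assumes "definable V (\<Gamma>(x \<mapsto> \<kappa>)) P"
  shows "definable V \<Gamma> (\<lambda>A \<nu>. \<exists>v. has_kind (universe A) v \<kappa> \<and> P A (\<nu>(x := v)))"
proof (rule definableE[OF assms])
  fix \<phi> assume \<phi>: "wf_formula V (\<Gamma>(x \<mapsto> \<kappa>)) \<phi>"
    "\<And>A \<nu>. A \<in> structures V \<Longrightarrow> fits A (\<Gamma>(x \<mapsto> \<kappa>)) \<nu> \<Longrightarrow> sat A \<nu> \<phi> \<longleftrightarrow> P A \<nu>"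
  show ?thesis
  proof (cases \<kappa>)
    case KElem
    then show ?thesis using \<phi> fits_upd[of _ _ _ _ KElem]
      by (intro definableI[of _ _ "ExElem x \<phi>"]) (auto simp: has_kind_KElem)
  next
    case KSet
    then show ?thesis using \<phi> fits_upd[of _ _ _ _ KSet]
      by (intro definableI[of _ _ "ExSet x \<phi>"]) (auto simp: has_kind_KSet, blast)
  qed
qed

lemma definable_ex_elem:
  assumes "definable V (\<Gamma>(x \<mapsto> KElem)) P"
  shows "definable V \<Gamma> (\<lambda>A \<nu>. \<exists>a\<in>universe A. P A (\<nu>(x := Elem a)))"
  by (rule definable_cong[OF definable_ex[OF assms]]) (auto simp: has_kind_KElem)

lemma definable_all_elem:
  assumes "definable V (\<Gamma>(x \<mapsto> KElem)) P"
  shows "definable V \<Gamma> (\<lambda>A \<nu>. \<forall>a\<in>universe A. P A (\<nu>(x := Elem a)))"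
  by (rule definable_cong[OF definable_neg[OF definable_ex_elem[OF definable_neg[OF assms]]]]) auto

lemma definable_ex_set:
  assumes "definable V (\<Gamma>(x \<mapsto> KSet)) P"
  shows "definable V \<Gamma> (\<lambda>A \<nu>. \<exists>S. S \<subseteq> universe A \<and> P A (\<nu>(x := SetArg S)))"
  by (rule definable_cong[OF definable_ex[OF assms]]) (auto simp: has_kind_KSet)

lemma definable_true: "definable V \<Gamma> (\<lambda>A \<nu>. True)"
  by (rule definableI[of _ _ "Neg (ExElem 0 (Neg (Eq 0 0)))"]) auto

lemma definable_const: "definable V \<Gamma> (\<lambda>A \<nu>. b)"
  using definable_true definable_neg[OF definable_true] by (cases b) simp_all

lemma definable_Ball:
  assumes "finite I" "\<And>i. i \<in> I \<Longrightarrow> definable V \<Gamma> (P i)"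
  shows "definable V \<Gamma> (\<lambda>A \<nu>. \<forall>i\<in>I. P i A \<nu>)"
  using assms by (induction I rule: finite_induct) (simp_all add: definable_true definable_conj)

lemma definable_Bex:
  assumes "finite I" "\<And>i. i \<in> I \<Longrightarrow> definable V \<Gamma> (P i)"
  shows "definable V \<Gamma> (\<lambda>A \<nu>. \<exists>i\<in>I. P i A \<nu>)"
  using assms by (induction I rule: finite_induct) (simp_all add: definable_const definable_disj)

lemma definable_eq: 
  "\<Gamma> x = Some KElem \<Longrightarrow> \<Gamma> y = Some KElem \<Longrightarrow> definable V \<Gamma> (\<lambda>A \<nu>. \<nu> x = \<nu> y)"
  by (rule definableI[of _ _ "Eq x y"]) auto

text \<open>Total projections, so that predicates can refer to the raw values of variables. The
  results at the wrong constructor are arbitrary defaults.\<close>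

fun elem_of :: "arg \<Rightarrow> nat" where
  "elem_of (Elem a) = a"
| "elem_of (SetArg S) = 0"

fun set_of :: "arg \<Rightarrow> nat set" where
  "set_of (Elem a) = {}"
| "set_of (SetArg S) = S"

lemma fits_Elem:
  "fits A \<Gamma> \<nu> \<Longrightarrow> \<Gamma> x = Some KElem \<Longrightarrow> \<nu> x = Elem (elem_of (\<nu> x)) \<and> elem_of (\<nu> x) \<in> universe A"
  by (drule (1) fitsD) (auto simp: has_kind_KElem)

lemma fits_SetArg:
  "fits A \<Gamma> \<nu> \<Longrightarrow> \<Gamma> x = Some KSet \<Longrightarrow> \<nu> x = SetArg (set_of (\<nu> x)) \<and> set_of (\<nu> x) \<subseteq> universe A"
  by (drule (1) fitsD) (auto simp: has_kind_KSet)

lemma definable_elem_eq: 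
  assumes "\<Gamma> x = Some KElem" "\<Gamma> y = Some KElem"
  shows "definable V \<Gamma> (\<lambda>A \<nu>. elem_of (\<nu> x) = elem_of (\<nu> y))"
  by (rule definable_cong[OF definable_eq[OF assms]]) (metis assms fits_Elem)

lemma definable_mem: 
  assumes "\<Gamma> x = Some KElem" "\<Gamma> X = Some KSet"
  shows "definable V \<Gamma> (\<lambda>A \<nu>. elem_of (\<nu> x) \<in> set_of (\<nu> X))"
proof (rule definableI[of _ _ "Mem x X"])
  fix A \<nu> assume "fits A \<Gamma> \<nu>"
  then show "sat A \<nu> (Mem x X) \<longleftrightarrow> elem_of (\<nu> x) \<in> set_of (\<nu> X)"
    using fits_Elem[of A \<Gamma> \<nu> x] fits_SetArg[of A \<Gamma> \<nu> X] assms
    by (metis arg.inject(1,2) sat.simps(2))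
qed (use assms in simp)

lemma definable_atom: 
  "fmlookup V R = Some \<tau> \<Longrightarrow> map \<Gamma> xs = map Some \<tau> \<Longrightarrow> definable V \<Gamma> (\<lambda>A \<nu>. map \<nu> xs \<in> rel A R)"
  by (rule definableI[of _ _ "Atom R xs"]) auto

lemma definable_dvd: 
  "2 \<le> p \<Longrightarrow> \<Gamma> X = Some KSet \<Longrightarrow> definable V \<Gamma> (\<lambda>A \<nu>. p dvd card (set_of (\<nu> X)))"
  by (rule definableI[of _ _ "Divides p X"]) (auto dest!: fitsD simp: has_kind_KSet)

text \<open>The renaming \<open>\<rho>\<close> need not be injective, since an argument list may
  repeat a variable. Hence only bound variables have to be chosen with care.\<close>

lemma definable_rename:
  "wf_formula V \<Gamma> \<phi> \<Longrightarrow> finite (dom \<Gamma>) \<Longrightarrow> (\<And>x \<kappa>. \<Gamma> x = Some \<kappa> \<Longrightarrow> \<Gamma>' (\<rho> x) = Some \<kappa>) \<Longrightarrow>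
   definable V \<Gamma>' (\<lambda>A \<nu>. sat A (\<nu> \<circ> \<rho>) \<phi>)"
proof (induction \<phi> arbitrary: \<Gamma> \<Gamma>' \<rho>)
  case (Eq x y)
  then show ?case by (intro definableI[of _ _ "Eq (\<rho> x) (\<rho> y)"]) auto
next
  case (Mem x y)
  then show ?case by (intro definableI[of _ _ "Mem (\<rho> x) (\<rho> y)"]) auto
next
  case (Atom R xs)
  then obtain \<tau> where \<tau>: "fmlookup V R = Some \<tau>" "map \<Gamma> xs = map Some \<tau>" by auto
  have "map \<Gamma>' (map \<rho> xs) = map \<Gamma> xs" unfolding map_map
  proof (rule map_cong[OF refl])
    fix x assume "x \<in> set xs"
    then have "\<Gamma> x \<in> Some ` set \<tau>" using \<tau>(2) by (metis image_eqI list.set_map)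
    then show "(\<Gamma>' \<circ> \<rho>) x = \<Gamma> x" using Atom(3) by auto
  qed
  then show ?case using definable_atom[OF \<tau>(1), of \<Gamma>' "map \<rho> xs"] \<tau>(2) by (simp add: comp_def)
next
  case (Divides p x) 
  then show ?case by (intro definableI[of _ _ "Divides p (\<rho> x)"]) auto
next
  case (Neg \<phi>)
  then show ?case unfolding sat.simps by (intro definable_neg Neg.IH[of \<Gamma>]) auto
next
  case (Conj \<phi> \<psi>)
  then show ?case unfolding sat.simps by (intro definable_conj Conj.IH[of \<Gamma>]) auto
next
  case (ExElem x \<phi>)
  \<comment> \<open>The bound variable moves to a name outside the image of the context, which
    avoids capture; a fresh name exists because the context is finite.\<close>
  obtain y where y: "y \<notin> \<rho> ` dom \<Gamma>" using ExElem.prems(2) by (meson ex_new_if_finite finite_imageI infinite_UNIV_nat)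
  have wf: "wf_formula V (\<Gamma>(x \<mapsto> KElem)) \<phi>" using ExElem.prems(1) by simp
  have "definable V (\<Gamma>'(y \<mapsto> KElem)) (\<lambda>A \<nu>. sat A (\<nu> \<circ> \<rho>(x := y)) \<phi>)"
    by (rule ExElem.IH[OF wf], unfold dom_fun_upd) (use ExElem.prems(2,3) y in \<open>force simp: dom_fun_upd split: if_splits\<close>)+
  then have "definable V \<Gamma>' (\<lambda>A \<nu>. \<exists>a\<in>universe A. sat A (\<nu>(y := Elem a) \<circ> \<rho>(x := y)) \<phi>)"
    by (rule definable_ex_elem)
  moreover have "sat A (\<nu>(y := Elem a) \<circ> \<rho>(x := y)) \<phi> \<longleftrightarrow> sat A ((\<nu> \<circ> \<rho>)(x := Elem a)) \<phi>" for A \<nu> a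
    by (rule sat_cong[OF wf]) (use y in \<open>auto simp: image_iff\<close>)
  ultimately show ?case by (simp only: sat.simps)
next
  case (ExSet x \<phi>)
  obtain y where y: "y \<notin> \<rho> ` dom \<Gamma>" using ExSet.prems(2) by (meson ex_new_if_finite finite_imageI infinite_UNIV_nat)
  have wf: "wf_formula V (\<Gamma>(x \<mapsto> KSet)) \<phi>" using ExSet.prems(1) by simp
  have "definable V (\<Gamma>'(y \<mapsto> KSet)) (\<lambda>A \<nu>. sat A (\<nu> \<circ> \<rho>(x := y)) \<phi>)"
    by (rule ExSet.IH[OF wf], unfold dom_fun_upd) (use ExSet.prems(2,3) y in \<open>force simp: dom_fun_upd split: if_splits\<close>)+
  then have "definable V \<Gamma>' (\<lambda>A \<nu>. \<exists>a. a \<subseteq> universe A \<and> sat A (\<nu>(y := SetArg a) \<circ> \<rho>(x := y)) \<phi>)"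
    by (rule definable_ex_set)
  moreover have "sat A (\<nu>(y := SetArg a) \<circ> \<rho>(x := y)) \<phi> \<longleftrightarrow> sat A ((\<nu> \<circ> \<rho>)(x := SetArg a)) \<phi>" for A \<nu> a
    by (rule sat_cong[OF wf]) (use y in \<open>auto simp: image_iff\<close>)
  ultimately show ?case by (simp only: sat.simps)
qed

text \<open>Quantifies a whole block of variables at once: the names being distinct, one function
  \<open>f\<close> can carry all the values. The block serves for the parts of a set variable, for
  colour classes, for the diagram of a structure, and for the positions of a copy tuple.\<close>

lemma definable_ex_vars:
  assumes "distinct (map fst ys)" "definable V (\<Gamma> ++ map_of ys) P"
  shows "definable V \<Gamma> (\<lambda>A \<nu>. \<exists>f. (\<forall>(y, \<kappa>)\<in>set ys. has_kind (universe A) (f y) \<kappa>) \<and>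
           P A (override_on \<nu> f (fst ` set ys)))"
  using assms
proof (induction ys arbitrary: P)
  case Nil then show ?case by simp
next
  case (Cons p ys)
  obtain y \<kappa> where p: "p = (y, \<kappa>)" by fastforce
  have "definable V ((\<Gamma> ++ map_of ys)(y \<mapsto> \<kappa>)) P" using Cons.prems(2) unfolding p by (simp only: map_of.simps map_add_upd fst_conv snd_conv)
  then have "definable V \<Gamma> (\<lambda>A \<nu>. \<exists>f. (\<forall>(y, \<kappa>)\<in>set ys. has_kind (universe A) (f y) \<kappa>) \<and>
     (\<exists>v. has_kind (universe A) v \<kappa> \<and> P A ((override_on \<nu> f (fst ` set ys))(y := v))))"
    using Cons.IH[OF _ definable_ex[of V "\<Gamma> ++ map_of ys" y \<kappa> P]] Cons.prems(1) by (simp del: fun_upd_apply)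
  then show ?case
  proof (rule definable_cong)
    fix A \<nu>
    have y: "y \<notin> fst ` set ys" using Cons.prems(1) p by simp
    have 1: "override_on \<nu> f (insert y (fst ` set ys)) = (override_on \<nu> f (fst ` set ys))(y := f y)" for f :: "nat \<Rightarrow> arg"
      by (auto simp: override_on_def)
    have 2: "override_on \<nu> (f(y := v)) (insert y (fst ` set ys)) = (override_on \<nu> f (fst ` set ys))(y := v)" for f :: "nat \<Rightarrow> arg" and v
      using y by (auto simp: override_on_def)
    show "(\<exists>f. (\<forall>(y, \<kappa>)\<in>set ys. has_kind (universe A) (f y) \<kappa>) \<and>
     (\<exists>v. has_kind (universe A) v \<kappa> \<and> P A ((override_on \<nu> f (fst ` set ys))(y := v)))) \<longleftrightarrow>
     (\<exists>f. (\<forall>(y, \<kappa>)\<in>set (p # ys). has_kind (universe A) (f y) \<kappa>) \<and>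
           P A (override_on \<nu> f (fst ` set (p # ys))))" (is "?L \<longleftrightarrow> ?R")
    proof
      assume ?L
      then obtain f v where fv: "\<forall>(y, \<kappa>)\<in>set ys. has_kind (universe A) (f y) \<kappa>"
        "has_kind (universe A) v \<kappa>" "P A ((override_on \<nu> f (fst ` set ys))(y := v))" by blast
      have "z \<noteq> y" if "(z, \<kappa>') \<in> set ys" for z \<kappa>' using y that by force
      then show ?R using fv 2[of f v] p by (intro exI[of _ "f(y := v)"]) auto
    next
      assume ?R
      then show ?L using p 1 by auto
    qed
  qed
qed

text \<open>The logic provides residue 0 only. Residue \<open>Suc r\<close> is reached by removing
  one element and asking for residue \<open>r\<close>; as \<open>Suc r < p\<close>, the residue does
  not wrap around.\<close>

lemma definable_card_mod:
  "2 \<le> p \<Longrightarrow> r < p \<Longrightarrow> \<Gamma> X = Some KSet \<Longrightarrow> definable V \<Gamma> (\<lambda>A \<nu>. card (set_of (\<nu> X)) mod p = r)"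
proof (induction r arbitrary: \<Gamma> X)
  case 0
  show ?case using 0 by (intro definable_cong[OF definable_dvd[of p \<Gamma> X]]) (simp_all add: dvd_eq_mod_eq_0)
next
  case (Suc r)
  \<comment> \<open>Names above \<open>X\<close>, hence distinct from it: \<open>x\<close> is the
    removed element, \<open>Y\<close> the remaining set, and \<open>y\<close> runs over the universe
    to state that \<open>Y\<close> is \<open>X\<close> without \<open>x\<close>.\<close>
  define x Y y where xy: "x = Suc X" "Y = Suc (Suc X)" "y = Suc (Suc (Suc X))"
  let ?\<Gamma> = "\<Gamma>(x \<mapsto> KElem, Y \<mapsto> KSet)"
  have "definable V \<Gamma> (\<lambda>A \<nu>. \<exists>a\<in>universe A. \<exists>T. T \<subseteq> universe A \<and>
    (elem_of ((\<nu>(x := Elem a, Y := SetArg T)) x) \<in> set_of ((\<nu>(x := Elem a, Y := SetArg T)) X) \<and>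
     (\<forall>b\<in>universe A. elem_of ((\<nu>(x := Elem a, Y := SetArg T, y := Elem b)) y) \<in>
            set_of ((\<nu>(x := Elem a, Y := SetArg T, y := Elem b)) Y) \<longleftrightarrow>
        elem_of ((\<nu>(x := Elem a, Y := SetArg T, y := Elem b)) y) \<in>
            set_of ((\<nu>(x := Elem a, Y := SetArg T, y := Elem b)) X) \<and>
        elem_of ((\<nu>(x := Elem a, Y := SetArg T, y := Elem b)) y) \<noteq>
            elem_of ((\<nu>(x := Elem a, Y := SetArg T, y := Elem b)) x)) \<and>
     card (set_of ((\<nu>(x := Elem a, Y := SetArg T)) Y)) mod p = r))"
    apply (rule definable_ex_elem, rule definable_ex_set)
    apply (intro definable_conj Suc.IH)
        apply (rule definable_mem; use Suc.prems in \<open>simp add: xy\<close>)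
       apply (rule definable_all_elem)
       apply (intro definable_iff definable_conj definable_neg definable_mem definable_elem_eq)
            apply (use Suc.prems in \<open>simp_all add: xy\<close>)
    done
  then show ?case
  proof (rule definable_cong)
    fix A \<nu> assume A: "A \<in> structures V" and "fits A \<Gamma> \<nu>"
    then have S: "set_of (\<nu> X) \<subseteq> universe A" using fits_SetArg Suc.prems(3) by blast
    let ?S = "set_of (\<nu> X)"
    have fin: "finite ?S" using S structuresD(1)[OF A] finite_subset by auto
    have "(\<exists>a\<in>universe A. \<exists>T. T \<subseteq> universe A \<and> (a \<in> ?S \<and>
       (\<forall>b\<in>universe A. b \<in> T \<longleftrightarrow> b \<in> ?S \<and> b \<noteq> a) \<and> card T mod p = r)) \<longleftrightarrow> card ?S mod p = Suc r" (is "?L \<longleftrightarrow> ?R")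
    proof
      assume ?L
      then obtain a T where *: "T \<subseteq> universe A" "a \<in> ?S" "\<forall>b\<in>universe A. b \<in> T \<longleftrightarrow> b \<in> ?S \<and> b \<noteq> a"
        "card T mod p = r" by blast
      then have "?S = insert a T" "a \<notin> T" using S by auto
      then have "card ?S = Suc (card T)" using fin by (metis card_insert_disjoint finite_insert)
      then show ?R using *(4) Suc.prems(2) by (simp add: mod_Suc)
    next
      assume R: ?R
      then have "?S \<noteq> {}" by auto
      then obtain a where a: "a \<in> ?S" by auto
      have "card ?S = Suc (card (?S - {a}))" using fin a by (metis card.remove)
      then have "card (?S - {a}) mod p = r" using R by (simp add: mod_Suc split: if_splits)
      then show ?L using a S by (intro bexI[of _ a] exI[of _ "?S - {a}"]) auto
    qed
    then show "(\<exists>a\<in>universe A. \<exists>T. T \<subseteq> universe A \<and>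
    (elem_of ((\<nu>(x := Elem a, Y := SetArg T)) x) \<in> set_of ((\<nu>(x := Elem a, Y := SetArg T)) X) \<and>
     (\<forall>b\<in>universe A. elem_of ((\<nu>(x := Elem a, Y := SetArg T, y := Elem b)) y) \<in>
            set_of ((\<nu>(x := Elem a, Y := SetArg T, y := Elem b)) Y) \<longleftrightarrow>
        elem_of ((\<nu>(x := Elem a, Y := SetArg T, y := Elem b)) y) \<in>
            set_of ((\<nu>(x := Elem a, Y := SetArg T, y := Elem b)) X) \<and>
        elem_of ((\<nu>(x := Elem a, Y := SetArg T, y := Elem b)) y) \<noteq>
            elem_of ((\<nu>(x := Elem a, Y := SetArg T, y := Elem b)) x)) \<and>
     card (set_of ((\<nu>(x := Elem a, Y := SetArg T)) Y)) mod p = r)) \<longleftrightarrow> card ?S mod p = Suc r"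
      by (simp add: xy)
  qed
qed

text \<open>The residue of a sum is determined by the residues of its summands, so each induction
  step is a finite disjunction over the pairs of residues that add up to \<open>r\<close>.\<close>

lemma definable_sum_mod:
  fixes k :: nat and X :: "nat \<Rightarrow> nat"
  assumes "2 \<le> p" and "r < p" and "\<And>i. i < k \<Longrightarrow> \<Gamma> (X i) = Some KSet"
  shows "definable V \<Gamma> (\<lambda>A \<nu>. (\<Sum>i<k. card (set_of (\<nu> (X i)))) mod p = r)"
  using assms(2,3)
proof (induct k arbitrary: r)
  case 0
  show ?case using definable_const[of V \<Gamma> "0 mod p = r"] by simp
next
  case (Suc k)
  have "definable V \<Gamma> (\<lambda>A \<nu>. \<exists>(r1, r2) \<in> {(r1, r2) \<in> {..<p} \<times> {..<p}. (r1 + r2) mod p = r}.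
     (\<Sum>i<k. card (set_of (\<nu> (X i)))) mod p = r1 \<and> card (set_of (\<nu> (X k))) mod p = r2)"
    unfolding case_prod_beta
    by (rule definable_Bex; (intro definable_conj Suc.hyps definable_card_mod)?)
      (use Suc.prems assms(1) in \<open>auto intro: finite_subset[of _ "{..<p} \<times> {..<p}"]\<close>)
  then show ?case
  proof (rule definable_cong)
    fix A \<nu>
    let ?a = "\<Sum>i<k. card (set_of (\<nu> (X i)))" and ?b = "card (set_of (\<nu> (X k)))"
    have "(?a + ?b) mod p = (?a mod p + ?b mod p) mod p" by (simp add: mod_add_eq)
    then show "(\<exists>(r1, r2) \<in> {(r1, r2) \<in> {..<p} \<times> {..<p}. (r1 + r2) mod p = r}. ?a mod p = r1 \<and> ?b mod p = r2)
      \<longleftrightarrow> (\<Sum>i<Suc k. card (set_of (\<nu> (X i)))) mod p = r"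
      using assms(1) by auto
  qed
qed

subsection \<open>Translating formulas\<close>

text \<open>A structure \<open>B\<close> computed from \<open>A\<close> has its elements among the numbers \<open>k * a + i\<close>, where \<open>a\<close>
  is an element of \<open>A\<close> and \<open>i < k\<close>.  An element variable \<open>x\<close> of \<open>B\<close> is represented by one element
  variable of \<open>A\<close> together with an index \<open>\<sigma> x < k\<close> that is fixed in the formula, a set variable by \<open>k\<close> set
  variables.  These are the variables \<open>part k x i\<close> with \<open>i < k\<close>; the variables
  \<open>part k x k\<close> are left for the parameters on which \<open>B\<close> depends.\<close>

definition part :: "nat \<Rightarrow> nat \<Rightarrow> nat \<Rightarrow> nat" where
  "part k x i = Suc k * x + i"

lemma part_div_mod: "i \<le> k \<Longrightarrow> part k x i div Suc k = x \<and> part k x i mod Suc k = i"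
proof -
  assume "i \<le> k"
  then have "i < Suc k" by simp
  then show ?thesis unfolding part_def by (metis add.right_neutral div_less div_mult_self4 mod_less mod_mult_self4 nat.simps(3) add.commute)
qed

lemma part_eq_iff: "i \<le> k \<Longrightarrow> j \<le> k \<Longrightarrow> part k x i = part k y j \<longleftrightarrow> x = y \<and> i = j"
  using part_div_mod by metis

text \<open>For an element variable only slot 0 is declared, because its copy index is kept outside
  the formula.\<close>

definition lift_ctx :: "nat \<Rightarrow> (nat \<rightharpoonup> arg_kind) \<Rightarrow> (nat \<rightharpoonup> arg_kind) \<Rightarrow> nat \<rightharpoonup> arg_kind" where
  "lift_ctx k G \<Gamma> z =
     (if z mod Suc k = k then G (z div Suc k)
      else case \<Gamma> (z div Suc k) of
          None \<Rightarrow> None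
        | Some KElem \<Rightarrow> if z mod Suc k = 0 then Some KElem else None
        | Some KSet \<Rightarrow> Some KSet)"

lemma lift_ctx_param: "lift_ctx k G \<Gamma> (part k x k) = G x"
  using part_div_mod[of k k x] by (simp add: lift_ctx_def)

lemma lift_ctx_elem: "1 \<le> k \<Longrightarrow> \<Gamma> x = Some KElem \<Longrightarrow> lift_ctx k G \<Gamma> (part k x 0) = Some KElem"
  using part_div_mod[of 0 k x] by (simp add: lift_ctx_def)

lemma lift_ctx_set: "i < k \<Longrightarrow> \<Gamma> x = Some KSet \<Longrightarrow> lift_ctx k G \<Gamma> (part k x i) = Some KSet"
  using part_div_mod[of i k x] by (simp add: lift_ctx_def)

lemma part_cases: obtains x i where "i \<le> k" "z = part k x i"
proof
  show "z mod Suc k \<le> k" by (simp add: less_Suc_eq_le[symmetric] del: less_Suc_eq_le)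
  show "z = part k (z div Suc k) (z mod Suc k)" unfolding part_def by (simp only: mult_div_mod_eq)
qed

text \<open>Only an inclusion: if \<open>x\<close> was a set variable in \<open>\<Gamma>\<close>,
  its slots strictly between 0 and \<open>k\<close> stay declared on the right. This suffices by
  \<open>definable_mono\<close>.\<close>

lemma lift_ctx_upd_elem:
  assumes "1 \<le> k"
  shows "lift_ctx k G (\<Gamma>(x \<mapsto> KElem)) \<subseteq>\<^sub>m (lift_ctx k G \<Gamma>)(part k x 0 \<mapsto> KElem)"
  unfolding map_le_def
proof
  fix z assume z: "z \<in> dom (lift_ctx k G (\<Gamma>(x \<mapsto> KElem)))"
  obtain y i where yi: "i \<le> k" "z = part k y i" by (rule part_cases)
  show "lift_ctx k G (\<Gamma>(x \<mapsto> KElem)) z = ((lift_ctx k G \<Gamma>)(part k x 0 \<mapsto> KElem)) z"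
    using z part_div_mod[OF yi(1), of y] part_eq_iff[OF yi(1), of 0 y x] assms unfolding yi(2)
    by (auto simp: lift_ctx_def split: if_splits)
qed

lemma lift_ctx_upd_set:
  "lift_ctx k G (\<Gamma>(x \<mapsto> KSet)) \<subseteq>\<^sub>m lift_ctx k G \<Gamma> ++ map_of (map (\<lambda>i. (part k x i, KSet)) [0..<k])"
  unfolding map_le_def
proof
  fix z assume z: "z \<in> dom (lift_ctx k G (\<Gamma>(x \<mapsto> KSet)))"
  obtain y i where yi: "i \<le> k" "z = part k y i" by (rule part_cases)
  have 1: "map_of (map (\<lambda>i. (part k x i, KSet)) [0..<k]) z = None" if "\<not> (y = x \<and> i < k)"
    unfolding map_of_eq_None_iff yi(2) using that by (auto simp: part_eq_iff yi(1))
  have 2: "map_of (map (\<lambda>i. (part k x i, KSet)) [0..<k]) (part k x i) = Some KSet" if "i < k"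
    using that by (auto simp: map_of_eq_Some_iff distinct_map inj_on_def part_eq_iff comp_def)
  show "lift_ctx k G (\<Gamma>(x \<mapsto> KSet)) z =
    (lift_ctx k G \<Gamma> ++ map_of (map (\<lambda>i. (part k x i, KSet)) [0..<k])) z"
  proof (cases "y = x \<and> i < k")
    case True
    then show ?thesis using 2 yi part_div_mod[OF yi(1), of y] by (simp add: map_add_def lift_ctx_def)
  next
    case False
    then have "lift_ctx k G (\<Gamma>(x \<mapsto> KSet)) z = lift_ctx k G \<Gamma> z"
      using yi part_div_mod[OF yi(1), of y] by (auto simp: lift_ctx_def)
    then show ?thesis using 1[OF False] by (simp add: map_add_def)
  qed
qed

text \<open>Decoding: the valuation over the output structure that is represented by a valuation
  \<open>\<nu>\<close> over the input together with the copy indices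
  \<open>\<sigma>\<close>.\<close>

definition join :: "nat \<Rightarrow> (nat \<Rightarrow> nat) \<Rightarrow> (nat \<rightharpoonup> arg_kind) \<Rightarrow> (nat \<Rightarrow> arg) \<Rightarrow> nat \<Rightarrow> arg" where
  "join k \<sigma> \<Gamma> \<nu> x =
     (if \<Gamma> x = Some KSet then SetArg (\<Union>i<k. (\<lambda>a. k * a + i) ` set_of (\<nu> (part k x i)))
      else Elem (k * elem_of (\<nu> (part k x 0)) + \<sigma> x))"

lemma join_upd_elem:
  assumes "1 \<le> k"
  shows "join k (\<sigma>(x := i)) (\<Gamma>(x \<mapsto> KElem)) (\<nu>(part k x 0 := Elem a)) =
     (join k \<sigma> \<Gamma> \<nu>)(x := Elem (k * a + i))"
proof
  fix y
  show "join k (\<sigma>(x := i)) (\<Gamma>(x \<mapsto> KElem)) (\<nu>(part k x 0 := Elem a)) y =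
     ((join k \<sigma> \<Gamma> \<nu>)(x := Elem (k * a + i))) y"
    using assms by (auto simp: join_def part_eq_iff intro!: SUP_cong)
qed

lemma join_upd_set:
  "join k \<sigma> (\<Gamma>(x \<mapsto> KSet)) (override_on \<nu> f (part k x ` {..<k})) =
     (join k \<sigma> \<Gamma> \<nu>)(x := SetArg (\<Union>i<k. (\<lambda>a. k * a + i) ` set_of (f (part k x i))))"
proof
  fix y
  have "y = x" if "i \<le> k" "part k y i \<in> part k x ` {..<k}" for i
    using that by (auto simp: part_eq_iff)
  then show "join k \<sigma> (\<Gamma>(x \<mapsto> KSet)) (override_on \<nu> f (part k x ` {..<k})) y =
     ((join k \<sigma> \<Gamma> \<nu>)(x := SetArg (\<Union>i<k. (\<lambda>a. k * a + i) ` set_of (f (part k x i))))) y"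
    by (cases "y = x") (simp_all add: join_def override_on_def part_eq_iff image_iff join_def[abs_def])
qed

lemma mult_add_eq_iff:
  fixes k a b i j :: nat
  assumes "i < k" "j < k"
  shows "k * a + i = k * b + j \<longleftrightarrow> a = b \<and> i = j"
proof
  assume *: "k * a + i = k * b + j"
  have "(k * a + i) div k = a" "(k * a + i) mod k = i" "(k * b + j) div k = b" "(k * b + j) mod k = j"
    using assms by (auto simp: div_add1_eq)
  then show "a = b \<and> i = j" using * by metis
qed simp

lemma card_join:
  fixes k :: nat
  assumes "\<And>i. i < k \<Longrightarrow> finite (S i)"
  shows "card (\<Union>i<k. (\<lambda>a. k * a + i) ` S i) = (\<Sum>i<k. card (S i))"
proof -
  have "card (\<Union>i<k. (\<lambda>a. k * a + i) ` S i) = (\<Sum>i<k. card ((\<lambda>a. k * a + i) ` S i))"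
  proof (rule card_UN_disjoint)
    show "\<forall>i\<in>{..<k}. \<forall>j\<in>{..<k}. i \<noteq> j \<longrightarrow> (\<lambda>a. k * a + i) ` S i \<inter> (\<lambda>a. k * a + j) ` S j = {}"
    proof (intro ballI impI equals0I)
      fix i j u assume "i \<in> {..<k}" "j \<in> {..<k}" "i \<noteq> j" "u \<in> (\<lambda>a. k * a + i) ` S i \<inter> (\<lambda>a. k * a + j) ` S j"
      moreover from this obtain a b where "k * a + i = k * b + j" by auto
      ultimately show False using mult_add_eq_iff[of i k j a b] by auto
    qed
  qed (use assms in simp_all)
  also have "\<dots> = (\<Sum>i<k. card (S i))"
    by (rule sum.cong[OF refl], rule card_image) (auto simp: inj_on_def)
  finally show ?thesis .
qed

text \<open>Induction on \<open>\<phi>\<close>. An element quantifier becomes a finite disjunction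
  over the copy index and a quantifier over \<open>A\<close>, relativised to the universe of the
  output; a set quantifier becomes \<open>k\<close> set quantifiers with the same relativisation;
  divisibility becomes a condition on the sum of the \<open>k\<close> cardinalities. The atoms are
  left to the caller as \<open>def_rel\<close>. Since \<open>B\<close> may depend on
  \<open>\<nu>\<close> only through the parameter slots, binding the other variables leaves it
  unchanged.\<close>

lemma definable_translation:
  fixes B :: "struct \<Rightarrow> (nat \<Rightarrow> arg) \<Rightarrow> struct"
  assumes k: "1 \<le> k"
    and indep: "\<And>A \<nu> \<nu>'. (\<And>x. \<nu> (part k x k) = \<nu>' (part k x k)) \<Longrightarrow> B A \<nu> = B A \<nu>'"
    and univ: "\<And>A \<nu> u. A \<in> structures V \<Longrightarrow> u \<in> universe (B A \<nu>) \<Longrightarrow> \<exists>i<k. \<exists>a\<in>universe A. u = k * a + i"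
    and def_univ: "\<And>\<Gamma> z i. i < k \<Longrightarrow> \<Gamma> z = Some KElem \<Longrightarrow>
      (\<And>x \<kappa>. G x = Some \<kappa> \<Longrightarrow> \<Gamma> (part k x k) = Some \<kappa>) \<Longrightarrow>
      definable V \<Gamma> (\<lambda>A \<nu>. k * elem_of (\<nu> z) + i \<in> universe (B A \<nu>))"
    and def_rel: "\<And>\<Gamma> \<sigma> R \<tau> xs. fmlookup W R = Some \<tau> \<Longrightarrow> map \<Gamma> xs = map Some \<tau> \<Longrightarrow>
      (\<And>x. \<Gamma> x = Some KElem \<Longrightarrow> \<sigma> x < k) \<Longrightarrow>
      definable V (lift_ctx k G \<Gamma>) (\<lambda>A \<nu>. map (join k \<sigma> \<Gamma> \<nu>) xs \<in> rel (B A \<nu>) R)"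
  shows "wf_formula W \<Gamma> \<phi> \<Longrightarrow> (\<And>x. \<Gamma> x = Some KElem \<Longrightarrow> \<sigma> x < k) \<Longrightarrow>
    definable V (lift_ctx k G \<Gamma>) (\<lambda>A \<nu>. sat (B A \<nu>) (join k \<sigma> \<Gamma> \<nu>) \<phi>)"
proof (induction \<phi> arbitrary: \<Gamma> \<sigma>)
  case (Eq x y)
  then have x: "\<Gamma> x = Some KElem" and y: "\<Gamma> y = Some KElem" by auto
  \<comment> \<open>Codes are equal iff both the elements and the indices agree; the indices are
    known at translation time, so their comparison is a constant.\<close>
  have "definable V (lift_ctx k G \<Gamma>) (\<lambda>A \<nu>. elem_of (\<nu> (part k x 0)) = elem_of (\<nu> (part k y 0)) \<and> \<sigma> x = \<sigma> y)"
    by (intro definable_conj definable_elem_eq definable_const lift_ctx_elem[OF k] x y)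
  then show ?case
    by (rule definable_cong) (use x y Eq.prems(2) in \<open>simp add: join_def mult_add_eq_iff\<close>)
next
  case (Mem x X)
  then have x: "\<Gamma> x = Some KElem" and X: "\<Gamma> X = Some KSet" by auto
  have "definable V (lift_ctx k G \<Gamma>) (\<lambda>A \<nu>. elem_of (\<nu> (part k x 0)) \<in> set_of (\<nu> (part k X (\<sigma> x))))"
    using Mem.prems(2) x by (intro definable_mem lift_ctx_elem[OF k] lift_ctx_set x X) auto
  then show ?case
    by (rule definable_cong) (use x X Mem.prems(2) in \<open>auto simp: join_def mult_add_eq_iff image_iff\<close>)
next
  case (Atom R xs)
  then obtain \<tau> where "fmlookup W R = Some \<tau>" "map \<Gamma> xs = map Some \<tau>" by auto
  then show ?case using def_rel Atom.prems(2) by simp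
next
  case (Divides p X)
  then have p: "2 \<le> p" "0 < p" and X: "\<Gamma> X = Some KSet" by auto
  have "definable V (lift_ctx k G \<Gamma>) (\<lambda>A \<nu>. (\<Sum>i<k. card (set_of (\<nu> (part k X i)))) mod p = 0)"
    by (intro definable_sum_mod p lift_ctx_set X)
  then show ?case
  proof (rule definable_cong)
    fix A \<nu> assume A: "A \<in> structures V" and fit: "fits A (lift_ctx k G \<Gamma>) \<nu>"
    have "finite (set_of (\<nu> (part k X i)))" if "i < k" for i
      using fits_SetArg[OF fit lift_ctx_set[OF that, of \<Gamma> X G]] X structuresD(1)[OF A] finite_subset by blast
    then show "((\<Sum>i<k. card (set_of (\<nu> (part k X i)))) mod p = 0) = sat (B A \<nu>) (join k \<sigma> \<Gamma> \<nu>) (Divides p X)"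
      using X by (simp add: join_def card_join dvd_eq_mod_eq_0)
  qed
next
  case (Neg \<phi>)
  then show ?case unfolding sat.simps by (intro definable_neg Neg.IH) auto
next
  case (Conj \<phi> \<psi>)
  then show ?case unfolding sat.simps by (intro definable_conj Conj.IH) auto
next
  case (ExElem x \<phi>)
  have wf: "wf_formula W (\<Gamma>(x \<mapsto> KElem)) \<phi>" using ExElem.prems(1) by simp
  let ?\<Gamma> = "(lift_ctx k G \<Gamma>)(part k x 0 \<mapsto> KElem)"
  have "definable V (lift_ctx k G \<Gamma>) (\<lambda>A \<nu>. \<exists>i\<in>{..<k}. \<exists>a\<in>universe A.
    k * elem_of ((\<nu>(part k x 0 := Elem a)) (part k x 0)) + i \<in> universe (B A (\<nu>(part k x 0 := Elem a))) \<and>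
    sat (B A (\<nu>(part k x 0 := Elem a))) (join k (\<sigma>(x := i)) (\<Gamma>(x \<mapsto> KElem)) (\<nu>(part k x 0 := Elem a))) \<phi>)"
  proof (rule definable_Bex[OF finite_lessThan], rule definable_ex_elem, rule definable_conj)
    fix i assume "i \<in> {..<k}"
    then have i: "i < k" by simp
    show "definable V ?\<Gamma> (\<lambda>A \<nu>. k * elem_of (\<nu> (part k x 0)) + i \<in> universe (B A \<nu>))"
      using k by (intro def_univ i) (auto simp: part_eq_iff lift_ctx_param)
    have "definable V (lift_ctx k G (\<Gamma>(x \<mapsto> KElem)))
       (\<lambda>A \<nu>. sat (B A \<nu>) (join k (\<sigma>(x := i)) (\<Gamma>(x \<mapsto> KElem)) \<nu>) \<phi>)"
      by (rule ExElem.IH[OF wf]) (use i ExElem.prems(2) in \<open>auto split: if_splits\<close>)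
    then show "definable V ?\<Gamma> (\<lambda>A \<nu>. sat (B A \<nu>) (join k (\<sigma>(x := i)) (\<Gamma>(x \<mapsto> KElem)) \<nu>) \<phi>)"
      by (rule definable_mono[OF _ lift_ctx_upd_elem[OF k]])
  qed
  then show ?case
  proof (rule definable_cong)
    fix A \<nu> assume A: "A \<in> structures V"
    have B: "B A (\<nu>(part k x 0 := Elem a)) = B A \<nu>" for a
      using k by (intro indep) (simp add: part_eq_iff)
    show "(\<exists>i\<in>{..<k}. \<exists>a\<in>universe A.
      k * elem_of ((\<nu>(part k x 0 := Elem a)) (part k x 0)) + i \<in> universe (B A (\<nu>(part k x 0 := Elem a))) \<and>
      sat (B A (\<nu>(part k x 0 := Elem a))) (join k (\<sigma>(x := i)) (\<Gamma>(x \<mapsto> KElem)) (\<nu>(part k x 0 := Elem a))) \<phi>)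
      \<longleftrightarrow> sat (B A \<nu>) (join k \<sigma> \<Gamma> \<nu>) (ExElem x \<phi>)"
      unfolding B join_upd_elem[OF k] using univ[OF A, of _ \<nu>] by fastforce
  qed
next
  case (ExSet x \<phi>)
  have wf: "wf_formula W (\<Gamma>(x \<mapsto> KSet)) \<phi>" using ExSet.prems(1) by simp
  let ?ys = "map (\<lambda>i. (part k x i, KSet)) [0..<k]"
  let ?\<Gamma> = "lift_ctx k G \<Gamma> ++ map_of ?ys"
  \<comment> \<open>An auxiliary variable for relativising the set: it lies in the next block, so it
    is no part of \<open>x\<close>, and it has slot 0, which by \<open>1 \<le> k\<close> is not a
    parameter slot. Shadowing the element variable \<open>Suc x\<close> is harmless, as
    \<open>z\<close> is bound only in the relativising conjunct.\<close>
  define z where "z = part k (Suc x) 0"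
  have fst_ys: "fst ` set ?ys = part k x ` {..<k}" by force
  let ?P = "\<lambda>A \<nu>. (\<forall>i\<in>{..<k}. \<forall>a\<in>universe A.
      elem_of ((\<nu>(z := Elem a)) z) \<in> set_of ((\<nu>(z := Elem a)) (part k x i)) \<longrightarrow>
      k * elem_of ((\<nu>(z := Elem a)) z) + i \<in> universe (B A (\<nu>(z := Elem a)))) \<and>
    sat (B A \<nu>) (join k \<sigma> (\<Gamma>(x \<mapsto> KSet)) \<nu>) \<phi>"
  have "definable V (lift_ctx k G \<Gamma>) (\<lambda>A \<nu>. \<exists>f. (\<forall>(y, \<kappa>)\<in>set ?ys. has_kind (universe A) (f y) \<kappa>) \<and>
      ?P A (override_on \<nu> f (fst ` set ?ys)))"
  proof (rule definable_ex_vars, simp add: distinct_map inj_on_def part_eq_iff comp_def,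
      rule definable_conj)
    show "definable V ?\<Gamma> (\<lambda>A \<nu>. \<forall>i\<in>{..<k}. \<forall>a\<in>universe A.
      elem_of ((\<nu>(z := Elem a)) z) \<in> set_of ((\<nu>(z := Elem a)) (part k x i)) \<longrightarrow>
      k * elem_of ((\<nu>(z := Elem a)) z) + i \<in> universe (B A (\<nu>(z := Elem a))))"
    proof (rule definable_Ball[OF finite_lessThan], rule definable_all_elem, rule definable_imp)
      fix i assume "i \<in> {..<k}"
      then have i: "i < k" by simp
      have "lift_ctx k G (\<Gamma>(x \<mapsto> KSet)) (part k x i) = Some KSet" by (rule lift_ctx_set[OF i]) simp
      then have "?\<Gamma> (part k x i) = Some KSet" using lift_ctx_upd_set[of k G \<Gamma> x]
        unfolding map_le_def by (metis domI)
      then have "(?\<Gamma>(z \<mapsto> KElem)) (part k x i) = Some KSet" using i by (simp add: z_def part_eq_iff)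
      then show "definable V (?\<Gamma>(z \<mapsto> KElem)) (\<lambda>A \<nu>. elem_of (\<nu> z) \<in> set_of (\<nu> (part k x i)))"
        by (intro definable_mem) auto
      have "part k y k \<notin> fst ` set ?ys" for y by (auto simp: part_eq_iff)
      then have 1: "?\<Gamma> (part k y k) = G y" for y
        by (simp add: map_add_def lift_ctx_param map_of_eq_None_iff[THEN iffD2])
      show "definable V (?\<Gamma>(z \<mapsto> KElem)) (\<lambda>A \<nu>. k * elem_of (\<nu> z) + i \<in> universe (B A \<nu>))"
        by (rule def_univ[OF i]) (use k 1 in \<open>auto simp: z_def part_eq_iff simp del: map_add_Some_iff\<close>)
    qed
    show "definable V ?\<Gamma> (\<lambda>A \<nu>. sat (B A \<nu>) (join k \<sigma> (\<Gamma>(x \<mapsto> KSet)) \<nu>) \<phi>)"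
      by (rule definable_mono[OF ExSet.IH[OF wf] lift_ctx_upd_set])
        (use ExSet.prems(2) in \<open>auto split: if_splits\<close>)
  qed
  then show ?case
  proof (rule definable_cong)
    fix A \<nu> assume A: "A \<in> structures V"
    have B: "B A (override_on \<nu> f (part k x ` {..<k})) = B A \<nu>" for f
      by (intro indep) (auto simp: override_on_def part_eq_iff)
    have B': "B A ((override_on \<nu> f (part k x ` {..<k}))(z := Elem a)) = B A \<nu>" for f a
      using k by (subst B[symmetric, of f], intro indep) (auto simp: z_def part_eq_iff)
    have z: "part k x i \<noteq> z" if "i < k" for i using that by (simp add: z_def part_eq_iff)
    let ?J = "\<lambda>f. \<Union>i<k. (\<lambda>a. k * a + i) ` set_of (f (part k x i))"
    have sub: "(\<forall>i\<in>{..<k}. \<forall>a\<in>universe A.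
      elem_of (((override_on \<nu> f (part k x ` {..<k}))(z := Elem a)) z) \<in>
         set_of (((override_on \<nu> f (part k x ` {..<k}))(z := Elem a)) (part k x i)) \<longrightarrow>
      k * elem_of (((override_on \<nu> f (part k x ` {..<k}))(z := Elem a)) z) + i \<in>
         universe (B A ((override_on \<nu> f (part k x ` {..<k}))(z := Elem a)))) \<longleftrightarrow> ?J f \<subseteq> universe (B A \<nu>)"
      if f: "\<forall>(y, \<kappa>)\<in>set ?ys. has_kind (universe A) (f y) \<kappa>" for f
    proof -
      have "set_of (f (part k x i)) \<subseteq> universe A" if "i < k" for i
      proof -
        have "has_kind (universe A) (f (part k x i)) KSet" using f that by force
        then show ?thesis by (auto simp: has_kind_KSet)
      qed
      then show ?thesis unfolding B' using z by (simp add: subset_iff) blast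
    qed
    have "(\<exists>f. (\<forall>(y, \<kappa>)\<in>set ?ys. has_kind (universe A) (f y) \<kappa>) \<and> ?J f \<subseteq> universe (B A \<nu>) \<and>
        sat (B A \<nu>) ((join k \<sigma> \<Gamma> \<nu>)(x := SetArg (?J f))) \<phi>) \<longleftrightarrow>
      sat (B A \<nu>) (join k \<sigma> \<Gamma> \<nu>) (ExSet x \<phi>)" (is "?L \<longleftrightarrow> ?R")
    proof
      assume ?R
      then obtain S where S: "S \<subseteq> universe (B A \<nu>)" "sat (B A \<nu>) ((join k \<sigma> \<Gamma> \<nu>)(x := SetArg S)) \<phi>" by auto
      \<comment> \<open>Splits \<open>S\<close> by copy: the variable \<open>part k x i\<close>
        receives the elements whose \<open>i\<close>-th code lies in \<open>S\<close>, and
        \<open>y mod Suc k\<close> recovers \<open>i\<close> from the variable.\<close>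
      define f where "f = (\<lambda>y. SetArg {a \<in> universe A. k * a + y mod Suc k \<in> S})"
      have f: "f (part k x i) = SetArg {a \<in> universe A. k * a + i \<in> S}" if "i < k" for i
        using that part_div_mod[of i k x] by (simp add: f_def)
      \<comment> \<open>Nothing of \<open>S\<close> is lost, because by \<open>univ\<close> every
        element of the output is a code.\<close>
      have "?J f = S"
      proof
        show "?J f \<subseteq> S" using f by auto
        show "S \<subseteq> ?J f"
        proof
          fix u assume "u \<in> S"
          moreover obtain i a where "i < k" "a \<in> universe A" "u = k * a + i"
            using univ[OF A] S(1) \<open>u \<in> S\<close> by blast
          ultimately show "u \<in> ?J f" using f by auto
        qed
      qed
      moreover have "\<forall>(y, \<kappa>)\<in>set ?ys. has_kind (universe A) (f y) \<kappa>" by (auto simp: f_def)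
      ultimately show ?L using S by (intro exI[of _ f]) auto
    qed auto
    then show "(\<exists>f. (\<forall>(y, \<kappa>)\<in>set ?ys. has_kind (universe A) (f y) \<kappa>) \<and>
      ?P A (override_on \<nu> f (fst ` set ?ys))) \<longleftrightarrow> sat (B A \<nu>) (join k \<sigma> \<Gamma> \<nu>) (ExSet x \<phi>)"
      unfolding fst_ys B join_upd_set using sub by blast
  qed
qed

section \<open>Backwards translation through each kind of transduction\<close>

lemma definable_sentence:
  assumes "definable V Map.empty (\<lambda>A \<nu>. P A)"
  obtains \<phi> where "sentence V \<phi>" "\<And>A. A \<in> structures V \<Longrightarrow> A \<Turnstile> \<phi> \<longleftrightarrow> P A"
proof (rule definableE[OF assms])
  fix \<phi> assume \<phi>: "wf_formula V Map.empty \<phi>"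
    "\<And>A \<nu>. A \<in> structures V \<Longrightarrow> fits A Map.empty \<nu> \<Longrightarrow> sat A \<nu> \<phi> \<longleftrightarrow> P A"
  have "sentence V \<phi>" using \<phi>(1) by (simp add: formula_of_type_typed)
  then show thesis using \<phi>(2) models_sat[of V \<phi>] by (intro that[of \<phi>]) (auto simp: fits_def)
qed

lemma definable_models:
  assumes "sentence V \<phi>"
  shows "definable V \<Gamma> (\<lambda>A \<nu>. A \<Turnstile> \<phi>)"
  using assms wf_formula_mono[of V Map.empty \<phi> \<Gamma>] models_sat[OF assms]
  by (intro definableI[of _ _ \<phi>]) (auto simp: formula_of_type_typed)

lemma map_Some_nth:
  "map \<Gamma> xs = map Some \<tau> \<longleftrightarrow> length xs = length \<tau> \<and> (\<forall>i<length \<tau>. \<Gamma> (xs ! i) = Some (\<tau> ! i))"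
  by (auto simp: list_eq_iff_nth_eq)

lemma typed_Some: "typed \<tau> i = Some \<kappa> \<longleftrightarrow> i < length \<tau> \<and> \<tau> ! i = \<kappa>"
  by (simp add: typed_def)

lemma finite_dom_typed: "finite (dom (typed \<tau>))"
  by (rule finite_subset[of _ "{..<length \<tau>}"]) (auto simp: typed_Some)

text \<open>\<open>holds\<close> reads its \<open>i\<close>-th argument as the variable
  \<open>i\<close>, so this is renaming along \<open>(!) xs\<close>.\<close>

lemma definable_holds:
  assumes "formula_of_type V \<tau> \<phi>" "map \<Gamma> xs = map Some \<tau>"
  shows "definable V \<Gamma> (\<lambda>A \<nu>. holds A \<phi> (map \<nu> xs))"
proof -
  have wf: "wf_formula V (typed \<tau>) \<phi>" using assms(1) by (simp add: formula_of_type_typed)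
  have "definable V \<Gamma> (\<lambda>A \<nu>. sat A (\<nu> \<circ> (!) xs) \<phi>)"
    by (rule definable_rename[OF wf finite_dom_typed])
      (use assms(2) in \<open>auto simp: typed_Some map_Some_nth\<close>)
  then show ?thesis
    by (rule definable_cong) (auto simp: holds_def typed_Some map_Some_nth[THEN iffD1, OF assms(2)] intro!: sat_cong[OF wf])
qed

lemma definable_holds_elem:
  assumes "formula_of_type V [KElem] \<phi>" "\<Gamma> z = Some KElem"
  shows "definable V \<Gamma> (\<lambda>A \<nu>. holds A \<phi> [Elem (elem_of (\<nu> z))])"
  by (rule definable_cong[OF definable_holds[OF assms(1), of \<Gamma> "[z]"]])
    (use assms(2) fits_Elem[of _ \<Gamma> _ z] in auto)

lemma definable_tuples:
  assumes xs: "map \<Gamma> xs = map Some \<tau>"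
    and U: "\<And>\<Gamma>' z. \<Gamma>' z = Some KElem \<Longrightarrow> definable V \<Gamma>' (\<lambda>A \<nu>. elem_of (\<nu> z) \<in> U A)"
  shows "definable V \<Gamma> (\<lambda>A \<nu>. map \<nu> xs \<in> tuples (U A) \<tau>)"
proof -
  have l: "length xs = length \<tau>" and nth: "\<And>j. j < length \<tau> \<Longrightarrow> \<Gamma> (xs ! j) = Some (\<tau> ! j)"
    using xs by (auto simp: map_Some_nth)
  have "definable V \<Gamma> (\<lambda>A \<nu>. has_kind (U A) (\<nu> (xs ! j)) (\<tau> ! j))" if j: "j < length \<tau>" for j
  proof (cases "\<tau> ! j")
    case KElem
    then have "\<Gamma> (xs ! j) = Some KElem" using nth[OF j] by simp
    from U[of \<Gamma>, OF this] show ?thesis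
      by (rule definable_cong) (use KElem nth[OF j] fits_Elem[of _ \<Gamma> _ "xs ! j"] in \<open>metis has_kind.simps(1)\<close>)
  next
    case KSet
    then have X: "\<Gamma> (xs ! j) = Some KSet" using nth[OF j] by simp
    let ?z = "Suc (xs ! j)"
    have "definable V \<Gamma> (\<lambda>A \<nu>. \<forall>a\<in>universe A. elem_of ((\<nu>(?z := Elem a)) ?z) \<in> set_of ((\<nu>(?z := Elem a)) (xs ! j)) \<longrightarrow>
       elem_of ((\<nu>(?z := Elem a)) ?z) \<in> U A)"
      by (rule definable_all_elem, rule definable_imp[OF definable_mem U]) (use X in auto)
    then show ?thesis
    proof (rule definable_cong)
      fix A \<nu> assume "fits A \<Gamma> \<nu>"
      then obtain S where "S \<subseteq> universe A" "\<nu> (xs ! j) = SetArg S"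
        using fits_SetArg[of A \<Gamma> \<nu> "xs ! j"] X by metis
      then show "(\<forall>a\<in>universe A. elem_of ((\<nu>(?z := Elem a)) ?z) \<in> set_of ((\<nu>(?z := Elem a)) (xs ! j)) \<longrightarrow>
       elem_of ((\<nu>(?z := Elem a)) ?z) \<in> U A) \<longleftrightarrow> has_kind (U A) (\<nu> (xs ! j)) (\<tau> ! j)"
        using KSet by auto
    qed
  qed
  then have "definable V \<Gamma> (\<lambda>A \<nu>. \<forall>j\<in>{..<length \<tau>}. has_kind (U A) (\<nu> (xs ! j)) (\<tau> ! j))"
    by (intro definable_Ball) auto
  then show ?thesis
    by (rule definable_cong) (auto simp: tuples_def list_all2_conv_all_nth l)
qed

text \<open>With a single copy the code \<open>1 * a + 0\<close> is \<open>a\<close> itself, so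
  interpretations and colourings are instances of the translation in which decoding only reads slot
  0.\<close>

lemma join_one:
  assumes "fits A (lift_ctx 1 G \<Gamma>) \<nu>" "\<Gamma> x = Some \<kappa>" "\<And>x. \<Gamma> x = Some KElem \<Longrightarrow> \<sigma> x < 1"
  shows "join 1 \<sigma> \<Gamma> \<nu> x = \<nu> (part 1 x 0)"
proof (cases \<kappa>)
  case KElem
  then show ?thesis using assms fits_Elem[OF assms(1) lift_ctx_elem[of 1 \<Gamma> x G]]
    by (simp add: join_def)
next
  case KSet
  then show ?thesis using assms fits_SetArg[OF assms(1) lift_ctx_set[of 0 1 \<Gamma> x G]]
    by (simp add: join_def lessThan_Suc)
qed

lemma map_join_one:
  assumes "fits A (lift_ctx 1 G \<Gamma>) \<nu>" "map \<Gamma> xs = map Some \<tau>" "\<And>x. \<Gamma> x = Some KElem \<Longrightarrow> \<sigma> x < 1"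
  shows "map (join 1 \<sigma> \<Gamma> \<nu>) xs = map \<nu> (map (\<lambda>x. part 1 x 0) xs)"
  unfolding map_map
proof (rule map_cong[OF refl])
  fix x assume "x \<in> set xs"
  then have "\<Gamma> x \<in> Some ` set \<tau>" using assms(2) by (metis image_eqI list.set_map)
  then show "join 1 \<sigma> \<Gamma> \<nu> x = (\<nu> \<circ> (\<lambda>x. part 1 x 0)) x"
    using join_one[OF assms(1) _ assms(3)] by auto
qed

lemma lift_ctx_one_map:
  assumes "map \<Gamma> xs = map Some \<tau>"
  shows "map (lift_ctx 1 G \<Gamma>) (map (\<lambda>x. part 1 x 0) xs) = map Some \<tau>"
proof -
  have "lift_ctx 1 G \<Gamma> (part 1 x 0) = Some \<kappa>" if "\<Gamma> x = Some \<kappa>" for x \<kappa>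
    using that lift_ctx_elem[of 1 \<Gamma> x G] lift_ctx_set[of 0 1 \<Gamma> x G] by (cases \<kappa>) auto
  then show ?thesis using assms by (auto simp: map_Some_nth)
qed

lemma sat_join_empty: 
  assumes "sentence W \<phi>" shows "sat B (join k \<sigma> Map.empty \<nu>) \<phi> \<longleftrightarrow> B \<Turnstile> \<phi>"
  using models_sat[OF assms] by blast

text \<open>The translation with one copy and no parameters; the atoms of the output are the
  defining formulas \<open>\<psi> R\<close>, restricted to tuples over the new universe.\<close>

lemma interpretation_backwards:
  assumes \<phi>: "formula_of_type V [KElem] \<phi>"
    and \<psi>: "\<And>R \<tau>. fmlookup W R = Some \<tau> \<Longrightarrow> formula_of_type V \<tau> (\<psi> R)"
    and \<chi>: "sentence W \<chi>"
  shows "definable V Map.empty (\<lambda>A \<nu>. \<exists>B. (A, B) \<in> interpretation_rel V W \<phi> \<psi> \<and> B \<Turnstile> \<chi>)"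
proof -
  let ?B = "\<lambda>A. interpret_struct W \<phi> \<psi> A"
  have U: "definable V \<Gamma> (\<lambda>A \<nu>. elem_of (\<nu> z) \<in> universe (?B A))" if "\<Gamma> z = Some KElem" for \<Gamma> z
    by (rule definable_cong[OF definable_holds_elem[OF \<phi>, of \<Gamma> z, OF that]])
      (use that fits_Elem[of _ \<Gamma> _ z] in \<open>auto simp: interpret_struct_def Let_def\<close>)
  have "definable V (lift_ctx 1 Map.empty Map.empty) (\<lambda>A \<nu>. sat (?B A) (join 1 (\<lambda>_. 0) Map.empty \<nu>) \<chi>)"
  proof (rule definable_translation[where B = "\<lambda>A _. ?B A" and W = W])
    show "\<exists>i<1. \<exists>a\<in>universe A. u = 1 * a + i" if "u \<in> universe (?B A)" for A u
      using that by (auto simp: interpret_struct_def Let_def)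
    show "definable V \<Gamma> (\<lambda>A \<nu>. 1 * elem_of (\<nu> z) + i \<in> universe (?B A))"
      if "i < 1" "\<Gamma> z = Some KElem" for \<Gamma> z i using U[of \<Gamma>, OF that(2)] that(1) by simp
    show "definable V (lift_ctx 1 Map.empty \<Gamma>) (\<lambda>A \<nu>. map (join 1 \<sigma> \<Gamma> \<nu>) xs \<in> rel (?B A) R)"
      if R: "fmlookup W R = Some \<tau>" and xs: "map \<Gamma> xs = map Some \<tau>" and \<sigma>: "\<And>x. \<Gamma> x = Some KElem \<Longrightarrow> \<sigma> x < 1"
      for \<Gamma> \<sigma> R \<tau> xs
    proof -
      let ?xs = "map (\<lambda>x. part 1 x 0) xs"
      note xs' = lift_ctx_one_map[OF xs, of Map.empty]
      have "definable V (lift_ctx 1 Map.empty \<Gamma>)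
         (\<lambda>A \<nu>. map \<nu> ?xs \<in> tuples (universe (?B A)) \<tau> \<and> holds A (\<psi> R) (map \<nu> ?xs))"
        by (intro definable_conj definable_tuples[OF xs'] U definable_holds[OF \<psi>[OF R] xs'])
      then show ?thesis
        by (rule definable_cong)
          (subst map_join_one[OF _ xs \<sigma>], assumption+, simp add: interpret_struct_def Let_def R del: map_map)
    qed
  qed (use \<chi> in \<open>auto simp: formula_of_type_typed\<close>)
  then have "definable V Map.empty (\<lambda>A \<nu>. ?B A \<Turnstile> \<chi>)"
    unfolding sat_join_empty[OF \<chi>] by (rule definable_mono) (auto simp: map_le_def lift_ctx_def)
  \<comment> \<open>An interpretation is undefined when it would produce an empty universe, while
    \<open>\<chi>\<close> may well hold there; this case has to be excluded explicitly.\<close>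
  moreover have "definable V Map.empty (\<lambda>A \<nu>. \<exists>a\<in>universe A. elem_of ((\<nu>(0 := Elem a)) 0) \<in> universe (?B A))"
    by (rule definable_ex_elem, rule U) simp
  ultimately have "definable V Map.empty (\<lambda>A \<nu>. ?B A \<Turnstile> \<chi> \<and>
      (\<exists>a\<in>universe A. elem_of ((\<nu>(0 := Elem a)) 0) \<in> universe (?B A)))"
    by (rule definable_conj)
  then show ?thesis
  proof (rule definable_cong)
    fix A \<nu> assume A: "A \<in> structures V"
    have ne: "(\<exists>a\<in>universe A. elem_of ((\<nu>(0 := Elem a)) 0) \<in> universe (?B A)) \<longleftrightarrow> universe (?B A) \<noteq> {}"
      by (auto simp: interpret_struct_def Let_def)
    show "?B A \<Turnstile> \<chi> \<and> (\<exists>a\<in>universe A. elem_of ((\<nu>(0 := Elem a)) 0) \<in> universe (?B A)) \<longleftrightarrow>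
      (\<exists>B. (A, B) \<in> interpretation_rel V W \<phi> \<psi> \<and> B \<Turnstile> \<chi>)" unfolding ne
    proof
      assume *: "?B A \<Turnstile> \<chi> \<and> universe (?B A) \<noteq> {}"
      then show "\<exists>B. (A, B) \<in> interpretation_rel V W \<phi> \<psi> \<and> B \<Turnstile> \<chi>"
        using A interpret_struct_structures[OF A] iso_refl[of "?B A"]
        by (intro exI[of _ "?B A"]) (simp add: interpretation_rel_def)
    next
      assume "\<exists>B. (A, B) \<in> interpretation_rel V W \<phi> \<psi> \<and> B \<Turnstile> \<chi>"
      then obtain B where B: "B \<in> structures W" "?B A \<simeq> B" "B \<Turnstile> \<chi>" by (auto simp: interpretation_rel_def)
      then have ne: "universe (?B A) \<noteq> {}" using structuresD(2)[OF B(1)]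
        by (auto simp: isomorphic_def bij_betw_def)
      then show "?B A \<Turnstile> \<chi> \<and> universe (?B A) \<noteq> {}"
        using models_iso[OF interpret_struct_structures[OF A ne] B(2) \<chi>] B(3) by simp
    qed
  qed
qed

lemma filter_backwards:
  assumes "sentence V \<phi>" "sentence V \<chi>"
  shows "definable V Map.empty (\<lambda>A \<nu>. \<exists>B. (A, B) \<in> filter_rel V \<phi> \<and> B \<Turnstile> \<chi>)"
proof (rule definable_cong)
  show "definable V Map.empty (\<lambda>A \<nu>. A \<Turnstile> \<phi> \<and> A \<Turnstile> \<chi>)"
    using assms by (intro definable_conj definable_models)
  show "A \<Turnstile> \<phi> \<and> A \<Turnstile> \<chi> \<longleftrightarrow> (\<exists>B. (A, B) \<in> filter_rel V \<phi> \<and> B \<Turnstile> \<chi>)"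
    if "A \<in> structures V" for A
  proof
    assume "A \<Turnstile> \<phi> \<and> A \<Turnstile> \<chi>"
    then show "\<exists>B. (A, B) \<in> filter_rel V \<phi> \<and> B \<Turnstile> \<chi>"
      using that iso_refl[of A] by (intro exI[of _ A]) (simp add: filter_rel_def)
  next
    assume "\<exists>B. (A, B) \<in> filter_rel V \<phi> \<and> B \<Turnstile> \<chi>"
    then obtain B where "A \<Turnstile> \<phi>" "A \<simeq> B" "B \<Turnstile> \<chi>" by (auto simp: filter_rel_def)
    then show "A \<Turnstile> \<phi> \<and> A \<Turnstile> \<chi>" using models_iso[OF that _ assms(2)] by blast
  qed
qed

text \<open>A canonical output of copying, with elements coded as the translation expects. By
  \<open>copy_rel_iso\<close> every other output is isomorphic to it, so it is enough to evaluate
  \<open>\<chi>\<close> here.\<close>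

definition copy_struct :: "nat \<Rightarrow> rel_name \<Rightarrow> struct \<Rightarrow> struct" where
  "copy_struct k c A =
     \<lparr>universe = {k * a + i | i a. i < k \<and> a \<in> universe A},
      rel = (\<lambda>R. if R = c then (\<lambda>a. map (\<lambda>i. Elem (k * a + i)) [0..<k]) ` universe A
                 else (\<Union>i<k. map (map_arg (\<lambda>a. k * a + i)) ` rel A R))\<rparr>"

lemma copy_struct_copy:
  assumes "A \<in> structures V"
  shows "(A, copy_struct k c A) \<in> copy_rel V k c"
  unfolding copy_rel_def
  by (auto simp: assms copy_struct_def inj_on_def mult_add_eq_iff intro!: exI[of _ "\<lambda>i a. k * a + i"])

lemma copy_structures:
  assumes "1 \<le> k" "c \<notin> fmdom' V" "(A, B) \<in> copy_rel V k c"
  shows "B \<in> structures (fmupd c (replicate k KElem) V)"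
proof -
  obtain h where A: "A \<in> structures V" and U: "universe B = (\<Union>i<k. h i ` universe A)"
    and rel: "\<And>R. rel B R =
           (if R = c then (\<lambda>a. map (\<lambda>i. Elem (h i a)) [0..<k]) ` universe A
            else (\<Union>i<k. map (map_arg (h i)) ` rel A R))"
    using assms(3) unfolding copy_rel_def by blast
  show ?thesis
  proof (rule structuresI)
    show "finite (universe B)" using U structuresD(1)[OF A] by simp
    show "universe B \<noteq> {}" using U structuresD(2)[OF A] assms(1) by (auto simp: Suc_le_eq)
    fix R
    show "rel B R = {}" if "fmlookup (fmupd c (replicate k KElem) V) R = None"
      using that structuresD(3)[OF A, of R] rel by (auto split: if_splits)
    show "rel B R \<subseteq> tuples (universe B) \<tau>" if R: "fmlookup (fmupd c (replicate k KElem) V) R = Some \<tau>" for \<tau>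
    proof (cases "R = c")
      case True
      then show ?thesis using R rel U
        by (auto simp: tuples_def list_all2_conv_all_nth) (meson imageI lessThan_iff)
    next
      case False
      then have "rel A R \<subseteq> tuples (universe A) \<tau>" using R structuresD(4)[OF A] by simp
      moreover have "h i ` universe A \<subseteq> universe B" if "i < k" for i using that U by auto
      ultimately show ?thesis using False rel tuples_map_arg by fastforce
    qed
  qed
qed

lemma copy_rel_iso:
  assumes "1 \<le> k" "(A, B) \<in> copy_rel V k c"
  shows "copy_struct k c A \<simeq> B"
proof -
  obtain h where A: "A \<in> structures V" and inj: "inj_on (\<lambda>(i, a). h i a) ({..<k} \<times> universe A)"
    and U: "universe B = (\<Union>i<k. h i ` universe A)"
    and rel: "\<And>R. rel B R =
           (if R = c then (\<lambda>a. map (\<lambda>i. Elem (h i a)) [0..<k]) ` universe A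
            else (\<Union>i<k. map (map_arg (h i)) ` rel A R))"
    using assms(2) unfolding copy_rel_def by blast
  define g where "g = (\<lambda>u. h (u mod k) (u div k))"
  have g: "g (k * a + i) = h i a" if "i < k" for i a using that by (simp add: g_def)
  have "bij_betw g (universe (copy_struct k c A)) (universe B)"
    unfolding bij_betw_def
  proof
    show "inj_on g (universe (copy_struct k c A))"
    proof (rule inj_onI)
      fix u v assume "u \<in> universe (copy_struct k c A)" "v \<in> universe (copy_struct k c A)" and eq: "g u = g v"
      then obtain a i b j where *: "u = k * a + i" "v = k * b + j" "i < k" "j < k" "a \<in> universe A" "b \<in> universe A"
        by (auto simp: copy_struct_def)
      then have "h i a = h j b" using eq g by simp
      then have "i = j \<and> a = b" using inj_onD[OF inj, of "(i, a)" "(j, b)"] * by simp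
      then show "u = v" using * by simp
    qed
    show "g ` universe (copy_struct k c A) = universe B"
      unfolding U copy_struct_def using g by (auto simp: image_iff) (metis g)+
  qed
  moreover have "rel B R = map (map_arg g) ` rel (copy_struct k c A) R" for R
  proof -
    have "map_arg g \<circ> map_arg (\<lambda>a. k * a + i) = map_arg (h i)" if "i < k" for i
      using that g by (auto simp: fun_eq_iff map_arg_comp comp_def)
    then have "map (map_arg g) (map (map_arg (\<lambda>a. k * a + i)) as) = map (map_arg (h i)) as" if "i < k" for i as
      using that by simp
    then have "(\<Union>i<k. map (map_arg (h i)) ` rel A R) = map (map_arg g) ` (\<Union>i<k. map (map_arg (\<lambda>a. k * a + i)) ` rel A R)"
      unfolding image_UN image_image by (intro SUP_cong image_cong refl) (simp only: lessThan_iff)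
    moreover have "map (map_arg g) (map (\<lambda>i. Elem (k * a + i)) [0..<k]) = map (\<lambda>i. Elem (h i a)) [0..<k]" for a
      using g by simp
    ultimately show ?thesis unfolding rel copy_struct_def by (simp only: image_image select_convs split: if_split) simp
  qed
  ultimately show ?thesis unfolding isomorphic_def by blast
qed

text \<open>The translation with \<open>k\<close> copies. The work lies in the atoms, where it must
  be expressed that a tuple of decoded arguments is a row of the copy relation or lives within one
  copy.\<close>

lemma copy_backwards:
  assumes k: "1 \<le> k" and c: "c \<notin> fmdom' V"
    and \<chi>: "sentence (fmupd c (replicate k KElem) V) \<chi>"
  shows "definable V Map.empty (\<lambda>A \<nu>. \<exists>B. (A, B) \<in> copy_rel V k c \<and> B \<Turnstile> \<chi>)"
proof -
  let ?B = "\<lambda>A. copy_struct k c A"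
  let ?W = "fmupd c (replicate k KElem) V"
  have "definable V (lift_ctx k Map.empty Map.empty) (\<lambda>A \<nu>. sat (?B A) (join k (\<lambda>_. 0) Map.empty \<nu>) \<chi>)"
  proof (rule definable_translation[where B = "\<lambda>A _. ?B A" and W = ?W, OF k])
    show "\<exists>i<k. \<exists>a\<in>universe A. u = k * a + i" if "u \<in> universe (?B A)" for A u
      using that by (auto simp: copy_struct_def)
    show "definable V \<Gamma> (\<lambda>A \<nu>. k * elem_of (\<nu> z) + i \<in> universe (?B A))"
      if "i < k" "\<Gamma> z = Some KElem" for \<Gamma> z i
      by (rule definable_cong[OF definable_true])
        (use that fits_Elem[of _ \<Gamma> _ z] in \<open>auto simp: copy_struct_def\<close>)
    show "definable V (lift_ctx k Map.empty \<Gamma>) (\<lambda>A \<nu>. map (join k \<sigma> \<Gamma> \<nu>) xs \<in> rel (?B A) R)"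
      if R: "fmlookup ?W R = Some \<tau>" and xs: "map \<Gamma> xs = map Some \<tau>" and \<sigma>: "\<And>x. \<Gamma> x = Some KElem \<Longrightarrow> \<sigma> x < k"
      for \<Gamma> \<sigma> R \<tau> xs
    proof -
      have l: "length xs = length \<tau>" and nth: "\<And>j. j < length \<tau> \<Longrightarrow> \<Gamma> (xs ! j) = Some (\<tau> ! j)"
        using xs by (auto simp: map_Some_nth)
      show ?thesis
      proof (cases "R = c")
        case True
        then have \<tau>: "\<tau> = replicate k KElem" using R by simp
        have \<Gamma>: "\<Gamma> (xs ! j) = Some KElem" if "j < k" for j using nth[of j] that \<tau> by simp
        let ?x = "\<lambda>j. part k (xs ! j) 0"
        \<comment> \<open>A row of the copy relation: all positions come from one input element, and
          position \<open>j\<close> carries the index \<open>j\<close>.\<close>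
        have "definable V (lift_ctx k Map.empty \<Gamma>) (\<lambda>A \<nu>. \<forall>j\<in>{..<k}. elem_of (\<nu> (?x j)) = elem_of (\<nu> (?x 0)) \<and> \<sigma> (xs ! j) = j)"
          using k by (intro definable_Ball definable_conj definable_elem_eq definable_const lift_ctx_elem[OF k] \<Gamma>) auto
        then show ?thesis
        proof (rule definable_cong)
          fix A \<nu> assume fit: "fits A (lift_ctx k Map.empty \<Gamma>) \<nu>"
          have a0: "elem_of (\<nu> (?x 0)) \<in> universe A"
            using fits_Elem[OF fit lift_ctx_elem[OF k, of \<Gamma> "xs ! 0"]] \<Gamma>[of 0] k by simp
          have "map (join k \<sigma> \<Gamma> \<nu>) xs = map (\<lambda>i. Elem (k * a + i)) [0..<k] \<longleftrightarrow>
             (\<forall>j<k. elem_of (\<nu> (?x j)) = a \<and> \<sigma> (xs ! j) = j)" for a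
            using \<Gamma> l \<tau> \<sigma> by (auto simp: list_eq_iff_nth_eq join_def mult_add_eq_iff)
          then show "(\<forall>j\<in>{..<k}. elem_of (\<nu> (?x j)) = elem_of (\<nu> (?x 0)) \<and> \<sigma> (xs ! j) = j) \<longleftrightarrow>
            map (join k \<sigma> \<Gamma> \<nu>) xs \<in> rel (?B A) R"
            using True a0 k by (auto simp: copy_struct_def image_iff)
        qed
      next
        case False
        then have RV: "fmlookup V R = Some \<tau>" using R by simp
        \<comment> \<open>The variable that holds the component of \<open>x\<close> in copy
          \<open>i\<close>; for an element variable this is slot 0, provided that its index is
          \<open>i\<close>, which \<open>?ok\<close> checks.\<close>
        let ?sel = "\<lambda>i x. part k x (if \<Gamma> x = Some KSet then i else 0)"
        let ?ok = "\<lambda>i \<nu> x. (\<Gamma> x = Some KElem \<longrightarrow> \<sigma> x = i) \<and>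
           (\<Gamma> x = Some KSet \<longrightarrow> (\<forall>j<k. j \<noteq> i \<longrightarrow> set_of (\<nu> (part k x j)) = {}))"
        have sel: "lift_ctx k Map.empty \<Gamma> (?sel i x) = Some \<kappa>" if "\<Gamma> x = Some \<kappa>" "i < k" for x \<kappa> i
          using that k by (cases \<kappa>) (auto intro: lift_ctx_elem lift_ctx_set)
        have emp: "definable V \<Gamma>' (\<lambda>A \<nu>. set_of (\<nu> X) = {})" if X: "\<Gamma>' X = Some KSet" for \<Gamma>' X
        proof -
          let ?z = "Suc X"
          have "definable V \<Gamma>' (\<lambda>A \<nu>. \<forall>a\<in>universe A. \<not> elem_of ((\<nu>(?z := Elem a)) ?z) \<in> set_of ((\<nu>(?z := Elem a)) X))"
            by (rule definable_all_elem, rule definable_neg, rule definable_mem) (use X in auto)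
          then show ?thesis
            by (rule definable_cong) (use X fits_SetArg[of _ \<Gamma>' _ X] in auto)
        qed
        \<comment> \<open>The copy is guessed existentially rather than read off the arguments: a
          tuple without element arguments whose sets are all empty, in particular the nullary tuple,
          lies in every copy.\<close>
        have "definable V (lift_ctx k Map.empty \<Gamma>) (\<lambda>A \<nu>. \<exists>i\<in>{..<k}. (\<forall>x\<in>set xs. (\<Gamma> x = Some KElem \<longrightarrow> \<sigma> x = i) \<and>
           (\<Gamma> x = Some KSet \<longrightarrow> (\<forall>j\<in>{..<k}. j \<noteq> i \<longrightarrow> set_of (\<nu> (part k x j)) = {}))) \<and>
             map \<nu> (map (?sel i) xs) \<in> rel A R)"
        proof (intro definable_Bex finite_lessThan definable_conj definable_Ball finite_set definable_const definable_atom[OF RV])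
          fix i x assume i: "i \<in> {..<k}" and "x \<in> set xs"
          have "definable V (lift_ctx k Map.empty \<Gamma>) (\<lambda>A \<nu>. \<forall>j\<in>{..<k}. j \<noteq> i \<longrightarrow> set_of (\<nu> (part k x j)) = {})"
            if "\<Gamma> x = Some KSet"
            using that by (intro definable_Ball definable_imp definable_const emp lift_ctx_set) auto
          then show "definable V (lift_ctx k Map.empty \<Gamma>) (\<lambda>A \<nu>. \<Gamma> x = Some KSet \<longrightarrow> (\<forall>j\<in>{..<k}. j \<noteq> i \<longrightarrow> set_of (\<nu> (part k x j)) = {}))"
            by (cases "\<Gamma> x = Some KSet") (simp_all add: definable_true)
        next
          fix i assume i: "i \<in> {..<k}"
          show "map (lift_ctx k Map.empty \<Gamma>) (map (?sel i) xs) = map Some \<tau>"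
            using i sel nth l by (simp add: map_Some_nth)
        qed
        then show ?thesis
        proof (rule definable_cong)
          fix A \<nu> assume A: "A \<in> structures V" and fit: "fits A (lift_ctx k Map.empty \<Gamma>) \<nu>"
          have one: "join k \<sigma> \<Gamma> \<nu> x = map_arg (\<lambda>a. k * a + i) v \<longleftrightarrow> ?ok i \<nu> x \<and> v = \<nu> (?sel i x)"
            if i: "i < k" and x: "\<Gamma> x = Some \<kappa>" and v: "has_kind (universe A) v \<kappa>" for i x v \<kappa>
          proof (cases \<kappa>)
            case KElem
            then have "\<nu> (part k x 0) = Elem (elem_of (\<nu> (part k x 0)))"
              using fits_Elem[OF fit lift_ctx_elem[OF k]] x by blast
            moreover obtain a where "v = Elem a" using v KElem by (auto simp: has_kind_KElem)
            ultimately show ?thesis using KElem x \<sigma>[of x] i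
              by (auto simp: join_def mult_add_eq_iff) (metis elem_of.simps(1))+
          next
            case KSet
            have S: "\<nu> (part k x j) = SetArg (set_of (\<nu> (part k x j)))" if "j < k" for j
              using fits_SetArg[OF fit lift_ctx_set[OF that]] x KSet by blast
            obtain T where T: "v = SetArg T" using v KSet by (auto simp: has_kind_KSet)
            let ?S = "\<lambda>j. set_of (\<nu> (part k x j))"
            have "(\<Union>j<k. (\<lambda>a. k * a + j) ` ?S j) = (\<lambda>a. k * a + i) ` T \<longleftrightarrow>
              (\<forall>j<k. j \<noteq> i \<longrightarrow> ?S j = {}) \<and> T = ?S i" (is "?U = _ \<longleftrightarrow> _")
            proof
              assume eq: "?U = (\<lambda>a. k * a + i) ` T"
              have 1: "a \<in> T \<and> j = i" if "j < k" "a \<in> ?S j" for j a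
              proof -
                have "k * a + j \<in> ?U" using that by blast
                then obtain b where "b \<in> T" "k * a + j = k * b + i" unfolding eq by blast
                then show ?thesis using mult_add_eq_iff[OF that(1) i] by auto
              qed
              have 2: "a \<in> ?S i" if "a \<in> T" for a
              proof -
                have "k * a + i \<in> ?U" unfolding eq using that by blast
                then obtain b j where "j < k" "b \<in> ?S j" "k * a + i = k * b + j" by blast
                then show ?thesis using mult_add_eq_iff[OF i \<open>j < k\<close>] by auto
              qed
              show "(\<forall>j<k. j \<noteq> i \<longrightarrow> ?S j = {}) \<and> T = ?S i" using 1 2 i by blast
            next
              assume "(\<forall>j<k. j \<noteq> i \<longrightarrow> ?S j = {}) \<and> T = ?S i"
              then show "?U = (\<lambda>a. k * a + i) ` T" using i by auto
            qed
            moreover have "v = \<nu> (part k x i) \<longleftrightarrow> T = ?S i" using T S[OF i] by (metis set_of.simps(2))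
            ultimately show ?thesis using KSet x T by (simp add: join_def)
          qed
          have "(map (join k \<sigma> \<Gamma> \<nu>) xs = map (map_arg (\<lambda>a. k * a + i)) as) \<longleftrightarrow>
            (\<forall>x\<in>set xs. ?ok i \<nu> x) \<and> as = map \<nu> (map (?sel i) xs)"
            if i: "i < k" and as: "as \<in> rel A R" for i as
          proof -
            have t: "length as = length \<tau>" "\<And>j. j < length \<tau> \<Longrightarrow> has_kind (universe A) (as ! j) (\<tau> ! j)"
              using structuresD(4)[OF A RV] as by (auto simp: tuples_def list_all2_conv_all_nth)
            have "(map (join k \<sigma> \<Gamma> \<nu>) xs = map (map_arg (\<lambda>a. k * a + i)) as) \<longleftrightarrow>
              (\<forall>j<length \<tau>. join k \<sigma> \<Gamma> \<nu> (xs ! j) = map_arg (\<lambda>a. k * a + i) (as ! j))"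
              using t(1) l by (auto simp: list_eq_iff_nth_eq)
            also have "\<dots> \<longleftrightarrow> (\<forall>j<length \<tau>. ?ok i \<nu> (xs ! j) \<and> as ! j = \<nu> (?sel i (xs ! j)))"
              using one[OF i nth t(2)] by simp
            also have "\<dots> \<longleftrightarrow> (\<forall>x\<in>set xs. ?ok i \<nu> x) \<and> as = map \<nu> (map (?sel i) xs)"
              using t(1) l by (auto simp: list_eq_iff_nth_eq all_set_conv_all_nth)
            finally show ?thesis .
          qed
          then show "(\<exists>i\<in>{..<k}. (\<forall>x\<in>set xs. (\<Gamma> x = Some KElem \<longrightarrow> \<sigma> x = i) \<and>
           (\<Gamma> x = Some KSet \<longrightarrow> (\<forall>j\<in>{..<k}. j \<noteq> i \<longrightarrow> set_of (\<nu> (part k x j)) = {}))) \<and>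
             map \<nu> (map (?sel i) xs) \<in> rel A R) \<longleftrightarrow> map (join k \<sigma> \<Gamma> \<nu>) xs \<in> rel (?B A) R"
            using False by (simp add: copy_struct_def image_iff Ball_def del: map_map)
        qed
      qed
    qed
  qed (use \<chi> in \<open>auto simp: formula_of_type_typed\<close>)
  then have "definable V Map.empty (\<lambda>A \<nu>. ?B A \<Turnstile> \<chi>)"
    unfolding sat_join_empty[OF \<chi>] by (rule definable_mono) (auto simp: map_le_def lift_ctx_def)
  then show ?thesis
  proof (rule definable_cong)
    fix A assume A: "A \<in> structures V"
    show "?B A \<Turnstile> \<chi> \<longleftrightarrow> (\<exists>B. (A, B) \<in> copy_rel V k c \<and> B \<Turnstile> \<chi>)"
      using copy_struct_copy[OF A] copy_rel_iso[OF k]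
        models_iso[OF copy_structures[OF k c copy_struct_copy[OF A]] _ \<chi>] by blast
  qed
qed

abbreviation colour_vocab :: "vocabulary \<Rightarrow> rel_name list \<Rightarrow> vocabulary" where
  "colour_vocab V qs \<equiv> V ++\<^sub>f fmap_of_list (map (\<lambda>q. (q, [KElem])) qs)"

lemma fmlookup_colour_vocab:
  "fmlookup (colour_vocab V qs) R = (if R \<in> set qs then Some [KElem] else fmlookup V R)"
proof -
  have "map_of (map (\<lambda>q. (q, [KElem])) qs) R = (if R \<in> set qs then Some [KElem] else None)"
    by (induction qs) auto
  then show ?thesis by (auto simp: fmlookup_of_list map_add_def fset_of_list_elem split: option.splits)
qed

lemma colour_structures:
  assumes A: "A \<in> structures V"
  shows "colour_struct qs c A \<in> structures (colour_vocab V qs)"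
proof (rule structuresI)
  fix R
  show "rel (colour_struct qs c A) R = {}" if "fmlookup (colour_vocab V qs) R = None"
    using that structuresD(3)[OF A, of R] unfolding fmlookup_colour_vocab
    by (auto simp: colour_struct_def split: if_splits)
  show "rel (colour_struct qs c A) R \<subseteq> tuples (universe (colour_struct qs c A)) \<tau>"
    if "fmlookup (colour_vocab V qs) R = Some \<tau>" for \<tau>
    using that structuresD(4)[OF A, of R] unfolding fmlookup_colour_vocab
    by (auto simp: colour_struct_def tuples_def split: if_splits)
qed (use structuresD(1,2)[OF A] in \<open>simp_all add: colour_struct_def\<close>)

text \<open>The colouring with its classes stored in parameters: with one copy,
  \<open>part 1 j 1\<close> is the parameter slot of block \<open>j\<close>. The sets are arbitrary
  here; that they form a partition is required separately.\<close>

definition colour_by :: "rel_name list \<Rightarrow> struct \<Rightarrow> (nat \<Rightarrow> arg) \<Rightarrow> struct" where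
  "colour_by qs A \<nu> = A\<lparr>rel := (\<lambda>R. if R \<in> set qs
     then {[Elem a] | a. a \<in> universe A \<and> (\<exists>j<length qs. qs ! j = R \<and> a \<in> set_of (\<nu> (part 1 j 1)))}
     else rel A R)\<rparr>"

lemma colour_struct_eq:
  assumes "\<And>a j. a \<in> universe A \<Longrightarrow> j < length qs \<Longrightarrow> a \<in> set_of (\<nu> (part 1 j 1)) \<longleftrightarrow> c a = qs ! j"
  shows "colour_by qs A \<nu> = colour_struct qs c A"
proof -
  have "(\<exists>j<length qs. qs ! j = R \<and> a \<in> set_of (\<nu> (part 1 j 1))) \<longleftrightarrow> c a = R"
    if "a \<in> universe A" "R \<in> set qs" for a R
    using assms[OF that(1)] that(2) by (metis in_set_conv_nth)
  then have "{[Elem a] | a. a \<in> universe A \<and> (\<exists>j<length qs. qs ! j = R \<and> a \<in> set_of (\<nu> (part 1 j 1)))} =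
     {[Elem a] | a. a \<in> universe A \<and> c a = R}" if "R \<in> set qs" for R
    using that by blast
  then show ?thesis unfolding colour_by_def colour_struct_def by (simp cong: if_cong)
qed

text \<open>Nondeterminism becomes quantification: \<open>\<chi>\<close> is translated with the
  colour classes as parameters, and these are then quantified existentially under the condition that
  they partition the universe.\<close>

lemma colour_backwards:
  assumes qs: "distinct qs" and \<chi>: "sentence (colour_vocab V qs) \<chi>"
  shows "definable V Map.empty (\<lambda>A \<nu>. \<exists>B. (A, B) \<in> colour_rel V qs \<and> B \<Turnstile> \<chi>)"
proof -
  let ?n = "length qs" and ?W = "colour_vocab V qs" and ?B = "colour_by qs"
  let ?Z = "\<lambda>\<nu>. \<lambda>j. set_of (\<nu> (part 1 j 1))"
  define G where "G = (\<lambda>j. if j < ?n then Some KSet else None)"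
  have 1: "definable V (lift_ctx 1 G Map.empty) (\<lambda>A \<nu>. sat (?B A \<nu>) (join 1 (\<lambda>_. 0) Map.empty \<nu>) \<chi>)"
  proof (rule definable_translation[where B = ?B and W = ?W])
    show "?B A \<nu> = ?B A \<nu>'" if "\<And>x. \<nu> (part 1 x 1) = \<nu>' (part 1 x 1)" for A \<nu> \<nu>'
      unfolding colour_by_def that ..
    show "\<exists>i<1. \<exists>a\<in>universe A. u = 1 * a + i" if "u \<in> universe (?B A \<nu>)" for A \<nu> u
      using that by (auto simp: colour_by_def)
    show "definable V \<Gamma> (\<lambda>A \<nu>. 1 * elem_of (\<nu> z) + i \<in> universe (?B A \<nu>))"
      if "i < 1" "\<Gamma> z = Some KElem" for \<Gamma> z i
      by (rule definable_cong[OF definable_true])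
        (use that fits_Elem[of _ \<Gamma> _ z] in \<open>auto simp: colour_by_def\<close>)
    show "definable V (lift_ctx 1 G \<Gamma>) (\<lambda>A \<nu>. map (join 1 \<sigma> \<Gamma> \<nu>) xs \<in> rel (?B A \<nu>) R)"
      if R: "fmlookup ?W R = Some \<tau>" and xs: "map \<Gamma> xs = map Some \<tau>" and \<sigma>: "\<And>x. \<Gamma> x = Some KElem \<Longrightarrow> \<sigma> x < 1"
      for \<Gamma> \<sigma> R \<tau> xs
    proof -
      let ?xs = "map (\<lambda>x. part 1 x 0) xs"
      note xs' = lift_ctx_one_map[OF xs, of G]
      have "definable V (lift_ctx 1 G \<Gamma>) (\<lambda>A \<nu>. map \<nu> ?xs \<in> rel (?B A \<nu>) R)"
      proof (cases "R \<in> set qs")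
        case True
        then obtain x where x: "xs = [x]" "\<Gamma> x = Some KElem"
          using R xs unfolding fmlookup_colour_vocab by auto
        then have z: "lift_ctx 1 G \<Gamma> (part 1 x 0) = Some KElem" by (intro lift_ctx_elem) auto
        have "definable V (lift_ctx 1 G \<Gamma>) (\<lambda>A \<nu>. \<exists>j\<in>{..<?n}. qs ! j = R \<and> elem_of (\<nu> (part 1 x 0)) \<in> set_of (\<nu> (part 1 j 1)))"
          by (intro definable_Bex finite_lessThan definable_conj definable_const definable_mem z)
            (unfold lift_ctx_param, simp add: G_def)
        then show ?thesis
        proof (rule definable_cong)
          fix A \<nu> assume "fits A (lift_ctx 1 G \<Gamma>) \<nu>"
          then obtain a where "a \<in> universe A" "\<nu> (part 1 x 0) = Elem a"
            using fits_Elem[of A "lift_ctx 1 G \<Gamma>" \<nu> "part 1 x 0"] z by blast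
          then show "(\<exists>j\<in>{..<?n}. qs ! j = R \<and> elem_of (\<nu> (part 1 x 0)) \<in> set_of (\<nu> (part 1 j 1))) \<longleftrightarrow>
            map \<nu> ?xs \<in> rel (?B A \<nu>) R"
            using True x(1) by (auto simp: colour_by_def simp del: One_nat_def)
        qed
      next
        case False
        then have "fmlookup V R = Some \<tau>" using R unfolding fmlookup_colour_vocab by simp
        then show ?thesis using definable_atom[OF _ xs'] False by (simp add: colour_by_def del: One_nat_def map_map)
      qed
      then show ?thesis
        by (rule definable_cong) (subst map_join_one[OF _ xs \<sigma>], assumption+, rule refl)
    qed
  qed (use \<chi> in \<open>auto simp: formula_of_type_typed\<close>)
  let ?z = "part 1 0 0"
  have part: "definable V (lift_ctx 1 G Map.empty) (\<lambda>A \<nu>. \<forall>a\<in>universe A. \<exists>j\<in>{..<?n}.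
     elem_of ((\<nu>(?z := Elem a)) ?z) \<in> ?Z (\<nu>(?z := Elem a)) j \<and>
     (\<forall>i\<in>{..<?n}. i \<noteq> j \<longrightarrow> \<not> elem_of ((\<nu>(?z := Elem a)) ?z) \<in> ?Z (\<nu>(?z := Elem a)) i))"
    by (rule definable_all_elem,
        intro definable_Ball definable_Bex finite_lessThan definable_conj definable_imp definable_neg
          definable_const definable_mem)
      (simp_all add: part_eq_iff lift_ctx_param[of 1, simplified] G_def)
  let ?P = "\<lambda>A \<nu>. (\<forall>a\<in>universe A. \<exists>j\<in>{..<?n}. a \<in> ?Z \<nu> j \<and> (\<forall>i\<in>{..<?n}. i \<noteq> j \<longrightarrow> a \<notin> ?Z \<nu> i)) \<and> ?B A \<nu> \<Turnstile> \<chi>"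
  let ?ys = "map (\<lambda>j. (part 1 j 1, KSet)) [0..<?n]"
  have "definable V (lift_ctx 1 G Map.empty) ?P"
    by (rule definable_cong[OF definable_conj[OF part 1[unfolded sat_join_empty[OF \<chi>]]]])
      (simp add: part_eq_iff)
  moreover have "lift_ctx 1 G Map.empty \<subseteq>\<^sub>m Map.empty ++ map_of ?ys"
    unfolding map_le_def
  proof
    fix z assume "z \<in> dom (lift_ctx 1 G Map.empty)"
    moreover obtain j i where "i \<le> 1" "z = part 1 j i" by (rule part_cases)
    ultimately have z: "z = part 1 j 1" "j < ?n"
      using part_div_mod[of i 1 j] by (auto simp: lift_ctx_def G_def split: if_splits)
    then have "map_of ?ys z = Some KSet"
      by (auto simp: map_of_eq_Some_iff distinct_map inj_on_def part_eq_iff comp_def)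
    then show "lift_ctx 1 G Map.empty z = (Map.empty ++ map_of ?ys) z"
      using z lift_ctx_param[of 1 G Map.empty j] by (simp add: map_add_def G_def)
  qed
  ultimately have "definable V (Map.empty ++ map_of ?ys) ?P" by (rule definable_mono)
  then have "definable V Map.empty (\<lambda>A \<nu>. \<exists>f. (\<forall>(y, \<kappa>)\<in>set ?ys. has_kind (universe A) (f y) \<kappa>) \<and>
      ?P A (override_on \<nu> f (fst ` set ?ys)))"
    by (intro definable_ex_vars) (auto simp: distinct_map inj_on_def part_eq_iff comp_def)
  then show ?thesis
  proof (rule definable_cong)
    fix A \<nu> assume A: "A \<in> structures V"
    have fst_ys: "fst ` set ?ys = (\<lambda>j. part 1 j 1) ` {..<?n}" by force
    have Z: "?Z (override_on \<nu> f (fst ` set ?ys)) j = set_of (f (part 1 j 1))" if "j < ?n" for f j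
      using that unfolding fst_ys by (auto simp: override_on_def)
    show "(\<exists>f. (\<forall>(y, \<kappa>)\<in>set ?ys. has_kind (universe A) (f y) \<kappa>) \<and>
      ?P A (override_on \<nu> f (fst ` set ?ys))) \<longleftrightarrow> (\<exists>B. (A, B) \<in> colour_rel V qs \<and> B \<Turnstile> \<chi>)" (is "?L \<longleftrightarrow> ?R")
    proof
      assume ?L
      then obtain f where P: "?P A (override_on \<nu> f (fst ` set ?ys))" by blast
      let ?\<nu> = "override_on \<nu> f (fst ` set ?ys)"
      have "\<forall>a\<in>universe A. \<exists>j. j < ?n \<and> (\<forall>i<?n. a \<in> ?Z ?\<nu> i \<longleftrightarrow> i = j)"
      proof
        fix a assume "a \<in> universe A"
        with P obtain j where "j < ?n" "a \<in> ?Z ?\<nu> j" "\<forall>i\<in>{..<?n}. i \<noteq> j \<longrightarrow> a \<notin> ?Z ?\<nu> i" by blast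
        then show "\<exists>j. j < ?n \<and> (\<forall>i<?n. a \<in> ?Z ?\<nu> i \<longleftrightarrow> i = j)" by (intro exI[of _ j]) blast
      qed
      then obtain j where j: "\<And>a. a \<in> universe A \<Longrightarrow> j a < ?n \<and> (\<forall>i<?n. a \<in> ?Z ?\<nu> i \<longleftrightarrow> i = j a)"
        by metis
      have "?B A ?\<nu> = colour_struct qs (\<lambda>a. qs ! j a) A"
        by (rule colour_struct_eq) (use j qs in \<open>auto simp: nth_eq_iff_index_eq simp del: One_nat_def\<close>)
      moreover have "(A, colour_struct qs (\<lambda>a. qs ! j a) A) \<in> colour_rel V qs"
        unfolding colour_rel_def using A j iso_refl by (auto intro!: exI[of _ "\<lambda>a. qs ! j a"])
      ultimately show ?R using P by metis
    next
      assume ?R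
      then obtain B c where c: "c ` universe A \<subseteq> set qs" and iso: "colour_struct qs c A \<simeq> B" and B: "B \<Turnstile> \<chi>"
        by (auto simp: colour_rel_def)
      \<comment> \<open>The \<open>j\<close>-th colour class of \<open>c\<close>; the division
        recovers \<open>j\<close> from the parameter variable \<open>part 1 j 1\<close>.\<close>
      define f where "f = (\<lambda>y. SetArg {a \<in> universe A. c a = qs ! (y div Suc 1)})"
      let ?\<nu> = "override_on \<nu> f (fst ` set ?ys)"
      have Z': "?Z ?\<nu> j = {a \<in> universe A. c a = qs ! j}" if "j < ?n" for j
        using part_div_mod[of 1 1 j] unfolding Z[OF that] by (simp add: f_def)
      have "?B A ?\<nu> = colour_struct qs c A" by (rule colour_struct_eq, subst Z') auto
      then have "?B A ?\<nu> \<Turnstile> \<chi>"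
        using models_iso[OF colour_structures[OF A] iso \<chi>] B by simp
      moreover have "\<exists>j\<in>{..<?n}. a \<in> ?Z ?\<nu> j \<and> (\<forall>i\<in>{..<?n}. i \<noteq> j \<longrightarrow> a \<notin> ?Z ?\<nu> i)" if a: "a \<in> universe A" for a
      proof -
        obtain j where "j < ?n" "c a = qs ! j" using c a by (metis imageI in_set_conv_nth subsetD)
        then have "a \<in> ?Z ?\<nu> i \<longleftrightarrow> i = j" if "i < ?n" for i
          using that a qs unfolding Z'[OF that] by (auto simp: nth_eq_iff_index_eq)
        then show ?thesis using \<open>j < ?n\<close> by blast
      qed
      moreover have "\<forall>(y, \<kappa>)\<in>set ?ys. has_kind (universe A) (f y) \<kappa>" by (auto simp: f_def)
      ultimately show ?L by blast
    qed
  qed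
qed

lemma mso_transduction_structures:
  "mso_transduction V W f \<Longrightarrow> (A, B) \<in> f \<Longrightarrow> A \<in> structures V \<and> B \<in> structures W"
proof (induction arbitrary: A B rule: mso_transduction.induct)
  case (mso_copying k c V)
  then show ?case using copy_structures by (auto simp: copy_rel_def)
next
  case (mso_colouring qs V)
  then show ?case using iso_structures[OF colour_structures] by (auto simp: colour_rel_def)
next
  case (mso_composition V W f X g)
  then show ?case by blast
qed (auto simp: interpretation_rel_def filter_rel_def)

theorem mso_transduction_backwards:
  "mso_transduction V W f \<Longrightarrow> sentence W \<chi> \<Longrightarrow>
   definable V Map.empty (\<lambda>A \<nu>. \<exists>B. (A, B) \<in> f \<and> B \<Turnstile> \<chi>)"
proof (induction arbitrary: \<chi> rule: mso_transduction.induct)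
  case (mso_interpretation V \<phi> W \<psi>)
  then show ?case by (intro interpretation_backwards)
next
  case (mso_filtering V \<phi>)
  then show ?case by (intro filter_backwards)
next
  case (mso_copying k c V)
  then show ?case by (intro copy_backwards)
next
  case (mso_colouring qs V)
  then show ?case by (intro colour_backwards)
next
  case (mso_composition V W f X g)
  \<comment> \<open>A sentence saying that \<open>g\<close> has an output satisfying
    \<open>\<chi>\<close>; it is then pulled back through \<open>f\<close>.\<close>
  obtain \<chi>' where \<chi>': "sentence W \<chi>'" "\<And>A. A \<in> structures W \<Longrightarrow> A \<Turnstile> \<chi>' \<longleftrightarrow> (\<exists>B. (A, B) \<in> g \<and> B \<Turnstile> \<chi>)"
    by (rule definable_sentence[OF mso_composition.IH(2)[OF mso_composition.prems]]) blast
  show ?case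
    by (rule definable_cong[OF mso_composition.IH(1)[OF \<chi>'(1)]])
      (use \<chi>'(2) mso_transduction_structures[OF mso_composition.hyps(1)] in blast)
qed

section \<open>Isomorphism types: definability and bounded width\<close>

lemma tuples_surj:
  assumes "h ` U = U'" "bs \<in> tuples U' \<tau>"
  obtains as where "as \<in> tuples U \<tau>" "bs = map (map_arg h) as"
proof
  let ?g = "inv_into U h"
  show "map (map_arg ?g) bs \<in> tuples U \<tau>"
    by (rule tuples_map_arg[OF assms(2)]) (use assms(1) in \<open>auto intro: inv_into_into\<close>)
  have "map (map_arg (h \<circ> ?g)) bs = bs"
    by (rule tuples_map_arg_id[OF assms(2)]) (use assms(1) in \<open>auto simp: f_inv_into_f\<close>)
  then show "bs = map (map_arg h) (map (map_arg ?g) bs)" by (simp only: map_map_arg_comp)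
qed

fun kind_of :: "arg \<Rightarrow> arg_kind" where
  "kind_of (Elem a) = KElem"
| "kind_of (SetArg S) = KSet"

lemma has_kind_kind_of: "has_kind U a \<kappa> \<Longrightarrow> kind_of a = \<kappa>"
  by (cases a; cases \<kappa>) auto

definition all_args :: "nat set \<Rightarrow> arg set" where
  "all_args U = Elem ` U \<union> SetArg ` Pow U"

lemma has_kind_all_args: "has_kind U a \<kappa> \<Longrightarrow> a \<in> all_args U"
  by (cases a; cases \<kappa>) (auto simp: all_args_def)

lemma tuples_all_args: "as \<in> tuples U \<tau> \<Longrightarrow> set as \<subseteq> all_args U \<and> length as = length \<tau> \<and> map kind_of as = \<tau>"
  unfolding tuples_def
  by (auto simp: list_all2_conv_all_nth in_set_conv_nth list_eq_iff_nth_eq has_kind_kind_of)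
    (metis has_kind_all_args)

lemma finite_all_args: "finite U \<Longrightarrow> finite (all_args U)"
  by (simp add: all_args_def)

lemma finite_tuples: "finite U \<Longrightarrow> finite (tuples U \<tau>)"
  by (rule finite_subset[OF _ finite_lists_length_eq[OF finite_all_args, of U "length \<tau>"]])
    (auto dest: tuples_all_args)

text \<open>The isomorphism type of a finite structure is described by its diagram, with one variable for
  each element and each subset of the universe.\<close>

lemma definable_isomorphic:
  assumes A: "A \<in> structures V"
  shows "definable V Map.empty (\<lambda>B \<nu>. A \<simeq> B)"
proof -
  let ?U = "universe A" and ?X = "all_args (universe A)"
  have fin: "finite ?U" using structuresD(1)[OF A] .
  have finX: "finite ?X" by (rule finite_all_args[OF fin])
  \<comment> \<open>Numbers the elements and subsets of the universe of \<open>A\<close>; these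
    numbers are the variables of the diagram.\<close>
  obtain v :: "arg \<Rightarrow> nat" where v: "inj_on v ?X" using finite_imp_inj_to_nat_seg[OF finX] by blast
  obtain L where L: "set L = ?X" "distinct L" using finite_distinct_list[OF finX] by blast
  let ?ys = "map (\<lambda>a. (v a, kind_of a)) L"
  have dist: "distinct (map fst ?ys)" using L v by (simp add: distinct_map comp_def)
  have \<Gamma>: "(Map.empty ++ map_of ?ys) (v a) = Some (kind_of a)" if "a \<in> ?X" for a
    using that L(1) map_of_is_SomeI[OF dist, of "v a" "kind_of a"] by auto
  have \<Gamma>e: "(Map.empty ++ map_of ?ys) (v (Elem a)) = Some KElem" if "a \<in> ?U" for a
    using \<Gamma>[of "Elem a"] that by (simp add: all_args_def)
  have \<Gamma>s: "(Map.empty ++ map_of ?ys) (v (SetArg S)) = Some KSet" if "S \<subseteq> ?U" for S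
    using \<Gamma>[of "SetArg S"] that by (simp add: all_args_def)
  \<comment> \<open>The element variables name every element of \<open>B\<close> exactly once
    (\<open>?P1\<close>, \<open>?P2\<close>), the set variable of \<open>S\<close> denotes the set
    of values named by the elements of \<open>S\<close> (\<open>?P3\<close>), and the finite
    relation tables agree (\<open>?P4\<close>).\<close>
  let ?P1 = "\<lambda>B \<nu>. \<forall>a\<in>?U. \<forall>b\<in>?U. a \<noteq> b \<longrightarrow> elem_of (\<nu> (v (Elem a))) \<noteq> elem_of (\<nu> (v (Elem b)))"
  let ?P2 = "\<lambda>B \<nu>. \<forall>b\<in>universe B. \<exists>a\<in>?U. b = elem_of (\<nu> (v (Elem a)))"
  let ?P3 = "\<lambda>B \<nu>. \<forall>S\<in>Pow ?U. \<forall>a\<in>?U. elem_of (\<nu> (v (Elem a))) \<in> set_of (\<nu> (v (SetArg S))) \<longleftrightarrow> a \<in> S"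
  let ?P4 = "\<lambda>B \<nu>. \<forall>R\<in>fmdom' V. \<forall>as\<in>tuples ?U (the (fmlookup V R)). map \<nu> (map v as) \<in> rel B R \<longleftrightarrow> as \<in> rel A R"
  have P1: "definable V (Map.empty ++ map_of ?ys) ?P1"
    by (intro definable_Ball fin definable_imp definable_const definable_neg definable_elem_eq \<Gamma>e)
  \<comment> \<open>A name outside the diagram for the universally quantified element of
    \<open>?P2\<close>.\<close>
  obtain z where z: "z \<notin> v ` ?X" using finX by (meson ex_new_if_finite finite_imageI infinite_UNIV_nat)
  have zE: "z \<noteq> v (Elem a)" if "a \<in> ?U" for a using z that by (auto simp: all_args_def)
  have "definable V (Map.empty ++ map_of ?ys) (\<lambda>B \<nu>. \<forall>b\<in>universe B. \<exists>a\<in>?U.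
     elem_of ((\<nu>(z := Elem b)) z) = elem_of ((\<nu>(z := Elem b)) (v (Elem a))))"
    by (rule definable_all_elem, intro definable_Bex fin definable_elem_eq)
      (use zE \<Gamma>e in \<open>auto simp del: map_add_Some_iff\<close>)
  then have P2: "definable V (Map.empty ++ map_of ?ys) ?P2"
    by (rule definable_cong) (use zE in auto)
  have P3: "definable V (Map.empty ++ map_of ?ys) ?P3"
    using fin by (intro definable_Ball definable_iff definable_const definable_mem \<Gamma>e \<Gamma>s) auto
  have P4: "definable V (Map.empty ++ map_of ?ys) ?P4"
  proof (intro definable_Ball finite_tuples fin definable_iff definable_const)
    show "finite (fmdom' V)" by simp
    fix R as assume "R \<in> fmdom' V" and as: "as \<in> tuples ?U (the (fmlookup V R))"
    then have R: "fmlookup V R = Some (the (fmlookup V R))" by (auto simp: fmlookup_dom'_iff)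
    have "map (Map.empty ++ map_of ?ys) (map v as) = map Some (map kind_of as)"
      unfolding map_map
    proof (rule map_cong[OF refl])
      fix a assume "a \<in> set as"
      then have "a \<in> ?X" using tuples_all_args[OF as] by blast
      then show "((Map.empty ++ map_of ?ys) \<circ> v) a = (Some \<circ> kind_of) a" using \<Gamma> by simp
    qed
    then show "definable V (Map.empty ++ map_of ?ys) (\<lambda>B \<nu>. map \<nu> (map v as) \<in> rel B R)"
      using tuples_all_args[OF as] by (intro definable_atom[OF R]) simp
  qed
  let ?P = "\<lambda>B \<nu>. (?P1 B \<nu> \<and> ?P2 B \<nu>) \<and> (?P3 B \<nu> \<and> ?P4 B \<nu>)"
  have "definable V Map.empty (\<lambda>B \<nu>. \<exists>f. (\<forall>(y, \<kappa>)\<in>set ?ys. has_kind (universe B) (f y) \<kappa>) \<and>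
      ?P B (override_on \<nu> f (fst ` set ?ys)))"
    by (rule definable_ex_vars[OF dist definable_conj[OF definable_conj[OF P1 P2] definable_conj[OF P3 P4]]])
  then show ?thesis
  proof (rule definable_cong)
    fix B and \<nu> :: "nat \<Rightarrow> arg"
    assume B: "B \<in> structures V"
    have ov: "override_on \<nu> f (fst ` set ?ys) (v a) = f (v a)" if "a \<in> ?X" for f a
      using that L(1) by (auto simp: override_on_def image_image)
    show "(\<exists>f. (\<forall>(y, \<kappa>)\<in>set ?ys. has_kind (universe B) (f y) \<kappa>) \<and> ?P B (override_on \<nu> f (fst ` set ?ys))) \<longleftrightarrow> A \<simeq> B"
      (is "?L \<longleftrightarrow> ?R")
    proof
      assume ?R
      then obtain h where bij: "bij_betw h ?U (universe B)"
        and rel: "\<And>R. rel B R = map (map_arg h) ` rel A R" unfolding isomorphic_def by auto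
      have inj: "inj_on h ?U" and im: "h ` ?U = universe B" using bij by (auto simp: bij_betw_def)
      define f where "f = (\<lambda>y. map_arg h (inv_into ?X v y))"
      have f: "f (v a) = map_arg h a" if "a \<in> ?X" for a using that v by (simp add: f_def)
      let ?\<nu> = "override_on \<nu> f (fst ` set ?ys)"
      have \<nu>: "?\<nu> (v a) = map_arg h a" if "a \<in> ?X" for a using ov[OF that] f[OF that] by simp
      have \<nu>e: "?\<nu> (v (Elem a)) = Elem (h a)" if "a \<in> ?U" for a using \<nu>[of "Elem a"] that by (simp add: all_args_def)
      have \<nu>s: "?\<nu> (v (SetArg S)) = SetArg (h ` S)" if "S \<subseteq> ?U" for S
        using \<nu>[of "SetArg S"] that by (simp add: all_args_def)
      have "has_kind (universe B) (f (v a)) (kind_of a)" if "a \<in> ?X" for a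
        using f[OF that] that im[symmetric] by (auto simp: all_args_def intro!: imageI)
      then have "\<forall>(y, \<kappa>)\<in>set ?ys. has_kind (universe B) (f y) \<kappa>" using L(1) by auto
      moreover have "?P1 B ?\<nu>" using \<nu>e inj by (auto dest: inj_onD)
      moreover have "?P2 B ?\<nu>" using \<nu>e im by auto
      moreover have "?P3 B ?\<nu>" using \<nu>e \<nu>s by (simp add: inj_on_image_mem_iff[OF inj])
      moreover have "?P4 B ?\<nu>"
      proof (intro ballI)
        fix R as assume "R \<in> fmdom' V" and as: "as \<in> tuples ?U (the (fmlookup V R))"
        then have R: "fmlookup V R = Some (the (fmlookup V R))" by (auto simp: fmlookup_dom'_iff)
        have eq: "map ?\<nu> (map v as) = map (map_arg h) as" using tuples_all_args[OF as] \<nu> by auto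
        show "map ?\<nu> (map v as) \<in> rel B R \<longleftrightarrow> as \<in> rel A R"
        proof
          assume "map ?\<nu> (map v as) \<in> rel B R"
          then obtain as' where as': "as' \<in> rel A R" "map (map_arg h) as = map (map_arg h) as'"
            unfolding eq rel by auto
          moreover have "as' \<in> tuples ?U (the (fmlookup V R))" using structuresD(4)[OF A R] as'(1) by auto
          ultimately show "as \<in> rel A R" using tuples_map_arg_inj[OF inj as] by metis
        next
          assume "as \<in> rel A R"
          then show "map ?\<nu> (map v as) \<in> rel B R" unfolding eq rel by (rule imageI)
        qed
      qed
      ultimately show ?L by (intro exI[of _ f] conjI)
    next
      assume ?L
      then obtain f where f: "(\<forall>(y, \<kappa>)\<in>set ?ys. has_kind (universe B) (f y) \<kappa>) \<and>
        ?P B (override_on \<nu> f (fst ` set ?ys))" by (elim exE) (rule that)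
      let ?\<nu> = "override_on \<nu> f (fst ` set ?ys)"
      note kinds = f[THEN conjunct1]
        and P1 = f[THEN conjunct2, THEN conjunct1, THEN conjunct1]
        and P2 = f[THEN conjunct2, THEN conjunct1, THEN conjunct2]
        and P3 = f[THEN conjunct2, THEN conjunct2, THEN conjunct1]
        and P4 = f[THEN conjunct2, THEN conjunct2, THEN conjunct2]
      have k: "has_kind (universe B) (?\<nu> (v a)) (kind_of a)" if "a \<in> ?X" for a
        using ov[OF that] kinds L(1) that by auto
      define h where "h = (\<lambda>a. elem_of (?\<nu> (v (Elem a))))"
      have he: "?\<nu> (v (Elem a)) = Elem (h a) \<and> h a \<in> universe B" if "a \<in> ?U" for a
        using k[of "Elem a"] that by (auto simp: h_def all_args_def has_kind_KElem)
      have inj: "inj_on h ?U" unfolding inj_on_def h_def using P1 by metis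
      have im: "h ` ?U = universe B" unfolding h_def using P2 he[unfolded h_def] by auto
      have hs: "?\<nu> (v (SetArg S)) = SetArg (h ` S)" if S: "S \<subseteq> ?U" for S
      proof -
        obtain T where T: "T \<subseteq> universe B" "?\<nu> (v (SetArg S)) = SetArg T"
          using k[of "SetArg S"] S by (auto simp: all_args_def has_kind_KSet)
        have "h a \<in> T \<longleftrightarrow> a \<in> S" if "a \<in> ?U" for a
        proof -
          have "elem_of (?\<nu> (v (Elem a))) \<in> set_of (?\<nu> (v (SetArg S))) \<longleftrightarrow> a \<in> S" using P3[rule_format, of S a] S that by simp
          then show ?thesis using T(2) by (simp add: h_def)
        qed
        then have "T = h ` S" using T(1) S im[symmetric] by auto
        then show ?thesis using T(2) by simp
      qed
      have \<nu>: "?\<nu> (v a) = map_arg h a" if "a \<in> ?X" for a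
        using that he hs by (auto simp: all_args_def)
      have "rel B R = map (map_arg h) ` rel A R" for R
      proof (cases "fmlookup V R")
        case None
        then show ?thesis using structuresD(3)[OF A] structuresD(3)[OF B] by simp
      next
        case (Some \<tau>)
        have *: "map (map_arg h) as \<in> rel B R \<longleftrightarrow> as \<in> rel A R" if as: "as \<in> tuples ?U \<tau>" for as
        proof -
          have "map ?\<nu> (map v as) = map (map_arg h) as" using tuples_all_args[OF as] \<nu> by auto
          moreover have "R \<in> fmdom' V" "the (fmlookup V R) = \<tau>" using Some by (auto simp: fmlookup_dom'_iff)
          ultimately show ?thesis using P4 as by metis
        qed
        show ?thesis
        proof
          show "map (map_arg h) ` rel A R \<subseteq> rel B R" using * structuresD(4)[OF A Some] by blast
          show "rel B R \<subseteq> map (map_arg h) ` rel A R"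
          proof
            fix bs assume bs: "bs \<in> rel B R"
            then obtain as where "as \<in> tuples ?U \<tau>" "bs = map (map_arg h) as"
              using tuples_surj[OF im] structuresD(4)[OF B Some] by blast
            then show "bs \<in> map (map_arg h) ` rel A R" using * bs by blast
          qed
        qed
      qed
      then show ?R using inj im unfolding isomorphic_def bij_betw_def by blast
    qed
  qed
qed

text \<open>Builds an interpretation from definable predicates and hides the chosen formulas. Only
  the pairs with a literally described output are promised; isomorphic outputs follow from
  \<open>mso_transduction_iso\<close>.\<close>

lemma mso_interpretation_definable:
  assumes U: "definable V (typed [KElem]) (\<lambda>A \<nu>. PU A (\<nu> 0))"
    and rels: "\<And>R \<tau>. fmlookup W R = Some \<tau> \<Longrightarrow>
      definable V (typed \<tau>) (\<lambda>A \<nu>. PR R A (map \<nu> [0..<length \<tau>]))"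
  obtains f where "mso_transduction V W f"
    "\<And>A B. A \<in> structures V \<Longrightarrow> B \<in> structures W \<Longrightarrow> universe B = {a \<in> universe A. PU A (Elem a)} \<Longrightarrow>
      (\<And>R \<tau>. fmlookup W R = Some \<tau> \<Longrightarrow> rel B R = {as \<in> tuples (universe B) \<tau>. PR R A as}) \<Longrightarrow> (A, B) \<in> f"
proof -
  obtain \<phi> where \<phi>: "wf_formula V (typed [KElem]) \<phi>"
    "\<And>A \<nu>. A \<in> structures V \<Longrightarrow> fits A (typed [KElem]) \<nu> \<Longrightarrow> sat A \<nu> \<phi> \<longleftrightarrow> PU A (\<nu> 0)"
    by (rule definableE[OF U], rule that)
  have "\<forall>R. \<exists>\<psi>. \<forall>\<tau>. fmlookup W R = Some \<tau> \<longrightarrow> wf_formula V (typed \<tau>) \<psi> \<and>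
    (\<forall>A\<in>structures V. \<forall>\<nu>. fits A (typed \<tau>) \<nu> \<longrightarrow> sat A \<nu> \<psi> = PR R A (map \<nu> [0..<length \<tau>]))"
    using rels unfolding definable_def by (metis option.inject)
  then obtain \<psi> where \<psi>: "\<And>R \<tau>. fmlookup W R = Some \<tau> \<Longrightarrow> wf_formula V (typed \<tau>) (\<psi> R)"
    "\<And>R \<tau> A \<nu>. fmlookup W R = Some \<tau> \<Longrightarrow> A \<in> structures V \<Longrightarrow> fits A (typed \<tau>) \<nu> \<Longrightarrow>
       sat A \<nu> (\<psi> R) = PR R A (map \<nu> [0..<length \<tau>])" by metis
  show thesis
  proof (rule that[of "interpretation_rel V W \<phi> \<psi>"])
    show "mso_transduction V W (interpretation_rel V W \<phi> \<psi>)"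
      using \<phi>(1) \<psi>(1) by (intro mso_transduction.mso_interpretation) (auto simp: formula_of_type_typed)
    fix A B assume A: "A \<in> structures V" and B: "B \<in> structures W"
      and UB: "universe B = {a \<in> universe A. PU A (Elem a)}"
      and RB: "\<And>R \<tau>. fmlookup W R = Some \<tau> \<Longrightarrow> rel B R = {as \<in> tuples (universe B) \<tau>. PR R A as}"
    have 1: "holds A \<phi> [Elem a] \<longleftrightarrow> PU A (Elem a)" if "a \<in> universe A" for a
      using that \<phi>(2)[OF A, of "\<lambda>i. [Elem a] ! i"] by (simp add: holds_def fits_def typed_Some)
    have 2: "holds A (\<psi> R) as \<longleftrightarrow> PR R A as" if "fmlookup W R = Some \<tau>" "as \<in> tuples (universe B) \<tau>" for R \<tau> as
    proof -
      have as: "as \<in> tuples (universe A) \<tau>" using tuples_map_arg[OF that(2), of id "universe A"] UB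
        tuples_map_arg_id[OF that(2), of id] by auto
      have "fits A (typed \<tau>) ((!) as)" using as by (auto simp: fits_def typed_Some tuples_def list_all2_conv_all_nth)
      moreover have "map ((!) as) [0..<length \<tau>] = as" using tuples_all_args[OF as] map_nth by metis
      ultimately show ?thesis using \<psi>(2)[OF that(1) A] by (simp add: holds_def)
    qed
    have "{a \<in> universe A. holds A \<phi> [Elem a]} = universe B" using 1 UB by auto
    moreover have "(case fmlookup W R of None \<Rightarrow> {} | Some \<tau> \<Rightarrow> {as \<in> tuples (universe B) \<tau>. holds A (\<psi> R) as}) = rel B R" for R
      using 2 RB structuresD(3)[OF B, of R] by (auto split: option.splits)
    ultimately have "interpret_struct W \<phi> \<psi> A = B" by (simp add: interpret_struct_def Let_def)
    then show "(A, B) \<in> interpretation_rel V W \<phi> \<psi>" using A B iso_refl by (simp add: interpretation_rel_def)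
  qed
qed

text \<open>The shape of the tree is immaterial: what matters is that some tree lives on a
  prescribed universe.\<close>

lemma star_tree:
  assumes "finite U" "r \<in> U"
  defines "T \<equiv> \<lparr>universe = U, rel = (\<lambda>R. if R = ''parent'' then {[Elem x, Elem r] | x. x \<in> U - {r}} else {})\<rparr>"
  shows "T \<in> trees"
proof -
  have lk: "fmlookup tree_vocab R = (if R = ''parent'' then Some [KElem, KElem] else None)" for R
    by (simp add: tree_vocab_def fmlookup_of_list)
  have Ts: "T \<in> structures tree_vocab"
    by (rule structuresI) (use assms(1,2) in \<open>auto simp: T_def lk tuples_def split: if_splits\<close>)
  have p: "parent_pairs T = (U - {r}) \<times> {r}" by (auto simp: parent_pairs_def T_def)
  have "(\<forall>y. (r, y) \<notin> parent_pairs T) \<and> (\<forall>x\<in>U - {r}. \<exists>!y. (x, y) \<in> parent_pairs T) \<and>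
     (\<forall>x\<in>U. (x, r) \<in> (parent_pairs T)\<^sup>*)"
    unfolding p by auto
  moreover have "universe T = U" by (simp add: T_def)
  ultimately show ?thesis using Ts assms(2) unfolding trees_def by auto
qed

text \<open>Place a star on the universe of \<open>A\<close> and give every node a colour of its
  own. Elements and subsets are then definable, and an interpretation can reproduce the finite
  tables of \<open>A\<close>.\<close>

lemma bounded_width_singleton:
  assumes A: "A \<in> structures V"
  shows "bounded_mso_width V {A}"
proof -
  let ?U = "universe A"
  obtain r where r: "r \<in> ?U" using structuresD(2)[OF A] by auto
  have fin: "finite ?U" using structuresD(1)[OF A] .
  define T where "T = \<lparr>universe = ?U, rel = (\<lambda>R. if R = ''parent'' then {[Elem x, Elem r] | x. x \<in> ?U - {r}} else {})\<rparr>"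
  have T: "T \<in> trees" unfolding T_def by (rule star_tree[OF fin r])
  then have Ts: "T \<in> structures tree_vocab" by (simp add: trees_def)
  \<comment> \<open>Words over a single letter: distinct for distinct elements, and never equal to
    \<open>''parent''\<close>.\<close>
  define col :: "nat \<Rightarrow> rel_name" where "col = (\<lambda>a. replicate a (CHR ''c''))"
  have col_inj: "col a = col b \<longleftrightarrow> a = b" for a b
    unfolding col_def by (metis length_replicate)
  have "''parent'' \<noteq> col a" for a
  proof
    assume "''parent'' = col a"
    then have "CHR ''p'' \<in> set (col a)" by (metis list.set_intros(1))
    then have "CHR ''p'' = CHR ''c''" unfolding col_def by (rule in_set_replicate[THEN iffD1, THEN conjunct1])
    then show False by simp
  qed
  then have fresh: "col ` ?U \<inter> fmdom' tree_vocab = {}" by (auto simp: tree_vocab_def)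
  define qs where "qs = map col (sorted_list_of_set ?U)"
  have qs: "set qs = col ` ?U" "distinct qs" "1 \<le> length qs"
    using fin r col_inj by (auto simp: qs_def distinct_map inj_on_def Suc_le_eq card_gt_0_iff)
  let ?W = "colour_vocab tree_vocab qs"
  let ?D = "colour_struct qs col T"
  have TD: "(T, ?D) \<in> colour_rel tree_vocab qs"
    unfolding colour_rel_def using Ts iso_refl qs(1) by (auto simp: T_def intro!: exI[of _ col])
  have D: "?D \<in> structures ?W" by (rule colour_structures[OF Ts])
  have UD: "universe ?D = ?U" by (simp add: colour_struct_def T_def)
  have RD: "rel ?D (col a) = {[Elem a]}" if "a \<in> ?U" for a
    using that qs(1) col_inj by (auto simp: colour_struct_def T_def)
  \<comment> \<open>The value \<open>v\<close> is recognised as the argument \<open>a\<close> of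
    \<open>A\<close> through the colours alone.\<close>
  define match where "match = (\<lambda>(B :: struct) a v. case a of
       Elem a \<Rightarrow> [v] \<in> rel B (col a)
     | SetArg S \<Rightarrow> (\<forall>b\<in>universe B. b \<in> set_of v \<longleftrightarrow> (\<exists>a\<in>S. [Elem b] \<in> rel B (col a))))"
  have lk: "fmlookup ?W (col a) = Some [KElem]" if "a \<in> ?U" for a
    using that qs(1) unfolding fmlookup_colour_vocab by simp
  have def_match: "definable ?W \<Gamma> (\<lambda>B \<nu>. match B a (\<nu> x))"
    if a: "has_kind ?U a \<kappa>" and x: "\<Gamma> x = Some \<kappa>" for \<Gamma> a x \<kappa>
  proof (cases a)
    case (Elem b)
    then have "b \<in> ?U" "\<Gamma> x = Some KElem" using a x by (cases \<kappa>; simp)+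
    then show ?thesis using definable_atom[OF lk, of b \<Gamma> "[x]"] Elem by (simp add: match_def)
  next
    case (SetArg S)
    then have S: "S \<subseteq> ?U" and x: "\<Gamma> x = Some KSet" using a x by (cases \<kappa>; simp)+
    let ?z = "Suc x"
    have "definable ?W \<Gamma> (\<lambda>B \<nu>. \<forall>b\<in>universe B. elem_of ((\<nu>(?z := Elem b)) ?z) \<in> set_of ((\<nu>(?z := Elem b)) x) \<longleftrightarrow>
       (\<exists>a\<in>S. map (\<nu>(?z := Elem b)) [?z] \<in> rel B (col a)))"
      by (rule definable_all_elem, intro definable_iff definable_mem definable_Bex definable_atom[OF lk])
        (use S x fin finite_subset in auto)
    then show ?thesis using SetArg by (simp add: match_def)
  qed
  have match_eq: "match ?D a v \<longleftrightarrow> a = v" if kinds: "has_kind ?U a \<kappa>" "has_kind ?U v \<kappa>" for a v \<kappa>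
  proof (cases \<kappa>)
    case KElem
    then show ?thesis using kinds RD by (auto simp: has_kind_KElem match_def)
  next
    case KSet
    then obtain S S' where S: "a = SetArg S" "v = SetArg S'" "S \<subseteq> ?U" "S' \<subseteq> ?U"
      using kinds by (auto simp: has_kind_KSet)
    have "(\<exists>a\<in>S. [Elem b] \<in> rel ?D (col a)) \<longleftrightarrow> b \<in> S" for b using S(3) RD by auto
    then show ?thesis using S UD by (auto simp: match_def)
  qed
  \<comment> \<open>Table lookup: a finite disjunction over the tuples of \<open>A\<close>.\<close>
  let ?PR = "\<lambda>R B bs. \<exists>as\<in>rel A R. \<forall>j\<in>{..<length as}. match B (as ! j) (bs ! j)"
  obtain f where f: "mso_transduction ?W V f"
    and f': "\<And>B B'. B \<in> structures ?W \<Longrightarrow> B' \<in> structures V \<Longrightarrow> universe B' = {a \<in> universe B. True} \<Longrightarrow>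
      (\<And>R \<tau>. fmlookup V R = Some \<tau> \<Longrightarrow> rel B' R = {as \<in> tuples (universe B') \<tau>. ?PR R B as}) \<Longrightarrow> (B, B') \<in> f"
  proof (rule mso_interpretation_definable[of ?W "\<lambda>_ _. True" V ?PR])
    show "definable ?W (typed [KElem]) (\<lambda>A \<nu>. True)" by (rule definable_true)
    fix R \<tau> assume R: "fmlookup V R = Some \<tau>"
    have finR: "finite (rel A R)" using structuresD(4)[OF A R] finite_tuples[OF fin] finite_subset by blast
    have kinds: "length as = length \<tau> \<and> (\<forall>j<length \<tau>. has_kind ?U (as ! j) (\<tau> ! j))" if "as \<in> rel A R" for as
      using structuresD(4)[OF A R] that by (auto simp: tuples_def list_all2_conv_all_nth)
    have "definable ?W (typed \<tau>) (\<lambda>B \<nu>. \<exists>as\<in>rel A R. \<forall>j\<in>{..<length as}. match B (as ! j) (\<nu> j))"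
      using kinds by (intro definable_Bex finR definable_Ball finite_lessThan def_match) (auto simp: typed_Some)
    then show "definable ?W (typed \<tau>) (\<lambda>B \<nu>. ?PR R B (map \<nu> [0..<length \<tau>]))"
      by (rule definable_cong) (use kinds in auto)
  qed blast
  have "(?D, A) \<in> f"
  proof (rule f'[OF D A])
    show "universe A = {a \<in> universe ?D. True}" using UD by simp
    fix R \<tau> assume R: "fmlookup V R = Some \<tau>"
    have "?PR R ?D bs \<longleftrightarrow> bs \<in> rel A R" if bs: "bs \<in> tuples ?U \<tau>" for bs
    proof -
      have "(\<forall>j\<in>{..<length as}. match ?D (as ! j) (bs ! j)) \<longleftrightarrow> as = bs" if "as \<in> rel A R" for as
      proof -
        have "as \<in> tuples ?U \<tau>" using structuresD(4)[OF A R] that by auto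
        then have "length as = length bs \<and> (\<forall>j<length as. match ?D (as ! j) (bs ! j) \<longleftrightarrow> as ! j = bs ! j)"
          using bs match_eq by (auto simp: tuples_def list_all2_conv_all_nth)
        then show ?thesis by (auto simp: list_eq_iff_nth_eq)
      qed
      then show ?thesis by auto
    qed
    then show "rel A R = {as \<in> tuples ?U \<tau>. ?PR R ?D as}" using structuresD(4)[OF A R] by auto
  qed
  then have "(T, A) \<in> colour_rel tree_vocab qs O f" using TD by auto
  moreover have "mso_transduction tree_vocab V (colour_rel tree_vocab qs O f)"
    by (rule mso_transduction.mso_composition[OF mso_transduction.mso_colouring f])
      (use qs fresh in auto)
  ultimately show ?thesis using T unfolding bounded_mso_width_def by blast
qed

text \<open>Each basic relation is closed under isomorphism of the output; for copying, the
  isomorphism is composed with the embeddings of the copies. This extends a cover of one structure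
  to its isomorphism class.\<close>

lemma mso_transduction_iso:
  "mso_transduction V W f \<Longrightarrow> (A, B) \<in> f \<Longrightarrow> B \<simeq> B' \<Longrightarrow> (A, B') \<in> f"
proof (induction arbitrary: A B B' rule: mso_transduction.induct)
  case (mso_interpretation V \<phi> W \<psi>)
  then show ?case using iso_structures iso_trans unfolding interpretation_rel_def by blast
next
  case (mso_filtering V \<phi>)
  then show ?case using iso_structures iso_trans unfolding filter_rel_def by blast
next
  case (mso_copying k c V)
  then obtain h where A: "A \<in> structures V" and inj: "inj_on (\<lambda>(i, a). h i a) ({..<k} \<times> universe A)"
    and U: "universe B = (\<Union>i<k. h i ` universe A)"
    and rel: "\<And>R. rel B R =
           (if R = c then (\<lambda>a. map (\<lambda>i. Elem (h i a)) [0..<k]) ` universe A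
            else (\<Union>i<k. map (map_arg (h i)) ` rel A R))"
    unfolding copy_rel_def by blast
  obtain g where g: "bij_betw g (universe B) (universe B')"
    "\<And>R. rel B' R = map (map_arg g) ` rel B R" using mso_copying.prems(2) unfolding isomorphic_def by blast
  have "inj_on g (\<Union>i<k. h i ` universe A)" "universe B' = g ` (\<Union>i<k. h i ` universe A)"
    using g(1) U by (auto simp: bij_betw_def)
  moreover have "(\<lambda>(i, a). h i a) ` ({..<k} \<times> universe A) = (\<Union>i<k. h i ` universe A)" by auto
  ultimately have "inj_on (g \<circ> (\<lambda>(i, a). h i a)) ({..<k} \<times> universe A)"
    using comp_inj_on[OF inj] by simp
  then have 1: "inj_on (\<lambda>(i, a). g (h i a)) ({..<k} \<times> universe A)"
    by (simp add: comp_def case_prod_beta')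
  have 2: "universe B' = (\<Union>i<k. (\<lambda>a. g (h i a)) ` universe A)"
    unfolding \<open>universe B' = _\<close> image_UN image_image ..
  have 3: "rel B' R = (if R = c then (\<lambda>a. map (\<lambda>i. Elem (g (h i a))) [0..<k]) ` universe A
            else (\<Union>i<k. map (map_arg (\<lambda>a. g (h i a))) ` rel A R))" for R
    unfolding g(2) rel by (simp add: image_UN image_image map_arg_comp comp_def)
  show ?case unfolding copy_rel_def using A 1 2 3 by (auto intro!: exI[of _ "\<lambda>i a. g (h i a)"])
next
  case (mso_colouring qs V)
  then show ?case using iso_trans unfolding colour_rel_def by blast
next
  case (mso_composition V W f X g)
  then show ?case by blast
qed

subsection \<open>Unions of classes of bounded width\<close>

text \<open>A disjoint sum of vocabularies: structures over \<open>V\<close> and over \<open>X\<close> both embed into the structures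
  over \<open>sum_vocab V X\<close>, and the nullary relation with the empty name tells the two
  embeddings apart.\<close>

abbreviation left_name :: "rel_name \<Rightarrow> rel_name" where "left_name \<equiv> Cons (CHR ''l'')"
abbreviation right_name :: "rel_name \<Rightarrow> rel_name" where "right_name \<equiv> Cons (CHR ''r'')"

definition sum_vocab :: "vocabulary \<Rightarrow> vocabulary \<Rightarrow> vocabulary" where
  "sum_vocab V X = Abs_fmap (\<lambda>n. case n of
       [] \<Rightarrow> Some []
     | ch # R \<Rightarrow> if ch = CHR ''l'' then fmlookup V R else if ch = CHR ''r'' then fmlookup X R else None)"

lemma fmlookup_sum_vocab:
  "fmlookup (sum_vocab V X) n = (case n of
       [] \<Rightarrow> Some []
     | ch # R \<Rightarrow> if ch = CHR ''l'' then fmlookup V R else if ch = CHR ''r'' then fmlookup X R else None)"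
    (is "_ = ?m n")
proof -
  have "dom ?m \<subseteq> {[]} \<union> left_name ` dom (fmlookup V) \<union> right_name ` dom (fmlookup X)"
    by (auto simp: image_iff split: list.splits if_splits) (metis fmlookup_dom'_iff)+
  then have "finite (dom ?m)" by (rule finite_subset) simp
  then show ?thesis unfolding sum_vocab_def by (subst Abs_fmap_inverse) auto
qed

lemma fmlookup_sum_vocab_simps [simp]:
  "fmlookup (sum_vocab V X) [] = Some []"
  "fmlookup (sum_vocab V X) (left_name R) = fmlookup V R"
  "fmlookup (sum_vocab V X) (right_name R) = fmlookup X R"
  by (simp_all add: fmlookup_sum_vocab)

definition inl_struct :: "struct \<Rightarrow> struct" where
  "inl_struct A = \<lparr>universe = universe A,
     rel = (\<lambda>n. case n of [] \<Rightarrow> {[]} | ch # R \<Rightarrow> if ch = CHR ''l'' then rel A R else {})\<rparr>"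

definition inr_struct :: "struct \<Rightarrow> struct" where
  "inr_struct A = \<lparr>universe = universe A,
     rel = (\<lambda>n. case n of [] \<Rightarrow> {} | ch # R \<Rightarrow> if ch = CHR ''r'' then rel A R else {})\<rparr>"

lemma inl_simps [simp]:
  "universe (inl_struct A) = universe A" "rel (inl_struct A) [] = {[]}"
  "rel (inl_struct A) (left_name R) = rel A R" "rel (inl_struct A) (right_name R) = {}"
  by (simp_all add: inl_struct_def)

lemma inr_simps [simp]:
  "universe (inr_struct A) = universe A" "rel (inr_struct A) [] = {}"
  "rel (inr_struct A) (left_name R) = {}" "rel (inr_struct A) (right_name R) = rel A R"
  by (simp_all add: inr_struct_def)

lemma inl_structures:
  assumes "A \<in> structures V" shows "inl_struct A \<in> structures (sum_vocab V X)"
proof (rule structuresI)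
  fix n
  show "rel (inl_struct A) n = {}" if "fmlookup (sum_vocab V X) n = None"
    using that structuresD(3)[OF assms] by (auto simp: fmlookup_sum_vocab inl_struct_def split: list.splits if_splits)
  show "rel (inl_struct A) n \<subseteq> tuples (universe (inl_struct A)) \<tau>" if "fmlookup (sum_vocab V X) n = Some \<tau>" for \<tau>
    using that structuresD(4)[OF assms]
    by (cases n) (auto simp: fmlookup_sum_vocab inl_struct_def tuples_def split: if_splits)
qed (use structuresD(1,2)[OF assms] in simp_all)

lemma inr_structures:
  assumes "A \<in> structures X" shows "inr_struct A \<in> structures (sum_vocab V X)"
proof (rule structuresI)
  fix n
  show "rel (inr_struct A) n = {}" if "fmlookup (sum_vocab V X) n = None"
    using that structuresD(3)[OF assms] by (auto simp: fmlookup_sum_vocab inr_struct_def split: list.splits if_splits)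
  show "rel (inr_struct A) n \<subseteq> tuples (universe (inr_struct A)) \<tau>" if "fmlookup (sum_vocab V X) n = Some \<tau>" for \<tau>
    using that structuresD(4)[OF assms]
    by (cases n) (auto simp: fmlookup_sum_vocab inr_struct_def tuples_def split: if_splits)
qed (use structuresD(1,2)[OF assms] in simp_all)

lemma inl_iso: "A \<simeq> B \<Longrightarrow> inl_struct A \<simeq> inl_struct B"
  unfolding isomorphic_def inl_struct_def by (auto split: list.splits)

lemma inr_iso: "A \<simeq> B \<Longrightarrow> inr_struct A \<simeq> inr_struct B"
  unfolding isomorphic_def inr_struct_def by (auto split: list.splits)

text \<open>One interpretation that branches on a sentence: \<open>PF\<close> becomes the flag. The
  relations of the side not chosen are empty in \<open>inl_struct B\<close> and
  \<open>inr_struct B\<close>, whence the premises that the other family of predicates never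
  holds.\<close>

lemma sum_interpretation:
  assumes U: "definable V (typed [KElem]) (\<lambda>A \<nu>. PU A (\<nu> 0))"
    and F: "definable V Map.empty (\<lambda>A \<nu>. PF A)"
    and L: "\<And>R \<tau>. fmlookup W R = Some \<tau> \<Longrightarrow> definable V (typed \<tau>) (\<lambda>A \<nu>. PL R A (map \<nu> [0..<length \<tau>]))"
    and R: "\<And>R \<tau>. fmlookup X R = Some \<tau> \<Longrightarrow> definable V (typed \<tau>) (\<lambda>A \<nu>. PR R A (map \<nu> [0..<length \<tau>]))"
  obtains f where "mso_transduction V (sum_vocab W X) f"
    "\<And>A B. A \<in> structures V \<Longrightarrow> B \<in> structures W \<Longrightarrow> PF A \<Longrightarrow>
      universe B = {a \<in> universe A. PU A (Elem a)} \<Longrightarrow>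
      (\<And>R \<tau>. fmlookup W R = Some \<tau> \<Longrightarrow> rel B R = {as \<in> tuples (universe B) \<tau>. PL R A as}) \<Longrightarrow>
      (\<And>R as. \<not> PR R A as) \<Longrightarrow> (A, inl_struct B) \<in> f"
    "\<And>A B. A \<in> structures V \<Longrightarrow> B \<in> structures X \<Longrightarrow> \<not> PF A \<Longrightarrow>
      universe B = {a \<in> universe A. PU A (Elem a)} \<Longrightarrow>
      (\<And>R \<tau>. fmlookup X R = Some \<tau> \<Longrightarrow> rel B R = {as \<in> tuples (universe B) \<tau>. PR R A as}) \<Longrightarrow>
      (\<And>R as. \<not> PL R A as) \<Longrightarrow> (A, inr_struct B) \<in> f"
proof -
  let ?P = "\<lambda>n A as. case n of [] \<Rightarrow> PF A | ch # R \<Rightarrow> if ch = CHR ''l'' then PL R A as else PR R A as"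
  obtain f where f: "mso_transduction V (sum_vocab W X) f"
    and f': "\<And>A B. A \<in> structures V \<Longrightarrow> B \<in> structures (sum_vocab W X) \<Longrightarrow>
      universe B = {a \<in> universe A. PU A (Elem a)} \<Longrightarrow>
      (\<And>n \<tau>. fmlookup (sum_vocab W X) n = Some \<tau> \<Longrightarrow> rel B n = {as \<in> tuples (universe B) \<tau>. ?P n A as}) \<Longrightarrow> (A, B) \<in> f"
  proof (rule mso_interpretation_definable[OF U, of "sum_vocab W X" ?P])
    fix n \<tau> assume n: "fmlookup (sum_vocab W X) n = Some \<tau>"
    show "definable V (typed \<tau>) (\<lambda>A \<nu>. ?P n A (map \<nu> [0..<length \<tau>]))"
    proof (cases n)
      case Nil
      then show ?thesis using n F by simp
    next
      case (Cons ch S)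
      then consider "ch = CHR ''l''" "fmlookup W S = Some \<tau>" | "ch = CHR ''r''" "fmlookup X S = Some \<tau>"
        using n by (auto simp: fmlookup_sum_vocab split: if_splits)
      then show ?thesis by cases (use L R Cons in simp_all)
    qed
  qed blast
  show thesis
  proof (rule that[OF f])
    fix A B assume *: "A \<in> structures V" "B \<in> structures W" "PF A"
      "universe B = {a \<in> universe A. PU A (Elem a)}"
      "\<And>R \<tau>. fmlookup W R = Some \<tau> \<Longrightarrow> rel B R = {as \<in> tuples (universe B) \<tau>. PL R A as}"
      "\<And>R as. \<not> PR R A as"
    show "(A, inl_struct B) \<in> f"
    proof (rule f'[OF *(1) inl_structures[OF *(2)]])
      show "universe (inl_struct B) = {a \<in> universe A. PU A (Elem a)}" using *(4) by simp
      fix n \<tau> assume "fmlookup (sum_vocab W X) n = Some \<tau>"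
      then show "rel (inl_struct B) n = {as \<in> tuples (universe (inl_struct B)) \<tau>. ?P n A as}"
        using *(3,6) *(5)[of _ \<tau>]
        by (cases n) (auto simp: fmlookup_sum_vocab inl_struct_def tuples_def simp del: mem_Collect_eq split: if_splits)
    qed
  next
    fix A B assume *: "A \<in> structures V" "B \<in> structures X" "\<not> PF A"
      "universe B = {a \<in> universe A. PU A (Elem a)}"
      "\<And>R \<tau>. fmlookup X R = Some \<tau> \<Longrightarrow> rel B R = {as \<in> tuples (universe B) \<tau>. PR R A as}"
      "\<And>R as. \<not> PL R A as"
    show "(A, inr_struct B) \<in> f"
    proof (rule f'[OF *(1) inr_structures[OF *(2)]])
      show "universe (inr_struct B) = {a \<in> universe A. PU A (Elem a)}" using *(4) by simp
      fix n \<tau> assume "fmlookup (sum_vocab W X) n = Some \<tau>"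
      then show "rel (inr_struct B) n = {as \<in> tuples (universe (inr_struct B)) \<tau>. ?P n A as}"
        using *(3,6) *(5)[of _ \<tau>]
        by (cases n) (auto simp: fmlookup_sum_vocab inr_struct_def split: if_splits)
    qed
  qed
qed

lemma definable_flag: "fmlookup V R = Some [] \<Longrightarrow> definable V \<Gamma> (\<lambda>A \<nu>. [] \<in> rel A R)"
  using definable_atom[of V R "[]" \<Gamma> "[]"] by simp

lemma map_typed: "map (typed \<tau>) [0..<length \<tau>] = map Some \<tau>"
  by (rule nth_equalityI) (simp_all add: typed_def)

lemma definable_atom_typed:
  "fmlookup V R = Some \<tau> \<Longrightarrow> definable V (typed \<tau>) (\<lambda>A \<nu>. map \<nu> [0..<length \<tau>] \<in> rel A R)"
  using definable_atom[of V R \<tau> "typed \<tau>" "[0..<length \<tau>]"] map_typed by blast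

lemma rel_restrict:
  "A \<in> structures V \<Longrightarrow> fmlookup V R = Some \<tau> \<Longrightarrow> rel A R = {as \<in> tuples (universe A) \<tau>. as \<in> rel A R}"
  using structuresD(4) by blast

section \<open>Making transductions act on left structures and preserve right ones\<close>

fun rename_rels :: "(rel_name \<Rightarrow> rel_name) \<Rightarrow> formula \<Rightarrow> formula" where
  "rename_rels g (Atom R xs) = Atom (g R) xs"
| "rename_rels g (Neg \<phi>) = Neg (rename_rels g \<phi>)"
| "rename_rels g (Conj \<phi> \<psi>) = Conj (rename_rels g \<phi>) (rename_rels g \<psi>)"
| "rename_rels g (ExElem x \<phi>) = ExElem x (rename_rels g \<phi>)"
| "rename_rels g (ExSet x \<phi>) = ExSet x (rename_rels g \<phi>)"
| "rename_rels g \<phi> = \<phi>"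

lemma wf_rename_rels:
  "wf_formula V \<Gamma> \<phi> \<Longrightarrow> wf_formula (sum_vocab V X) \<Gamma> (rename_rels left_name \<phi>)"
  by (induction \<phi> arbitrary: \<Gamma>) auto

lemma sat_rename_rels: "sat (inl_struct A) \<nu> (rename_rels left_name \<phi>) \<longleftrightarrow> sat A \<nu> \<phi>"
  by (induction \<phi> arbitrary: \<nu>) auto

lemma definable_holds_typed:
  assumes "formula_of_type V \<tau> \<phi>"
  shows "definable V (typed \<tau>) (\<lambda>A \<nu>. holds A \<phi> (map \<nu> [0..<length \<tau>]))"
  by (rule definable_holds[OF assms map_typed])

text \<open>Copying and colouring also act on structures of the form \<open>inr_struct B\<close>, but
  an interpretation recovers \<open>inr_struct B\<close>.\<close>

lemma sum_cleanup:
  assumes U: "definable (sum_vocab W X) (typed [KElem]) (\<lambda>A \<nu>. PU A (\<nu> 0))"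
  obtains f where "mso_transduction (sum_vocab W X) (sum_vocab W X) f"
    "\<And>B. B \<in> structures W \<Longrightarrow> (inl_struct B, inl_struct B) \<in> f"
    "\<And>D B. D \<in> structures (sum_vocab W X) \<Longrightarrow> B \<in> structures X \<Longrightarrow> [] \<notin> rel D [] \<Longrightarrow>
      universe B = {a \<in> universe D. PU D (Elem a)} \<Longrightarrow>
      (\<And>R \<tau>. fmlookup X R = Some \<tau> \<Longrightarrow> rel B R = {as \<in> tuples (universe B) \<tau>. as \<in> rel D (right_name R)}) \<Longrightarrow>
      (D, inr_struct B) \<in> f"
proof -
  let ?V = "sum_vocab W X"
  have flag: "definable ?V \<Gamma> (\<lambda>A \<nu>. [] \<in> rel A [])" for \<Gamma> by (rule definable_flag) simp
  obtain f where f: "mso_transduction ?V (sum_vocab W X) f"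
    "\<And>A B. A \<in> structures ?V \<Longrightarrow> B \<in> structures W \<Longrightarrow> [] \<in> rel A [] \<Longrightarrow>
      universe B = {a \<in> universe A. [] \<in> rel A [] \<or> PU A (Elem a)} \<Longrightarrow>
      (\<And>R \<tau>. fmlookup W R = Some \<tau> \<Longrightarrow> rel B R = {as \<in> tuples (universe B) \<tau>. [] \<in> rel A [] \<and> as \<in> rel A (left_name R)}) \<Longrightarrow>
      (\<And>R as. as \<notin> rel A (right_name R)) \<Longrightarrow> (A, inl_struct B) \<in> f"
    "\<And>A B. A \<in> structures ?V \<Longrightarrow> B \<in> structures X \<Longrightarrow> [] \<notin> rel A [] \<Longrightarrow>
      universe B = {a \<in> universe A. [] \<in> rel A [] \<or> PU A (Elem a)} \<Longrightarrow>
      (\<And>R \<tau>. fmlookup X R = Some \<tau> \<Longrightarrow> rel B R = {as \<in> tuples (universe B) \<tau>. as \<in> rel A (right_name R)}) \<Longrightarrow>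
      (\<And>R as. \<not> ([] \<in> rel A [] \<and> as \<in> rel A (left_name R))) \<Longrightarrow> (A, inr_struct B) \<in> f"
    \<comment> \<open>The universe is cut down to \<open>PU\<close> only when the flag is off, so
      left structures pass unchanged.\<close>
    by (rule sum_interpretation[of ?V "\<lambda>A v. [] \<in> rel A [] \<or> PU A v" "\<lambda>A. [] \<in> rel A []" W
        "\<lambda>R A as. [] \<in> rel A [] \<and> as \<in> rel A (left_name R)" X "\<lambda>R A as. as \<in> rel A (right_name R)"])
      (simp_all add: flag U definable_disj definable_conj definable_atom_typed)
  show thesis
  proof (rule that[OF f(1)])
    fix B assume B: "B \<in> structures W"
    show "(inl_struct B, inl_struct B) \<in> f"
      by (rule f(2)[OF inl_structures[OF B] B]) (simp_all add: rel_restrict[OF B, symmetric])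
  next
    fix D B assume "D \<in> structures ?V" "B \<in> structures X" "[] \<notin> rel D []"
      "universe B = {a \<in> universe D. PU D (Elem a)}"
      "\<And>R \<tau>. fmlookup X R = Some \<tau> \<Longrightarrow> rel B R = {as \<in> tuples (universe B) \<tau>. as \<in> rel D (right_name R)}"
    then show "(D, inr_struct B) \<in> f" by (intro f(3)) simp_all
  qed
qed

lemma sum_vocab_copy:
  "fmupd (left_name c) \<tau> (sum_vocab V X) = sum_vocab (fmupd c \<tau> V) X"
  by (rule fmap_ext) (auto simp: fmlookup_sum_vocab split: list.splits)

lemma sum_vocab_colour:
  "colour_vocab (sum_vocab V X) (map left_name qs) = sum_vocab (colour_vocab V qs) X"
proof (rule fmap_ext)
  fix n
  show "fmlookup (colour_vocab (sum_vocab V X) (map left_name qs)) n = fmlookup (sum_vocab (colour_vocab V qs) X) n"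
    unfolding fmlookup_sum_vocab fmlookup_colour_vocab by (auto split: list.splits)
qed

text \<open>Only inclusions are required: bounded width asks for a cover of the class, so any further pairs of
  \<open>f'\<close> are harmless.\<close>

definition simulates_left :: "vocabulary \<Rightarrow> (struct \<times> struct) set \<Rightarrow> (struct \<times> struct) set \<Rightarrow> bool" where
  "simulates_left X f f' \<longleftrightarrow> (\<forall>(A, B)\<in>f. (inl_struct A, inl_struct B) \<in> f') \<and>
     (\<forall>B\<in>structures X. (inr_struct B, inr_struct B) \<in> f')"

text \<open>All defining formulas are guarded by the flag: with the flag on, the renamed formulas
  compute the interpretation; with it off, every element and every right relation is kept.\<close>

lemma simulates_left_interpretation:
  assumes \<phi>: "formula_of_type V [KElem] \<phi>"
    and \<psi>: "\<And>R \<tau>. fmlookup W R = Some \<tau> \<Longrightarrow> formula_of_type V \<tau> (\<psi> R)"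
  shows "\<exists>f'. mso_transduction (sum_vocab V X) (sum_vocab W X) f' \<and>
    simulates_left X (interpretation_rel V W \<phi> \<psi>) f'"
proof -
  let ?V = "sum_vocab V X"
  let ?ren = "rename_rels left_name"
  have flag: "definable ?V \<Gamma> (\<lambda>A \<nu>. [] \<in> rel A [])" for \<Gamma> by (rule definable_flag) simp
  have ren: "formula_of_type ?V \<tau> (?ren \<chi>)" if "formula_of_type V \<tau> \<chi>" for \<tau> \<chi>
    using that wf_rename_rels by (simp add: formula_of_type_typed)
  have def_ren: "definable ?V (typed \<tau>) (\<lambda>A \<nu>. holds A (?ren \<chi>) (map \<nu> [0..<length \<tau>]))"
    if "formula_of_type V \<tau> \<chi>" for \<tau> \<chi> by (rule definable_holds_typed[OF ren[OF that]])
  have holds: "holds (inl_struct A) (?ren \<chi>) as \<longleftrightarrow> holds A \<chi> as" for A \<chi> as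
    by (simp add: holds_def sat_rename_rels)
  obtain f where f: "mso_transduction ?V (sum_vocab W X) f"
    "\<And>A B. A \<in> structures ?V \<Longrightarrow> B \<in> structures W \<Longrightarrow> [] \<in> rel A [] \<Longrightarrow>
      universe B = {a \<in> universe A. [] \<in> rel A [] \<longrightarrow> holds A (?ren \<phi>) [Elem a]} \<Longrightarrow>
      (\<And>R \<tau>. fmlookup W R = Some \<tau> \<Longrightarrow> rel B R = {as \<in> tuples (universe B) \<tau>. [] \<in> rel A [] \<and> holds A (?ren (\<psi> R)) as}) \<Longrightarrow>
      (\<And>R as. as \<notin> rel A (right_name R)) \<Longrightarrow> (A, inl_struct B) \<in> f"
    "\<And>A B. A \<in> structures ?V \<Longrightarrow> B \<in> structures X \<Longrightarrow> [] \<notin> rel A [] \<Longrightarrow>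
      universe B = {a \<in> universe A. [] \<in> rel A [] \<longrightarrow> holds A (?ren \<phi>) [Elem a]} \<Longrightarrow>
      (\<And>R \<tau>. fmlookup X R = Some \<tau> \<Longrightarrow> rel B R = {as \<in> tuples (universe B) \<tau>. as \<in> rel A (right_name R)}) \<Longrightarrow>
      (\<And>R as. \<not> ([] \<in> rel A [] \<and> holds A (?ren (\<psi> R)) as)) \<Longrightarrow> (A, inr_struct B) \<in> f"
    by (rule sum_interpretation[of ?V "\<lambda>A v. [] \<in> rel A [] \<longrightarrow> holds A (?ren \<phi>) [v]" "\<lambda>A. [] \<in> rel A []" W
        "\<lambda>R A as. [] \<in> rel A [] \<and> holds A (?ren (\<psi> R)) as" X "\<lambda>R A as. as \<in> rel A (right_name R)"])
      (use def_ren[OF \<phi>] def_ren[OF \<psi>] in \<open>simp_all add: flag definable_imp definable_conj definable_atom_typed\<close>)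
  have "(inl_struct A, inl_struct B) \<in> f" if "(A, B) \<in> interpretation_rel V W \<phi> \<psi>" for A B
  proof -
    let ?I = "interpret_struct W \<phi> \<psi> A"
    have A: "A \<in> structures V" and B: "B \<in> structures W" and iso: "?I \<simeq> B"
      using that by (auto simp: interpretation_rel_def)
    have "universe ?I \<noteq> {}" using iso structuresD(2)[OF B] by (auto simp: isomorphic_def bij_betw_def)
    then have I: "?I \<in> structures W" by (rule interpret_struct_structures[OF A])
    have "(inl_struct A, inl_struct ?I) \<in> f"
      by (rule f(2)[OF inl_structures[OF A] I]) (simp_all add: holds, simp_all add: interpret_struct_def Let_def)
    then show ?thesis by (rule mso_transduction_iso[OF f(1) _ inl_iso[OF iso]])
  qed
  moreover have "(inr_struct B, inr_struct B) \<in> f" if B: "B \<in> structures X" for B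
    by (rule f(3)[OF inr_structures[OF B] B]) (simp_all add: rel_restrict[OF B, symmetric])
  ultimately show ?thesis using f(1) unfolding simulates_left_def by blast
qed

lemma simulates_left_filter:
  assumes "sentence V \<phi>"
  shows "\<exists>f'. mso_transduction (sum_vocab V X) (sum_vocab V X) f' \<and> simulates_left X (filter_rel V \<phi>) f'"
proof -
  let ?V = "sum_vocab V X"
  \<comment> \<open>The filter is weakened to an implication from the flag, so that right structures
    always pass.\<close>
  let ?\<phi> = "Neg (Conj (Atom [] []) (Neg (rename_rels left_name \<phi>)))"
  have "sentence ?V ?\<phi>" using assms wf_rename_rels by (simp add: formula_of_type_typed)
  moreover have "(inl_struct A, inl_struct B) \<in> filter_rel ?V ?\<phi>" if "(A, B) \<in> filter_rel V \<phi>" for A B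
    using that by (auto simp: filter_rel_def inl_structures inl_iso holds_def sat_rename_rels)
  moreover have "(inr_struct B, inr_struct B) \<in> filter_rel ?V ?\<phi>" if "B \<in> structures X" for B
    using that iso_refl by (auto simp: filter_rel_def inr_structures holds_def)
  ultimately show ?thesis using mso_transduction.mso_filtering[of ?V ?\<phi>]
    unfolding simulates_left_def by blast
qed

text \<open>Copying also multiplies right structures; the cleanup keeps copy 0 only, which is
  definable as the set of first entries of the copy relation.\<close>

lemma simulates_left_copy:
  assumes k: "1 \<le> k" and c: "c \<notin> fmdom' V"
  shows "\<exists>f'. mso_transduction (sum_vocab V X) (sum_vocab (fmupd c (replicate k KElem) V) X) f' \<and>
    simulates_left X (copy_rel V k c) f'"
proof -
  let ?V = "sum_vocab V X" and ?W = "fmupd c (replicate k KElem) V"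
  let ?S = "sum_vocab ?W X"
  let ?c = "left_name c"
  let ?PU = "\<lambda>A v. \<exists>as\<in>rel A ?c. hd as = v"
  have lk: "fmlookup ?S ?c = Some (replicate k KElem)" by simp
  \<comment> \<open>Variable 0 is the tested element; the variables from 1 on are quantified and
    fill the remaining positions of the copy tuple.\<close>
  let ?ys = "map (\<lambda>i. (i, KElem)) [1..<k]"
  have "definable ?S (typed [KElem]) (\<lambda>A \<nu>. \<exists>f. (\<forall>(y, \<kappa>)\<in>set ?ys. has_kind (universe A) (f y) \<kappa>) \<and>
      map (override_on \<nu> f (fst ` set ?ys)) [0..<k] \<in> rel A ?c)"
  proof (rule definable_ex_vars, simp add: comp_def, rule definable_atom[OF lk])
    have "map_of ?ys i = (if i \<in> {1..<k} then Some KElem else None)" for i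
      by (auto simp: map_of_eq_None_iff map_of_eq_Some_iff comp_def)
    then show "map (typed [KElem] ++ map_of ?ys) [0..<k] = map Some (replicate k KElem)"
      by (auto simp: list_eq_iff_nth_eq map_add_def typed_def not_less_eq_eq)
  qed
  then have U: "definable ?S (typed [KElem]) (\<lambda>A \<nu>. ?PU A (\<nu> 0))"
  proof (rule definable_cong)
    fix A and \<nu> :: "nat \<Rightarrow> arg" assume A: "A \<in> structures ?S"
    have fst_ys: "fst ` set ?ys = {1..<k}" by force
    show "(\<exists>f. (\<forall>(y, \<kappa>)\<in>set ?ys. has_kind (universe A) (f y) \<kappa>) \<and>
      map (override_on \<nu> f (fst ` set ?ys)) [0..<k] \<in> rel A ?c) \<longleftrightarrow> ?PU A (\<nu> 0)" (is "?L \<longleftrightarrow> ?R")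
    proof
      assume ?L
      then obtain f where "map (override_on \<nu> f {1..<k}) [0..<k] \<in> rel A ?c" unfolding fst_ys by blast
      moreover have "hd (map (override_on \<nu> f {1..<k}) [0..<k]) = \<nu> 0" using k by (simp add: hd_map override_on_def)
      ultimately show ?R by blast
    next
      assume ?R
      then obtain as where as: "as \<in> rel A ?c" "hd as = \<nu> 0" by blast
      then have "as \<in> tuples (universe A) (replicate k KElem)" using structuresD(4)[OF A lk] by blast
      then have t: "length as = k" "\<And>i. i < k \<Longrightarrow> has_kind (universe A) (as ! i) KElem"
        by (auto simp: tuples_def list_all2_conv_all_nth)
      have "as ! 0 = \<nu> 0" using as(2) t(1) k by (metis hd_conv_nth list.size(3) not_one_le_zero)
      then have "map (override_on \<nu> ((!) as) {1..<k}) [0..<k] = as"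
        using t(1) by (auto simp: list_eq_iff_nth_eq override_on_def Suc_le_eq) 
      then show ?L unfolding fst_ys using as(1) t(2) by (intro exI[of _ "(!) as"]) auto
    qed
  qed
  obtain g where g: "mso_transduction ?S ?S g"
    "\<And>B. B \<in> structures ?W \<Longrightarrow> (inl_struct B, inl_struct B) \<in> g"
    "\<And>D B. D \<in> structures ?S \<Longrightarrow> B \<in> structures X \<Longrightarrow> [] \<notin> rel D [] \<Longrightarrow>
      universe B = {a \<in> universe D. ?PU D (Elem a)} \<Longrightarrow>
      (\<And>R \<tau>. fmlookup X R = Some \<tau> \<Longrightarrow> rel B R = {as \<in> tuples (universe B) \<tau>. as \<in> rel D (right_name R)}) \<Longrightarrow>
      (D, inr_struct B) \<in> g"
    by (rule sum_cleanup[OF U]) blast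
  have c': "?c \<notin> fmdom' ?V" using c by (simp add: fmlookup_dom'_iff)
  have copy: "mso_transduction ?V ?S (copy_rel ?V k ?c)"
    using mso_transduction.mso_copying[OF k c'] unfolding sum_vocab_copy .
  have "(inl_struct A, inl_struct B) \<in> copy_rel ?V k ?c O g" if AB: "(A, B) \<in> copy_rel V k c" for A B
  proof -
    obtain h where A: "A \<in> structures V" and h: "inj_on (\<lambda>(i, a). h i a) ({..<k} \<times> universe A)"
      "universe B = (\<Union>i<k. h i ` universe A)"
      "\<And>R. rel B R =
           (if R = c then (\<lambda>a. map (\<lambda>i. Elem (h i a)) [0..<k]) ` universe A
            else (\<Union>i<k. map (map_arg (h i)) ` rel A R))"
      using AB unfolding copy_rel_def by blast
    \<comment> \<open>The flag survives copying: its nullary tuple is inherited from every copy, and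
      \<open>1 \<le> k\<close> guarantees one.\<close>
    have "rel (inl_struct B) n = (if n = ?c then (\<lambda>a. map (\<lambda>i. Elem (h i a)) [0..<k]) ` universe (inl_struct A)
            else (\<Union>i<k. map (map_arg (h i)) ` rel (inl_struct A) n))" for n
      using k by (cases n) (auto simp: inl_struct_def h(3) Suc_le_eq)
    then have "(inl_struct A, inl_struct B) \<in> copy_rel ?V k ?c"
      unfolding copy_rel_def using inl_structures[OF A] h(1,2) by auto
    then show ?thesis using g(2)[OF copy_structures[OF k c AB]] by blast
  qed
  moreover have "(inr_struct B, inr_struct B) \<in> copy_rel ?V k ?c O g" if B: "B \<in> structures X" for B
  proof -
    let ?h = "\<lambda>i a. k * a + i"
    let ?D = "copy_struct k ?c (inr_struct B)"
    have BD: "(inr_struct B, ?D) \<in> copy_rel ?V k ?c" by (rule copy_struct_copy[OF inr_structures[OF B]])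
    have D: "?D \<in> structures ?S" using copy_structures[OF k c' BD] unfolding sum_vocab_copy .
    \<comment> \<open>Copy 0 of \<open>B\<close>, with elements \<open>k * b\<close>; it is the
      literal result of the cleanup and is isomorphic to \<open>B\<close>.\<close>
    define B' where "B' = \<lparr>universe = ?h 0 ` universe B, rel = (\<lambda>R. map (map_arg (?h 0)) ` rel B R)\<rparr>"
    have "inj_on (?h 0) (universe B)" using k by (auto simp: inj_on_def)
    then have iso: "B \<simeq> B'" unfolding isomorphic_def B'_def bij_betw_def by (intro exI[of _ "?h 0"]) simp
    then have B': "B' \<in> structures X" by (rule iso_structures[OF B])
    have "(?D, inr_struct B') \<in> g"
    proof (rule g(3)[OF D B'])
      show "[] \<notin> rel ?D []" by (simp add: copy_struct_def)
      have "hd (map (\<lambda>i. Elem (k * b + i)) [0..<k]) = Elem (k * b)" for b using k by (simp add: hd_map)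
      then have "?PU ?D (Elem a) \<longleftrightarrow> (\<exists>b\<in>universe B. k * b = a)" for a by (auto simp: copy_struct_def)
      then show "universe B' = {a \<in> universe ?D. ?PU ?D (Elem a)}"
        using k by (auto simp: B'_def copy_struct_def) (metis Suc_le_eq add.right_neutral)
      fix R \<tau> assume R: "fmlookup X R = Some \<tau>"
      have rD: "rel ?D (right_name R) = (\<Union>i<k. map (map_arg (?h i)) ` rel B R)" by (simp add: copy_struct_def)
      \<comment> \<open>Restricting to copy 0 brings in no foreign tuple: an argument from copy
        \<open>i\<close> that lies over copy 0 forces \<open>i = 0\<close>, unless it is the empty
        set, which looks the same in all copies.\<close>
      have one: "map_arg (?h i) v = map_arg (?h 0) v"
        if i: "i < k" and v: "has_kind (universe B) v \<kappa>" "has_kind (?h 0 ` universe B) (map_arg (?h i) v) \<kappa>" for i v \<kappa>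
      proof -
        have eq: "i = 0" if "k * a + i \<in> ?h 0 ` universe B" for a
        proof -
          from that obtain b where "k * a + i = k * b + 0" by auto
          then show ?thesis using mult_add_eq_iff[OF i, of 0 a b] k by simp
        qed
        show ?thesis
        proof (cases v)
          case (Elem a)
          then have "k * a + i \<in> ?h 0 ` universe B" using v(2) by (cases \<kappa>) simp_all
          then show ?thesis using eq[of a] by simp
        next
          case (SetArg T)
          then have "?h i ` T \<subseteq> ?h 0 ` universe B" using v(2) by (cases \<kappa>) simp_all
          then have "T = {} \<or> i = 0" using eq by blast
          then show ?thesis using SetArg by auto
        qed
      qed
      show "rel B' R = {as \<in> tuples (universe B') \<tau>. as \<in> rel ?D (right_name R)}"
      proof
        show "rel B' R \<subseteq> {as \<in> tuples (universe B') \<tau>. as \<in> rel ?D (right_name R)}"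
          using structuresD(4)[OF B' R] k unfolding rD by (auto simp: B'_def intro!: bexI[of _ 0])
        show "{as \<in> tuples (universe B') \<tau>. as \<in> rel ?D (right_name R)} \<subseteq> rel B' R"
        proof
          fix as assume "as \<in> {as \<in> tuples (universe B') \<tau>. as \<in> rel ?D (right_name R)}"
          then obtain i bs where i: "i < k" and bs: "bs \<in> rel B R" "as = map (map_arg (?h i)) bs"
            and as: "as \<in> tuples (?h 0 ` universe B) \<tau>" unfolding rD by (auto simp: B'_def)
          have "bs \<in> tuples (universe B) \<tau>" using structuresD(4)[OF B R] bs(1) by blast
          then have "map (map_arg (?h i)) bs = map (map_arg (?h 0)) bs"
            using as one[OF i] unfolding bs(2)
            by (intro nth_equalityI) (auto simp: tuples_def list_all2_conv_all_nth)
          then show "as \<in> rel B' R" using bs(1) unfolding bs(2) B'_def by (simp only: select_convs imageI)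
        qed
      qed
    qed
    then have "(?D, inr_struct B) \<in> g"
      by (rule mso_transduction_iso[OF g(1) _ inr_iso[OF iso_sym[OF B iso]]])
    then show ?thesis using BD by blast
  qed
  ultimately show ?thesis using mso_transduction.mso_composition[OF copy g(1)]
    unfolding simulates_left_def by blast
qed

lemma simulates_left_colour:
  assumes qs: "1 \<le> length qs" "distinct qs" "set qs \<inter> fmdom' V = {}"
  shows "\<exists>f'. mso_transduction (sum_vocab V X) (sum_vocab (colour_vocab V qs) X) f' \<and>
    simulates_left X (colour_rel V qs) f'"
proof -
  let ?V = "sum_vocab V X" and ?W = "colour_vocab V qs"
  let ?S = "sum_vocab ?W X" and ?qs = "map left_name qs"
  obtain g where g: "mso_transduction ?S ?S g"
    "\<And>B. B \<in> structures ?W \<Longrightarrow> (inl_struct B, inl_struct B) \<in> g"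
    "\<And>D B. D \<in> structures ?S \<Longrightarrow> B \<in> structures X \<Longrightarrow> [] \<notin> rel D [] \<Longrightarrow>
      universe B = {a \<in> universe D. True} \<Longrightarrow>
      (\<And>R \<tau>. fmlookup X R = Some \<tau> \<Longrightarrow> rel B R = {as \<in> tuples (universe B) \<tau>. as \<in> rel D (right_name R)}) \<Longrightarrow>
      (D, inr_struct B) \<in> g"
    by (rule sum_cleanup[OF definable_true]) blast
  have colour: "mso_transduction ?V ?S (colour_rel ?V ?qs)"
    unfolding sum_vocab_colour[symmetric]
    by (rule mso_transduction.mso_colouring)
      (use qs in \<open>auto simp: distinct_map fmlookup_dom'_iff disjoint_iff\<close>)
  have "(inl_struct A, inl_struct B) \<in> colour_rel ?V ?qs O g" if AB: "(A, B) \<in> colour_rel V qs" for A B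
  proof -
    obtain c where A: "A \<in> structures V" and c: "c ` universe A \<subseteq> set qs" "colour_struct qs c A \<simeq> B"
      using AB by (auto simp: colour_rel_def)
    have "rel (colour_struct ?qs (left_name \<circ> c) (inl_struct A)) n = rel (inl_struct (colour_struct qs c A)) n" for n
      by (cases n) (auto simp: colour_struct_def inl_struct_def)
    then have "colour_struct ?qs (left_name \<circ> c) (inl_struct A) = inl_struct (colour_struct qs c A)"
      by (intro struct.equality) (auto simp: colour_struct_def)
    then have "colour_struct ?qs (left_name \<circ> c) (inl_struct A) \<simeq> inl_struct B" using inl_iso[OF c(2)] by simp
    then have "(inl_struct A, inl_struct B) \<in> colour_rel ?V ?qs"
      unfolding colour_rel_def using inl_structures[OF A] c(1) by (auto intro!: exI[of _ "left_name \<circ> c"])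
    moreover have "B \<in> structures ?W" using iso_structures[OF colour_structures[OF A] c(2)] .
    ultimately show ?thesis using g(2) by blast
  qed
  moreover have "(inr_struct B, inr_struct B) \<in> colour_rel ?V ?qs O g" if B: "B \<in> structures X" for B
  proof -
    \<comment> \<open>Any colouring of a right structure will do, since the cleanup reads only its
      right relations and so forgets the colours; \<open>qs\<close> is nonempty, so
      \<open>hd\<close> is a colour.\<close>
    let ?c = "\<lambda>_. hd ?qs"
    let ?D = "colour_struct ?qs ?c (inr_struct B)"
    have "?c ` universe (inr_struct B) \<subseteq> set ?qs" using qs(1) by (cases qs) auto
    then have "(inr_struct B, ?D) \<in> colour_rel ?V ?qs"
      unfolding colour_rel_def using inr_structures[OF B] iso_refl by (auto intro!: exI[of _ ?c])
    moreover have D: "?D \<in> structures ?S"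
      using colour_structures[OF inr_structures[OF B]] sum_vocab_colour by metis
    moreover have "(?D, inr_struct B) \<in> g"
    proof (rule g(3)[OF D B])
      have "rel ?D (right_name R) = rel B R" for R by (auto simp: colour_struct_def)
      then show "rel B R = {as \<in> tuples (universe B) \<tau>. as \<in> rel ?D (right_name R)}"
        if "fmlookup X R = Some \<tau>" for R \<tau> using rel_restrict[OF B that] by simp
    qed (auto simp: colour_struct_def)
    ultimately show ?thesis by blast
  qed
  ultimately show ?thesis using mso_transduction.mso_composition[OF colour g(1)]
    unfolding simulates_left_def by blast
qed

lemma simulates_left:
  "mso_transduction V W f \<Longrightarrow> \<exists>f'. mso_transduction (sum_vocab V X) (sum_vocab W X) f' \<and> simulates_left X f f'"
proof (induction rule: mso_transduction.induct)
  case (mso_composition V W f Y g)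
  then obtain f' g' where *: "mso_transduction (sum_vocab V X) (sum_vocab W X) f'" "simulates_left X f f'"
    "mso_transduction (sum_vocab W X) (sum_vocab Y X) g'" "simulates_left X g g'" by blast
  have "simulates_left X (f O g) (f' O g')" using *(2,4) unfolding simulates_left_def by fast
  then show ?case using mso_transduction.mso_composition[OF *(1,3)] by blast
qed (blast intro: simulates_left_interpretation simulates_left_filter simulates_left_copy simulates_left_colour)+

text \<open>Simulation is available on the left side only; the swap lets the second transduction
  work on the other side.\<close>

lemma sum_swap:
  obtains f where "mso_transduction (sum_vocab V X) (sum_vocab X V) f"
    "\<And>A. A \<in> structures V \<Longrightarrow> (inl_struct A, inr_struct A) \<in> f"
    "\<And>B. B \<in> structures X \<Longrightarrow> (inr_struct B, inl_struct B) \<in> f"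
proof -
  let ?V = "sum_vocab V X"
  have flag: "definable ?V \<Gamma> (\<lambda>A \<nu>. [] \<in> rel A [])" for \<Gamma> by (rule definable_flag) simp
  obtain f where f: "mso_transduction ?V (sum_vocab X V) f"
    "\<And>A B. A \<in> structures ?V \<Longrightarrow> B \<in> structures X \<Longrightarrow> [] \<notin> rel A [] \<Longrightarrow>
      universe B = {a \<in> universe A. True} \<Longrightarrow>
      (\<And>R \<tau>. fmlookup X R = Some \<tau> \<Longrightarrow> rel B R = {as \<in> tuples (universe B) \<tau>. as \<in> rel A (right_name R)}) \<Longrightarrow>
      (\<And>R as. as \<notin> rel A (left_name R)) \<Longrightarrow> (A, inl_struct B) \<in> f"
    "\<And>A B. A \<in> structures ?V \<Longrightarrow> B \<in> structures V \<Longrightarrow> \<not> [] \<notin> rel A [] \<Longrightarrow>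
      universe B = {a \<in> universe A. True} \<Longrightarrow>
      (\<And>R \<tau>. fmlookup V R = Some \<tau> \<Longrightarrow> rel B R = {as \<in> tuples (universe B) \<tau>. as \<in> rel A (left_name R)}) \<Longrightarrow>
      (\<And>R as. as \<notin> rel A (right_name R)) \<Longrightarrow> (A, inr_struct B) \<in> f"
    by (rule sum_interpretation[of ?V "\<lambda>A v. True" "\<lambda>A. [] \<notin> rel A []" X
        "\<lambda>R A as. as \<in> rel A (right_name R)" V "\<lambda>R A as. as \<in> rel A (left_name R)"])
      (simp_all add: flag definable_true definable_neg definable_atom_typed)
  show thesis
  proof (rule that[OF f(1)])
    show "(inl_struct A, inr_struct A) \<in> f" if A: "A \<in> structures V" for A
      by (rule f(3)[OF inl_structures[OF A] A]) (simp_all add: rel_restrict[OF A, symmetric])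
    show "(inr_struct B, inl_struct B) \<in> f" if B: "B \<in> structures X" for B
      by (rule f(2)[OF inr_structures[OF B] B]) (simp_all add: rel_restrict[OF B, symmetric])
  qed
qed

text \<open>On embedded structures one side has only empty relations, so the union of both sides
  gives the original back.\<close>

lemma sum_merge:
  obtains f where "mso_transduction (sum_vocab V V) V f"
    "\<And>A. A \<in> structures V \<Longrightarrow> (inl_struct A, A) \<in> f"
    "\<And>A. A \<in> structures V \<Longrightarrow> (inr_struct A, A) \<in> f"
proof -
  let ?V = "sum_vocab V V"
  obtain f where f: "mso_transduction ?V V f"
    "\<And>A B. A \<in> structures ?V \<Longrightarrow> B \<in> structures V \<Longrightarrow> universe B = {a \<in> universe A. True} \<Longrightarrow>
      (\<And>R \<tau>. fmlookup V R = Some \<tau> \<Longrightarrow>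
        rel B R = {as \<in> tuples (universe B) \<tau>. as \<in> rel A (left_name R) \<or> as \<in> rel A (right_name R)}) \<Longrightarrow> (A, B) \<in> f"
    by (rule mso_interpretation_definable[of ?V "\<lambda>A v. True" V "\<lambda>R A as. as \<in> rel A (left_name R) \<or> as \<in> rel A (right_name R)"])
      (simp_all add: definable_true definable_disj definable_atom_typed)
  show thesis
  proof (rule that[OF f(1)])
    fix A assume A: "A \<in> structures V"
    show "(inl_struct A, A) \<in> f"
      by (rule f(2)[OF inl_structures[OF A] A]) (simp_all add: rel_restrict[OF A, symmetric])
    show "(inr_struct A, A) \<in> f"
      by (rule f(2)[OF inr_structures[OF A] A]) (simp_all add: rel_restrict[OF A, symmetric])
  qed
qed

text \<open>The nondeterministic choice comes from a colouring with two colours: the left embedding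
  is taken iff colour \<open>''0''\<close> occurs. Since universes are nonempty, the two constant
  colourings realise both outcomes.\<close>

lemma sum_choose:
  assumes fresh: "''0'' \<notin> fmdom' V" "''1'' \<notin> fmdom' V"
  obtains f where "mso_transduction V (sum_vocab V V) f"
    "\<And>A. A \<in> structures V \<Longrightarrow> (A, inl_struct A) \<in> f"
    "\<And>A. A \<in> structures V \<Longrightarrow> (A, inr_struct A) \<in> f"
proof -
  let ?qs = "[''0'', ''1'']"
  let ?W = "colour_vocab V ?qs"
  let ?P = "\<lambda>A. \<exists>a\<in>universe A. [Elem a] \<in> rel A ''0''"
  have F: "definable ?W \<Gamma> (\<lambda>A \<nu>. ?P A)" for \<Gamma>
  proof -
    have "definable ?W \<Gamma> (\<lambda>A \<nu>. \<exists>a\<in>universe A. map (\<nu>(0 := Elem a)) [0] \<in> rel A ''0'')"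
      by (rule definable_ex_elem, rule definable_atom[of _ _ "[KElem]"])
        (unfold fmlookup_colour_vocab, simp_all)
    then show ?thesis by simp
  qed
  have atom: "definable ?W (typed \<tau>) (\<lambda>A \<nu>. map \<nu> [0..<length \<tau>] \<in> rel A R)" if "fmlookup V R = Some \<tau>" for R \<tau>
  proof (rule definable_atom_typed)
    have "R \<notin> set ?qs" using that fresh by (auto simp: fmlookup_dom'_iff)
    then show "fmlookup ?W R = Some \<tau>" using that unfolding fmlookup_colour_vocab by simp
  qed
  obtain f where f: "mso_transduction ?W (sum_vocab V V) f"
    "\<And>A B. A \<in> structures ?W \<Longrightarrow> B \<in> structures V \<Longrightarrow> ?P A \<Longrightarrow>
      universe B = {a \<in> universe A. True} \<Longrightarrow>
      (\<And>R \<tau>. fmlookup V R = Some \<tau> \<Longrightarrow> rel B R = {as \<in> tuples (universe B) \<tau>. ?P A \<and> as \<in> rel A R}) \<Longrightarrow>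
      (\<And>R as. \<not> (\<not> ?P A \<and> as \<in> rel A R)) \<Longrightarrow> (A, inl_struct B) \<in> f"
    "\<And>A B. A \<in> structures ?W \<Longrightarrow> B \<in> structures V \<Longrightarrow> \<not> ?P A \<Longrightarrow>
      universe B = {a \<in> universe A. True} \<Longrightarrow>
      (\<And>R \<tau>. fmlookup V R = Some \<tau> \<Longrightarrow> rel B R = {as \<in> tuples (universe B) \<tau>. \<not> ?P A \<and> as \<in> rel A R}) \<Longrightarrow>
      (\<And>R as. \<not> (?P A \<and> as \<in> rel A R)) \<Longrightarrow> (A, inr_struct B) \<in> f"
  proof (rule sum_interpretation[of ?W "\<lambda>A v. True" ?P V
        "\<lambda>R A as. ?P A \<and> as \<in> rel A R" V "\<lambda>R A as. \<not> ?P A \<and> as \<in> rel A R"])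
    show "definable ?W (typed [KElem]) (\<lambda>A \<nu>. True)" by (rule definable_true)
    show "definable ?W Map.empty (\<lambda>A \<nu>. ?P A)" by (rule F)
    show "definable ?W (typed \<tau>) (\<lambda>A \<nu>. ?P A \<and> map \<nu> [0..<length \<tau>] \<in> rel A R)"
      "definable ?W (typed \<tau>) (\<lambda>A \<nu>. \<not> ?P A \<and> map \<nu> [0..<length \<tau>] \<in> rel A R)"
      if "fmlookup V R = Some \<tau>" for R \<tau>
      by (intro definable_conj definable_neg F atom that)+
  qed blast
  have colour: "mso_transduction V ?W (colour_rel V ?qs)"
    by (rule mso_transduction.mso_colouring) (use fresh in auto)
  show thesis
  proof (rule that[OF mso_transduction.mso_composition[OF colour f(1)]])
    fix A assume A: "A \<in> structures V"
    have col: "(A, colour_struct ?qs (\<lambda>_. q) A) \<in> colour_rel V ?qs" if "q \<in> set ?qs" for q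
      unfolding colour_rel_def using A that iso_refl by (auto intro!: exI[of _ "\<lambda>_. q"])
    have rels: "rel (colour_struct ?qs c A) R = rel A R" if "fmlookup V R = Some \<tau>" for c R \<tau>
    proof -
      have "R \<notin> set ?qs" using that fresh by (auto simp: fmlookup_dom'_iff)
      then show ?thesis by (simp add: colour_struct_def)
    qed
    have UA: "universe (colour_struct ?qs c A) = universe A" for c by (simp add: colour_struct_def)
    have P0: "?P (colour_struct ?qs (\<lambda>_. ''0'') A)" using structuresD(2)[OF A] by (auto simp: colour_struct_def)
    have P1: "\<not> ?P (colour_struct ?qs (\<lambda>_. ''1'') A)" by (auto simp: colour_struct_def)
    have "(colour_struct ?qs (\<lambda>_. ''0'') A, inl_struct A) \<in> f"
    proof (rule f(2)[OF colour_structures[OF A] A P0])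
      show "universe A = {a \<in> universe (colour_struct ?qs (\<lambda>_. ''0'') A). True}" using UA by simp
      show "rel A R = {as \<in> tuples (universe A) \<tau>. ?P (colour_struct ?qs (\<lambda>_. ''0'') A) \<and> as \<in> rel (colour_struct ?qs (\<lambda>_. ''0'') A) R}"
        if "fmlookup V R = Some \<tau>" for R \<tau>
        using P0 unfolding rels[OF that] using rel_restrict[OF A that] by simp
    qed (use P0 in blast)
    then show "(A, inl_struct A) \<in> colour_rel V ?qs O f" using col[of "''0''"] by auto
    have "(colour_struct ?qs (\<lambda>_. ''1'') A, inr_struct A) \<in> f"
    proof (rule f(3)[OF colour_structures[OF A] A P1])
      show "universe A = {a \<in> universe (colour_struct ?qs (\<lambda>_. ''1'') A). True}" using UA by simp
      show "rel A R = {as \<in> tuples (universe A) \<tau>. \<not> ?P (colour_struct ?qs (\<lambda>_. ''1'') A) \<and> as \<in> rel (colour_struct ?qs (\<lambda>_. ''1'') A) R}"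
        if "fmlookup V R = Some \<tau>" for R \<tau>
        using P1 unfolding rels[OF that] using rel_restrict[OF A that] by simp
    qed (use P1 in blast)
    then show "(A, inr_struct A) \<in> colour_rel V ?qs O f" using col[of "''1''"] by auto
  qed
qed

text \<open>A pair of \<open>f\<close> travels as left, computed by \<open>f'\<close>, swapped to
  the right and preserved by \<open>g'\<close>; a pair of \<open>g\<close> travels as right,
  preserved by \<open>f'\<close>, swapped to the left and computed by \<open>g'\<close>.\<close>

lemma bounded_width_Un:
  assumes "bounded_mso_width V C" "bounded_mso_width V D"
  shows "bounded_mso_width V (C \<union> D)"
proof -
  let ?T = tree_vocab
  obtain f g where f: "mso_transduction ?T V f" "C \<subseteq> f `` trees" and g: "mso_transduction ?T V g" "D \<subseteq> g `` trees"
    using assms unfolding bounded_mso_width_def by blast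
  obtain f' where f': "mso_transduction (sum_vocab ?T ?T) (sum_vocab V ?T) f'" "simulates_left ?T f f'"
    using simulates_left[OF f(1)] by blast
  obtain g' where g': "mso_transduction (sum_vocab ?T V) (sum_vocab V V) g'" "simulates_left V g g'"
    using simulates_left[OF g(1)] by blast
  obtain s where s: "mso_transduction (sum_vocab V ?T) (sum_vocab ?T V) s"
    "\<And>A. A \<in> structures V \<Longrightarrow> (inl_struct A, inr_struct A) \<in> s"
    "\<And>B. B \<in> structures ?T \<Longrightarrow> (inr_struct B, inl_struct B) \<in> s" by (rule sum_swap) blast
  obtain m where m: "mso_transduction (sum_vocab V V) V m"
    "\<And>A. A \<in> structures V \<Longrightarrow> (inl_struct A, A) \<in> m"
    "\<And>A. A \<in> structures V \<Longrightarrow> (inr_struct A, A) \<in> m" by (rule sum_merge) blast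
  obtain c where c: "mso_transduction ?T (sum_vocab ?T ?T) c"
    "\<And>A. A \<in> structures ?T \<Longrightarrow> (A, inl_struct A) \<in> c"
    "\<And>A. A \<in> structures ?T \<Longrightarrow> (A, inr_struct A) \<in> c"
    by (rule sum_choose[of ?T]) (auto simp: tree_vocab_def)
  let ?h = "c O (f' O (s O (g' O m)))"
  have h: "mso_transduction ?T V ?h"
    using mso_transduction.mso_composition[OF c(1) mso_transduction.mso_composition[OF f'(1)
      mso_transduction.mso_composition[OF s(1) mso_transduction.mso_composition[OF g'(1) m(1)]]]] .
  have 1: "(t, B) \<in> ?h" if "(t, B) \<in> f" for t B
  proof -
    have "t \<in> structures ?T" "B \<in> structures V" using mso_transduction_structures[OF f(1) that] by auto
    moreover have "(inl_struct t, inl_struct B) \<in> f'" using f'(2) that unfolding simulates_left_def by blast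
    moreover have "(inr_struct B, inr_struct B) \<in> g'" using g'(2) \<open>B \<in> structures V\<close> unfolding simulates_left_def by blast
    ultimately show ?thesis using c(2) s(2) m(3) by blast
  qed
  have 2: "(t, B) \<in> ?h" if "(t, B) \<in> g" for t B
  proof -
    have "t \<in> structures ?T" "B \<in> structures V" using mso_transduction_structures[OF g(1) that] by auto
    moreover have "(inl_struct t, inl_struct B) \<in> g'" using g'(2) that unfolding simulates_left_def by blast
    moreover have "(inr_struct t, inr_struct t) \<in> f'" using f'(2) \<open>t \<in> structures ?T\<close> unfolding simulates_left_def by blast
    ultimately show ?thesis using c(3) s(3) m(2) by blast
  qed
  have "C \<union> D \<subseteq> ?h `` trees"
  proof
    fix B assume "B \<in> C \<union> D"
    then obtain t where "t \<in> trees" "(t, B) \<in> f \<or> (t, B) \<in> g" using f(2) g(2) by blast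
    then show "B \<in> ?h `` trees" using 1 2 by (intro ImageI[of t]) blast+
  qed
  then show ?thesis using h unfolding bounded_mso_width_def by blast
qed

lemma bounded_width_empty: "bounded_mso_width V {}"
proof -
  \<comment> \<open>A true formula without free variables, hence of every type; it defines both the
    universe and all relations of some transduction into \<open>V\<close>.\<close>
  let ?t = "Neg (ExElem 0 (Neg (Eq 0 0)))"
  have "mso_transduction tree_vocab V (interpretation_rel tree_vocab V ?t (\<lambda>_. ?t))"
    by (rule mso_transduction.mso_interpretation) (simp_all add: formula_of_type_def)
  then show ?thesis unfolding bounded_mso_width_def by blast
qed

lemma bounded_width_subset: "bounded_mso_width V D \<Longrightarrow> C \<subseteq> D \<Longrightarrow> bounded_mso_width V C"
  unfolding bounded_mso_width_def by (meson order_trans)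

lemma bounded_width_UN:
  assumes "finite I" "\<And>i. i \<in> I \<Longrightarrow> bounded_mso_width V (C i)"
  shows "bounded_mso_width V (\<Union>i\<in>I. C i)"
  using assms by (induction I rule: finite_induct) (simp_all add: bounded_width_empty bounded_width_Un)

subsection \<open>There are countably many transductions\<close>

instance arg_kind :: countable by countable_datatype

instance formula :: countable by countable_datatype

text \<open>Finite syntax for transductions. The formulas of an interpretation form a list, because
  functions from all names to formulas are uncountable and only the finitely many names of the
  output vocabulary matter. Codes are not checked for well-formedness, so
  \<open>mso_transduction\<close> has to be required separately.\<close>

datatype transduction_code =
    InterpretationCode vocabulary vocabulary formula "(rel_name \<times> formula) list"
  | FilterCode vocabulary formula
  | CopyCode vocabulary nat rel_name
  | ColourCode vocabulary "rel_name list"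
  | CompositionCode transduction_code transduction_code

instance transduction_code :: countable by countable_datatype

fun decode :: "transduction_code \<Rightarrow> (struct \<times> struct) set" where
  "decode (InterpretationCode V W \<phi> \<psi>s) = interpretation_rel V W \<phi> (\<lambda>R. the (map_of \<psi>s R))"
| "decode (FilterCode V \<phi>) = filter_rel V \<phi>"
| "decode (CopyCode V k c) = copy_rel V k c"
| "decode (ColourCode V qs) = colour_rel V qs"
| "decode (CompositionCode a b) = decode a O decode b"

lemma interpretation_rel_cong:
  assumes "\<And>R \<tau>. fmlookup W R = Some \<tau> \<Longrightarrow> \<psi> R = \<psi>' R"
  shows "interpretation_rel V W \<phi> \<psi> = interpretation_rel V W \<phi> \<psi>'"
proof -
  have "interpret_struct W \<phi> \<psi> A = interpret_struct W \<phi> \<psi>' A" for A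
    using assms unfolding interpret_struct_def Let_def by (auto split: option.splits)
  then show ?thesis by (simp add: interpretation_rel_def)
qed

lemma mso_transduction_decode: "mso_transduction V W f \<Longrightarrow> f \<in> range decode"
proof (induction rule: mso_transduction.induct)
  case (mso_interpretation V \<phi> W \<psi>)
  obtain Rs where Rs: "set Rs = fmdom' W" using finite_list[of "fmdom' W"] by auto
  let ?l = "map (\<lambda>R. (R, \<psi> R)) Rs"
  have "map_of ?l R = Some (\<psi> R)" if "R \<in> set Rs" for R
    using that by (simp add: map_of_map_restrict)
  then have "interpretation_rel V W \<phi> \<psi> = decode (InterpretationCode V W \<phi> ?l)"
    unfolding decode.simps by (intro interpretation_rel_cong) (simp add: Rs fmlookup_dom'_iff)
  then show ?case by blast
next
  case (mso_filtering V \<phi>)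
  then show ?case using rangeI[of decode "FilterCode V \<phi>"] by simp
next
  case (mso_copying k c V)
  then show ?case using rangeI[of decode "CopyCode V k c"] by simp
next
  case (mso_colouring qs V)
  then show ?case using rangeI[of decode "ColourCode V qs"] by simp
next
  case (mso_composition V W f X g)
  then obtain a b where "f = decode a" "g = decode b" by blast
  then show ?case using rangeI[of decode "CompositionCode a b"] by simp
qed

subsection \<open>The two implications\<close>

lemma unbounded_width_language:
  assumes C: "struct_class V C" and unb: "\<not> bounded_mso_width V C"
  shows "\<exists>L. language V C L \<and> recognizable V C L \<and> \<not> mso_definable V C L"
proof -
  define F :: "nat \<Rightarrow> (struct \<times> struct) set" where "F = decode \<circ> from_nat"
  have F: "\<exists>j. f = F j" if "mso_transduction V' W f" for V' W f
    using mso_transduction_decode[OF that] by (metis F_def comp_apply from_nat_to_nat rangeE)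
  have CV: "C \<subseteq> structures V" using C by (simp add: struct_class_def)
  \<comment> \<open>The guard \<open>s j \<in> C\<close> makes the choice step work for an arbitrary
    sequence \<open>s\<close>: only for members of \<open>C\<close> is the isomorphism class known
    to consist of structures over \<open>V\<close>, hence to have bounded width.\<close>
  let ?P = "\<lambda>s i x. x \<in> C \<and> (\<forall>j\<le>i. mso_transduction tree_vocab V (F j) \<longrightarrow> x \<notin> F j `` trees) \<and>
      (\<forall>j<i. s j \<in> C \<longrightarrow> \<not> s j \<simeq> x)"
  have "\<exists>s. \<forall>i. ?P s i (s i)"
  proof (rule dependent_wellorder_choice)
    fix i :: nat and s :: "nat \<Rightarrow> struct"
    define X where "X = (\<lambda>j. if mso_transduction tree_vocab V (F j) then F j `` trees else {})"
    define Y where "Y = (\<lambda>j. if s j \<in> C then {B. s j \<simeq> B} else {})"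
    have X: "bounded_mso_width V (X j)" for j
    proof (cases "mso_transduction tree_vocab V (F j)")
      case True
      then show ?thesis unfolding bounded_mso_width_def X_def by (intro exI[of _ "F j"]) simp
    qed (simp add: bounded_width_empty X_def)
    have Y: "bounded_mso_width V (Y j)" for j
    proof (cases "s j \<in> C")
      case True
      then obtain f where f: "mso_transduction tree_vocab V f" "{s j} \<subseteq> f `` trees"
        using bounded_width_singleton CV unfolding bounded_mso_width_def by blast
      then have "{B. s j \<simeq> B} \<subseteq> f `` trees" using mso_transduction_iso[OF f(1)] by blast
      then show ?thesis using f(1) True unfolding bounded_mso_width_def Y_def by (intro exI[of _ f]) simp
    qed (simp add: bounded_width_empty Y_def)
    have "bounded_mso_width V ((\<Union>j\<in>{..i}. X j) \<union> (\<Union>j\<in>{..<i}. Y j))"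
      by (rule bounded_width_Un; rule bounded_width_UN) (simp_all add: X Y)
    \<comment> \<open>All structures forbidden at stage \<open>i\<close> form a finite union of
      classes of bounded width, which cannot exhaust \<open>C\<close>.\<close>
    then have "\<not> C \<subseteq> (\<Union>j\<in>{..i}. X j) \<union> (\<Union>j\<in>{..<i}. Y j)"
      using unb bounded_width_subset[of V _ C] by iprover
    then obtain x where x: "x \<in> C" "\<And>j. j \<le> i \<Longrightarrow> x \<notin> X j" "\<And>j. j < i \<Longrightarrow> x \<notin> Y j"
      by auto
    have "x \<notin> F j `` trees" if "j \<le> i" "mso_transduction tree_vocab V (F j)" for j
      using x(2)[OF that(1)] that(2) unfolding X_def by (simp only: if_True not_False_eq_True)
    moreover have "\<not> s j \<simeq> x" if "j < i" "s j \<in> C" for j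
      using x(3)[OF that(1)] that(2) unfolding Y_def by simp
    ultimately have "?P s i x" using x(1) by blast
    then show "\<exists>x. ?P s i x" by (rule exI)
  next
    fix x and f g :: "nat \<Rightarrow> struct" and i assume eq: "\<And>j. j < i \<Longrightarrow> f j = g j"
    have "(\<forall>j<i. f j \<in> C \<longrightarrow> \<not> f j \<simeq> x) \<longleftrightarrow> (\<forall>j<i. g j \<in> C \<longrightarrow> \<not> g j \<simeq> x)"
      by (intro all_cong) (simp only: eq)
    then show "?P f i x = ?P g i x" by (simp only:)
  qed
  then obtain s where s: "\<And>i. ?P s i (s i)" by (elim exE) (rule that, erule spec)
  have sC: "\<And>i. s i \<in> C"
    and avoid: "\<And>i j. j \<le> i \<Longrightarrow> mso_transduction tree_vocab V (F j) \<Longrightarrow> s i \<notin> F j `` trees"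
    and noniso: "\<And>i j. j < i \<Longrightarrow> \<not> s j \<simeq> s i" using s by blast+
  have sV: "s i \<in> structures V" for i using sC CV by blast
  have iso_eq: "i = j" if "s i \<simeq> s j" for i j
    using that noniso iso_sym[OF sV that] by (metis nat_neq_iff)
  define L where "L = (\<lambda>S. {B. \<exists>i\<in>S. s i \<simeq> B})"
  have L_inj: "S = S'" if "L S = L S'" for S S'
  proof -
    \<comment> \<open>The chosen structures are pairwise non-isomorphic, so \<open>S\<close> can be
      read off its language.\<close>
    have "S = {i. s i \<in> L S}" for S unfolding L_def using iso_eq iso_refl by blast
    then show ?thesis using that by metis
  qed
  have LV: "L S \<subseteq> structures V" for S using iso_structures[OF sV] unfolding L_def by blast
  have lang: "language V C (L S)" for S
    unfolding language_def struct_class_def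
  proof (intro conjI ballI impI LV)
    show "B \<in> L S" if "A \<in> L S" "A \<simeq> B" for A B using that iso_trans unfolding L_def by blast
    show "L S \<subseteq> C"
    proof
      fix B assume B: "B \<in> L S"
      then obtain i where "s i \<simeq> B" unfolding L_def by blast
      then show "B \<in> C" using C sC LV B unfolding struct_class_def by blast
    qed
  qed
  have rec: "recognizable V C (L S)" for S
    unfolding recognizable_def
  proof (intro allI impI)
    fix f assume "class_transduction tree_vocab trees V C f"
    then have f: "mso_transduction tree_vocab V f" by (simp add: class_transduction_def)
    obtain m where m: "f = F m" using F[OF f] by blast
    have "definable tree_vocab Map.empty (\<lambda>t \<nu>. \<exists>B. (t, B) \<in> f \<and> s i \<simeq> B)" for i
    proof (rule definable_sentence[OF definable_isomorphic[OF sV[of i]]])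
      fix \<chi> assume \<chi>: "sentence V \<chi>" "\<And>B. B \<in> structures V \<Longrightarrow> B \<Turnstile> \<chi> \<longleftrightarrow> s i \<simeq> B"
      show ?thesis by (rule definable_cong[OF mso_transduction_backwards[OF f \<chi>(1)]])
        (use \<chi>(2) mso_transduction_structures[OF f] in blast)
    qed
    then have "definable tree_vocab Map.empty (\<lambda>t \<nu>. \<exists>i\<in>S \<inter> {..<m}. \<exists>B. (t, B) \<in> f \<and> s i \<simeq> B)"
      by (intro definable_Bex) auto
    then obtain \<phi> where \<phi>: "sentence tree_vocab \<phi>"
      "\<And>t. t \<in> structures tree_vocab \<Longrightarrow> t \<Turnstile> \<phi> \<longleftrightarrow> (\<exists>i\<in>S \<inter> {..<m}. \<exists>B. (t, B) \<in> f \<and> s i \<simeq> B)"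
      by (rule definable_sentence) blast
    have "(\<exists>B\<in>L S. (t, B) \<in> f) \<longleftrightarrow> t \<Turnstile> \<phi>" if t: "t \<in> trees" for t
    proof -
      \<comment> \<open>From stage \<open>m\<close> onwards the choice avoids all outputs of
        \<open>F m\<close> on trees, so only the finitely many indices below \<open>m\<close>
        contribute.\<close>
      have "i < m" if "(t, B) \<in> f" "s i \<simeq> B" for i B
      proof (rule ccontr)
        assume "\<not> i < m"
        moreover have "(t, s i) \<in> f" using mso_transduction_iso[OF f that(1) iso_sym[OF sV that(2)]] .
        ultimately show False using avoid[of m i] f t unfolding m by auto
      qed
      then show ?thesis using \<phi>(2)[of t] t unfolding L_def trees_def by blast
    qed
    then show "mso_definable tree_vocab trees {t \<in> trees. \<exists>A\<in>L S. (t, A) \<in> f}"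
      unfolding mso_definable_def using \<phi>(1) by blast
  qed
  \<comment> \<open>Choosing a defining sentence for every \<open>S\<close> would inject the sets of
    numbers into the countable type of formulas, against Cantor.\<close>
  have "\<exists>S. \<not> mso_definable V C (L S)"
  proof (rule ccontr)
    assume "\<nexists>S. \<not> mso_definable V C (L S)"
    then have "\<forall>S. \<exists>\<phi>. L S = {A \<in> C. A \<Turnstile> \<phi>}" unfolding mso_definable_def by blast
    then obtain g :: "nat set \<Rightarrow> formula" where g: "\<And>S. L S = {A \<in> C. A \<Turnstile> g S}" by metis
    have "inj g" using g L_inj by (metis injI)
    then have "inj (to_nat \<circ> g)" by (simp add: inj_compose)
    then have "range (inv (to_nat \<circ> g)) = UNIV" by (rule inj_imp_surj_inv)
    then have "\<exists>h :: nat \<Rightarrow> nat set. h ` UNIV = Pow UNIV" by auto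
    then show False using Cantors_theorem by metis
  qed
  then show ?thesis using lang rec by blast
qed

text \<open>The encoding may be nondeterministic, yet a single encoding tree that satisfies
  \<open>\<phi>\<close> decides membership: whatever is decoded from an encoding of \<open>A\<close>
  is isomorphic to \<open>A\<close>, and \<open>L\<close> is closed under isomorphism.\<close>

lemma encoding_recognizable_definable:
  assumes f: "mso_encoding V C tree_vocab trees f" and CV: "struct_class V C"
    and L: "language V C L" "recognizable V C L"
  shows "mso_definable V C L"
proof -
  obtain g where ft: "mso_transduction V tree_vocab f" "f `` C \<subseteq> trees"
    and g: "class_transduction tree_vocab trees V C g"
    and id: "\<And>A B. A \<in> C \<Longrightarrow> (A, B) \<in> f O g \<longleftrightarrow> A \<simeq> B"
    using f unfolding mso_encoding_def class_transduction_def by blast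
  obtain \<phi> where \<phi>: "sentence tree_vocab \<phi>" "{t \<in> trees. \<exists>A\<in>L. (t, A) \<in> g} = {t \<in> trees. t \<Turnstile> \<phi>}"
    using L(2) g unfolding recognizable_def mso_definable_def by blast
  obtain \<chi> where \<chi>: "sentence V \<chi>"
    "\<And>A. A \<in> structures V \<Longrightarrow> A \<Turnstile> \<chi> \<longleftrightarrow> (\<exists>t. (A, t) \<in> f \<and> t \<Turnstile> \<phi>)"
    by (rule definable_sentence[OF mso_transduction_backwards[OF ft(1) \<phi>(1)]]) blast
  have CV': "C \<subseteq> structures V" using CV by (simp add: struct_class_def)
  have LC: "L \<subseteq> C" and Liso: "\<And>A B. A \<in> L \<Longrightarrow> A \<simeq> B \<Longrightarrow> B \<in> structures V \<Longrightarrow> B \<in> L"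
    using L(1) unfolding language_def struct_class_def by blast+
  have "A \<in> L \<longleftrightarrow> A \<Turnstile> \<chi>" if A: "A \<in> C" for A
  proof
    assume AL: "A \<in> L"
    have "(A, A) \<in> f O g" using id[OF A] iso_refl by blast
    then obtain t where t: "(A, t) \<in> f" "(t, A) \<in> g" by blast
    then have "t \<in> trees" using ft(2) A by blast
    then have "t \<Turnstile> \<phi>" using \<phi>(2) t(2) AL by blast
    then show "A \<Turnstile> \<chi>" using \<chi>(2) A CV' t(1) by blast
  next
    assume "A \<Turnstile> \<chi>"
    then obtain t where t: "(A, t) \<in> f" "t \<Turnstile> \<phi>" using \<chi>(2) A CV' by blast
    then have "t \<in> trees" using ft(2) A by blast
    then obtain B where B: "B \<in> L" "(t, B) \<in> g" using \<phi>(2) t(2) by blast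
    then have "A \<simeq> B" using id[OF A] t(1) by blast
    then have "B \<simeq> A" using iso_sym A CV' by blast
    then show "A \<in> L" using Liso B(1) A CV' by blast
  qed
  then have "L = {A \<in> C. A \<Turnstile> \<chi>}" using LC by blast
  then show ?thesis using \<chi>(1) unfolding mso_definable_def by blast
qed

theorem mainTheorem1:
  fixes V :: vocabulary and C :: "struct set"
  assumes "struct_class V C"
  shows "(\<not> bounded_mso_width V C \<longrightarrow>
           (\<exists>L. language V C L \<and> recognizable V C L \<and> \<not> mso_definable V C L)) \<and>
         ((\<exists>f. mso_encoding V C tree_vocab trees f) \<longrightarrow>
           (\<forall>L. language V C L \<and> recognizable V C L \<longrightarrow> mso_definable V C L))"
  using unbounded_width_language[OF assms] encoding_recognizable_definable[OF _ assms] by blast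

end
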